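(* Let $\mathsf Z=\{\mathsf z_k\}\subset\mathbb C$ be a sequence without limit points in $\mathbb C$ which is separated from the imaginary axis, and let $b\in\mathbb R^+$. Then the following two statements are equivalent. (I) There exists an entire function of exponential type $f\not\equiv0$ with $f(\mathsf Z)=0$ whose growth indicator satisfies $\mathsf h_f(\pi/2)\le\pi b$ and $\mathsf h_f(-\pi/2)\le\pi b$. (II) There exist a constant $C\in\mathbb R^+$ and a bounded function $d\colon\mathbb R^+\to\mathbb R^+$ with $\lim_{x\to+\infty}d(x)=0$ such that $$l_{\mathsf Z}(r,R)\le\bigl(b+d(R)\bigr)\ln\frac Rr+C\quad\text{for all }0<r<R<+\infty.$$
   Context: Notation: $\mathbb R^+=\{x\in\mathbb R: x\ge 0\}$. Sequences $\mathsf Z=\{\mathsf z_k\}_{k=1,2,\dots}\subset\mathbb C$ may have repeated terms. "Without limit points in $\mathbb C$" means that every bounded set contains $\mathsf z_k$ for only finitely many indices $k$. $\mathsf Z$ is separated from the imaginary axis $i\mathbb R$ if $\liminf_{k\to\infty}|\operatorname{Re}\mathsf z_k|/|\mathsf z_k|>0$; geometrically, there is a pair of nonempty open vertical angles containing $i\mathbb R\setminus\{0\}$ such that $\mathsf z_k$ lies outside them for all sufficiently large $k$. An entire function $f$ is of exponential type if $\limsup_{z\to\infty}\frac{\ln|f(z)|}{|z|}<+\infty$. Its growth indicator is $\mathsf h_f(\theta):=\limsup_{r\to+\infty}\frac{\ln|f(re^{i\theta})|}{r}$, $\theta\in\mathbb R$. An entire function $f$ vanishes on $\mathsf Z$, written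 $f(\mathsf Z)=0$, if for every $z\in\mathbb C$ the multiplicity of the zero of $f$ at $z$ is at least the number of occurrences of $z$ in $\mathsf Z$. For $0<r<R<+\infty$, $$l_{\mathsf Z}(r,R):=\max\Bigl\{\sum_{\substack{r<|\mathsf z_k|\le R\\ \operatorname{Re}\mathsf z_k>0}}\operatorname{Re}\frac1{\mathsf z_k},\ \sum_{\substack{r<|\mathsf z_k|\le R\\ \operatorname{Re}\mathsf z_k<0}}\operatorname{Re}\Bigl(-\frac1{\mathsf z_k}\Bigr)\Bigr\}.$$ *)

theory Defs
  imports "HOL-Complex_Analysis.Complex_Analysis"
begin

text \<open>
  A sequence of points is a function \<open>Z :: nat \<Rightarrow> complex\<close>; the numbering starts at \<open>0\<close> instead
  of \<open>1\<close>, and repeated values are allowed.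
\<close>

definition no_limit_points :: "(nat \<Rightarrow> complex) \<Rightarrow> bool" where
  "no_limit_points Z \<longleftrightarrow> (\<forall>S. bounded S \<longrightarrow> finite {k. Z k \<in> S})"

text \<open>
  In the absence of limit points only finitely many terms are \<open>0\<close>, so the convention
  \<open>0 / 0 = 0\<close> has no influence on the lower limit.
\<close>

definition separated_from_imaginary_axis :: "(nat \<Rightarrow> complex) \<Rightarrow> bool" where
  "separated_from_imaginary_axis Z \<longleftrightarrow>
     0 < liminf (\<lambda>k. ereal (\<bar>Re (Z k)\<bar> / norm (Z k)))"

text \<open>
  The logarithm of a modulus takes values in the extended reals with \<open>ln 0 = - \<infinity>\<close>; the
  library's real \<^const>\<open>ln\<close> is \<open>0\<close> at \<open>0\<close>.
\<close>

definition ln_norm :: "complex \<Rightarrow> ereal" where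
  "ln_norm w = (if w = 0 then - \<infinity> else ereal (ln (norm w)))"

definition entire_of_exponential_type :: "(complex \<Rightarrow> complex) \<Rightarrow> bool" where
  "entire_of_exponential_type f \<longleftrightarrow>
     f holomorphic_on UNIV \<and>
     Limsup at_infinity (\<lambda>z. ln_norm (f z) / ereal (norm z)) < \<infinity>"

definition growth_indicator :: "(complex \<Rightarrow> complex) \<Rightarrow> real \<Rightarrow> ereal" where
  "growth_indicator f \<theta> =
     Limsup at_top (\<lambda>r::real. ln_norm (f (of_real r * cis \<theta>)) / ereal r)"

text \<open>
  Intended for entire \<open>f\<close>. The zero function has zeros of infinite multiplicity, which \<^const>\<open>zorder\<close>
  does not express; for any other entire \<open>f\<close>, \<open>zorder f z\<close> is the multiplicity of the zero at \<open>z\<close>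
  (\<open>0\<close> if \<open>f z \<noteq> 0\<close>). Finiteness is required because the cardinality of an infinite set is \<open>0\<close>.
\<close>

definition vanishes_on :: "(complex \<Rightarrow> complex) \<Rightarrow> (nat \<Rightarrow> complex) \<Rightarrow> bool" where
  "vanishes_on f Z \<longleftrightarrow>
     f = (\<lambda>_. 0) \<or>
     (\<forall>z. finite {k. Z k = z} \<and> int (card {k. Z k = z}) \<le> zorder f z)"

text \<open>The sums are finite whenever \<open>Z\<close> has no limit points.\<close>

definition log_submeasure :: "(nat \<Rightarrow> complex) \<Rightarrow> real \<Rightarrow> real \<Rightarrow> real" where
  "log_submeasure Z r R = max
     (\<Sum>k\<in>{k. r < norm (Z k) \<and> norm (Z k) \<le> R \<and> Re (Z k) > 0}. Re (1 / Z k))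
     (\<Sum>k\<in>{k. r < norm (Z k) \<and> norm (Z k) \<le> R \<and> Re (Z k) < 0}. Re (- (1 / Z k)))"

end

theory Submission
  imports Defs "HOL-Real_Asymp.Real_Asymp"
begin

text \<open>
  Throughout, \<open>l(r, R)\<close> is the value \<open>log_submeasure Z r R\<close> and \<open>f\<close> is an entire function of
  exponential type.

  \<^bold>\<open>A function forces the bound.\<close> It is enough to treat the zeros \<open>z\<^sub>k\<close> in the right half plane,
  since \<open>f(- z)\<close> takes care of the others. Replacing in \<open>f\<close> every factor \<open>z - z\<^sub>k\<close> with
  \<open>10 r < |z\<^sub>k| \<le> R\<close> by \<open>z + cnj z\<^sub>k\<close> gives an entire function \<open>F\<close> with \<open>|F| = |f|\<close> on the imaginary
  axis, and near the point \<open>r\<close> one has \<open>ln |F / f| = 2 Re z \<Sum> Re (1 / z\<^sub>k) + O(r)\<close>. By the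
  Phragmen-Lindeloef principle in the two quadrants, \<open>|f| \<le> M exp (\<sigma> Re z + \<pi> \<beta> |Im z|)\<close> in the
  right half plane for each \<open>\<beta> > b\<close>. If \<open>K\<close> is large, the real part of
  \<open>V(z) = - 2 \<beta> z (Ln (1 + z) - ln (2 R)) + K z\<close> exceeds \<open>\<sigma> Re z + \<pi> \<beta> |Im z|\<close> on the half disc
  \<open>|z| < 2 R\<close> up to an additive constant, so the maximum principle bounds \<open>|F|\<close> inside by \<open>M |exp V|\<close>
  up to a constant factor; near \<open>r\<close> the exponent is only \<open>2 \<beta> Re z ln (R / r) + O(r)\<close>. Comparing both
  at a point close to \<open>r\<close> where \<open>|f| \<ge> exp (- C r)\<close> gives \<open>\<Sum> Re (1 / z\<^sub>k) \<le> \<beta> ln (R / r) + O(1)\<close>, and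
  the constant does not depend on \<open>\<beta>\<close>; the choice of
  \<open>\<beta>\<close> only restricts \<open>r\<close> to large values. That is \<open>zero_sum_right_half_plane\<close>; because of this
  uniformity the excess slope can be collected in a function \<open>d\<close> with limit \<open>0\<close>
  (\<open>slope_error_function\<close>).

  \<^bold>\<open>The bound yields a function.\<close> The hypothesis on \<open>l\<close> is first made discrete: there are integers
  \<open>m j \<ge> 0\<close> with mean value \<open>b\<close> at infinity such that \<open>l(i, J)\<close> exceeds the sum of \<open>m j / j\<close> over
  \<open>i < j \<le> J\<close> at most by a constant (\<open>reference_multiplicities\<close>). In each half plane, positive
  (respectively negative) integers are then added to the zeros until the sums of \<open>|Re (1 / z\<^sub>k)|\<close>
  agree with those of \<open>m j / j\<close> up to a constant on every range of moduli (\<open>family_with_fillers\<close>).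
  For such a balanced family \<open>p\<^sub>i\<close> in the right half plane, the product of
  \<open>(1 - z / p\<^sub>i) / (1 + z / cnj p\<^sub>i)\<close> and of \<open>(1 + z / j) ^ (2 m j)\<close> has a logarithm of its modulus of
  size \<open>O(|z|)\<close> off the cones that contain its zeros and poles, because the linear terms cancel
  (\<open>half_plane_product_le\<close>, \<open>half_plane_product_ge\<close>). On the imaginary axis its modulus is the product
  of \<open>(1 + y\<^sup>2 / j\<^sup>2) ^ m j\<close>, which grows like \<open>exp (\<pi> b |y|)\<close> since the product of \<open>1 + y\<^sup>2 / j\<^sup>2\<close> is
  \<open>sinh (\<pi> y) / (\<pi> y)\<close>; in particular it is the same for both half planes.

  Let \<open>a\<close> be this product for the right half plane and \<open>a'\<close> the reflected product for the left one,
  multiplied by \<open>exp (D z)\<close> and \<open>exp (- D z)\<close>. For large \<open>D\<close> the quotient \<open>a' / a\<close> is exponentially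
  small near the boundary of a large triangle around the right cone, and so \<open>a + a'\<close> differs there from
  \<open>a\<close> by a factor close to \<open>1\<close>. The logarithm of this factor is a difference \<open>\<Phi>i - \<Phi>o\<close> of functions that
  are bounded and holomorphic inside and outside of the triangle (\<open>cousin_splitting\<close>). Consequently
  \<open>a exp \<Phi>i\<close> inside and \<open>(a + a') exp \<Phi>o\<close> outside fit together; the same is done with the left
  triangle, and an entire function arises that has the zeros of both families (\<open>glued_function\<close>). All
  of this is done with the finitely many zeros of modulus at most \<open>n\<close>, with bounds that are uniform in
  \<open>n\<close>, and a limit by Montel's theorem (\<open>entire_limit\<close>) followed by multiplication with finitely many
  factors \<open>z - z\<^sub>k\<close> gives the required function.
\<close>

section \<open>Products and zeros of entire functions\<close>

text \<open>
  The linear term of the exponent is \<open>Re w\<close> and not \<open>norm w\<close>, here and in the lower bound that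
  follows: in the products below these linear terms cancel, and only the squares remain.
\<close>

lemma norm_one_plus_le:
  fixes w :: complex
  shows "norm (1 + w) \<le> exp (Re w + (norm w)\<^sup>2)"
proof -
  have n2: "(norm (1 + w))\<^sup>2 = 1 + (2 * Re w + (norm w)\<^sup>2)"
    by (simp add: cmod_power2) (simp add: power2_eq_square algebra_simps)
  have "(norm (1 + w))\<^sup>2 \<le> exp (2 * Re w + (norm w)\<^sup>2)"
    unfolding n2 by (rule exp_ge_add_one_self)
  also have "\<dots> \<le> exp (2 * (Re w + (norm w)\<^sup>2))"
    by simp
  also have "\<dots> = (exp (Re w + (norm w)\<^sup>2))\<^sup>2"
    by (rule exp_double)
  finally show ?thesis
    by (rule power2_le_imp_le) simp
qed

lemma norm_one_plus_ge:
  fixes w :: complex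
  assumes "norm w \<le> 1/5"
  shows "exp (Re w - 5 * (norm w)\<^sup>2) \<le> norm (1 + w)"
proof -
  define x where "x = 2 * Re w + (norm w)\<^sup>2"
  have n2: "(norm (1 + w))\<^sup>2 = 1 + x"
    unfolding x_def by (simp add: cmod_power2) (simp add: power2_eq_square algebra_simps)
  have re: "\<bar>Re w\<bar> \<le> norm w" by (rule abs_Re_le_cmod)
  have w2: "(norm w)\<^sup>2 \<le> (1/5) * norm w"
    unfolding power2_eq_square by (intro mult_right_mono assms) auto
  have ax: "\<bar>x\<bar> \<le> (11/5) * norm w"
    using re w2 zero_le_power2[of "norm w"] unfolding x_def abs_le_iff by linarith
  then have ax2: "\<bar>x\<bar> \<le> 1/2" using assms by linarith
  have x2: "x\<^sup>2 \<le> 5 * (norm w)\<^sup>2"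
  proof -
    have "x\<^sup>2 \<le> ((11/5) * norm w)\<^sup>2"
      using ax by (metis abs_ge_zero power2_abs power_mono)
    also have "\<dots> \<le> 5 * (norm w)\<^sup>2"
      by (simp add: power_mult_distrib power2_eq_square)
    finally show ?thesis .
  qed
  have "\<bar>ln (1 + x) - x\<bar> \<le> 2 * x\<^sup>2"
    using ax2 by (rule abs_ln_one_plus_x_minus_x_bound)
  then have "x - 2 * x\<^sup>2 \<le> ln (1 + x)" by linarith
  then have "exp (x - 2 * x\<^sup>2) \<le> 1 + x"
    using ax2 by (subst ln_ge_iff [symmetric]) auto
  moreover have "2 * (Re w - 5 * (norm w)\<^sup>2) \<le> x - 2 * x\<^sup>2"
  proof -
    have "x - 10 * (norm w)\<^sup>2 \<le> x - 2 * x\<^sup>2" using x2 by simp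
    moreover have "2 * (Re w - 5 * (norm w)\<^sup>2) \<le> x - 10 * (norm w)\<^sup>2"
      unfolding x_def by simp
    ultimately show ?thesis by (rule order_trans [rotated])
  qed
  ultimately have "exp (2 * (Re w - 5 * (norm w)\<^sup>2)) \<le> 1 + x"
    by (smt (verit) exp_le_cancel_iff)
  then have "(exp (Re w - 5 * (norm w)\<^sup>2))\<^sup>2 \<le> (norm (1 + w))\<^sup>2"
    unfolding n2 by (subst exp_double [symmetric])
  then show ?thesis
    by (rule power2_le_imp_le) simp
qed

text \<open>
  Between \<open>r\<close> and \<open>2 * r\<close> there are at most \<open>2 * N * r\<close> terms of size at most \<open>1 / r\<^sup>2\<close>; the dyadic
  blocks then form a geometric series.
\<close>

lemma sum_inverse_square_tail:
  fixes u :: "'i \<Rightarrow> real"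
  assumes fin: "finite I" and N: "0 \<le> N" and r: "0 < r"
    and dens: "\<And>t. r \<le> t \<Longrightarrow> real (card {i\<in>I. u i \<le> t}) \<le> N * t"
  shows "(\<Sum>i\<in>{i\<in>I. r < u i}. 1 / (u i)\<^sup>2) \<le> 4 * N / r"
proof -
  obtain M :: nat where M: "\<And>i. i \<in> I \<Longrightarrow> u i \<le> 2 ^ M * r"
  proof -
    obtain B where B: "\<And>i. i \<in> I \<Longrightarrow> u i \<le> B"
      using bdd_above_finite[OF finite_imageI[OF fin, of u]] by (auto simp: bdd_above_def)
    obtain M where "B / r < 2 ^ M" using real_arch_pow [of 2 "B/r"] by auto
    then have "B \<le> 2 ^ M * r" using r by (simp add: field_simps)
    with B show thesis by (intro that [of M]) (meson order_trans)
  qed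
  have "(\<Sum>i\<in>{i\<in>I. r < u i}. 1 / (u i)\<^sup>2) \<le> 4 * N / r"
    if "0 < r" "\<And>i. i \<in> I \<Longrightarrow> u i \<le> 2 ^ M * r"
      "\<And>t. r \<le> t \<Longrightarrow> real (card {i\<in>I. u i \<le> t}) \<le> N * t" for r
    using that
  proof (induction M arbitrary: r)
    case 0
    then have "{i\<in>I. r < u i} = {}" by force
    then have "(\<Sum>i\<in>{i\<in>I. r < u i}. 1 / (u i)\<^sup>2) = 0" by (metis sum.empty)
    then show ?case using N 0 by simp
  next
    case (Suc M)
    have split: "{i\<in>I. r < u i} = {i\<in>I. r < u i \<and> u i \<le> 2*r} \<union> {i\<in>I. 2*r < u i}"
      using Suc.prems(1) by auto
    have "(\<Sum>i\<in>{i\<in>I. r < u i}. 1 / (u i)\<^sup>2) =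
        (\<Sum>i\<in>{i\<in>I. r < u i \<and> u i \<le> 2*r}. 1 / (u i)\<^sup>2) + (\<Sum>i\<in>{i\<in>I. 2*r < u i}. 1 / (u i)\<^sup>2)"
      unfolding split by (rule sum.union_disjoint) (use fin in auto)
    moreover have "(\<Sum>i\<in>{i\<in>I. 2*r < u i}. 1 / (u i)\<^sup>2) \<le> 4 * N / (2*r)"
      by (rule Suc.IH) (use Suc.prems in \<open>auto simp: mult_ac\<close>)
    moreover have "(\<Sum>i\<in>{i\<in>I. r < u i \<and> u i \<le> 2*r}. 1 / (u i)\<^sup>2) \<le> 2 * N / r"
    proof -
      have "(\<Sum>i\<in>{i\<in>I. r < u i \<and> u i \<le> 2*r}. 1 / (u i)\<^sup>2)
          \<le> (\<Sum>i\<in>{i\<in>I. r < u i \<and> u i \<le> 2*r}. 1 / r\<^sup>2)"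
        using Suc.prems(1) by (intro sum_mono divide_left_mono power_mono mult_pos_pos) auto
      also have "\<dots> = real (card {i\<in>I. r < u i \<and> u i \<le> 2*r}) / r\<^sup>2"
        by simp
      also have "\<dots> \<le> real (card {i\<in>I. u i \<le> 2*r}) / r\<^sup>2"
        by (intro divide_right_mono of_nat_mono card_mono) (use fin in auto)
      also have "\<dots> \<le> N * (2*r) / r\<^sup>2"
        using Suc.prems by (intro divide_right_mono) auto
      also have "\<dots> = 2 * N / r" using Suc.prems(1) by (simp add: power2_eq_square)
      finally show ?thesis .
    qed
    ultimately show ?case using Suc.prems(1) by (simp add: field_simps)
  qed
  then show ?thesis using r M dens by blast
qed

lemma entire_nonzero:
  assumes hol: "f holomorphic_on UNIV" and nz: "f \<noteq> (\<lambda>_. 0)"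
  shows "\<forall>\<^sub>F w in at z. f w \<noteq> 0" and "\<exists>\<^sub>F w in at z. f w \<noteq> 0" and "f analytic_on {z}"
proof -
  obtain z0 where z0: "f z0 \<noteq> 0" using nz by auto
  show ev: "\<forall>\<^sub>F w in at z. f w \<noteq> 0"
    using non_zero_neighbour_alt[OF hol open_UNIV connected_UNIV UNIV_I UNIV_I z0]
    by (auto elim: eventually_mono)
  then show "\<exists>\<^sub>F w in at z. f w \<noteq> 0" by (simp add: eventually_frequently)
  show "f analytic_on {z}" using hol by (simp add: analytic_on_open analytic_on_subset[of _ UNIV])
qed

text \<open>
  Multiplicities are counted by indices, so the induction removes one simple factor at a time and
  repeated terms of \<open>Z\<close> need no special treatment.
\<close>

lemma entire_divide_by_zeros:
  fixes f :: "complex \<Rightarrow> complex"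
  assumes "finite I" "f holomorphic_on UNIV" "f \<noteq> (\<lambda>_. 0)"
    and "\<And>z. int (card {k\<in>I. Z k = z}) \<le> zorder f z"
  shows "\<exists>h. h holomorphic_on UNIV \<and> (\<forall>z. f z = (\<Prod>k\<in>I. z - Z k) * h z)"
  using assms
proof (induction I arbitrary: f rule: finite_induct)
  case empty
  then show ?case by auto
next
  case (insert k I)
  note ev = entire_nonzero(1)[OF insert.prems(1,2)] and freq = entire_nonzero(2)[OF insert.prems(1,2)]
    and ana = entire_nonzero(3)[OF insert.prems(1,2)]
  have "0 < zorder f (Z k)"
  proof -
    have "0 < card {i\<in>insert k I. Z i = Z k}"
      using insert.hyps by (simp add: card_gt_0_iff) blast
    then show ?thesis using insert.prems(3)[of "Z k"] by linarith
  qed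
  then have fk: "f (Z k) = 0"
    using zorder_pos_iff'[OF ana freq] by blast
  define g where "g z = (if z = Z k then deriv f (Z k) else (f z - f (Z k)) / (z - Z k))" for z
  have holg: "g holomorphic_on UNIV"
    unfolding g_def by (rule pole_lemma[OF insert.prems(1)]) auto
  have fg: "f z = (z - Z k) * g z" for z
    using fk by (auto simp: g_def)
  have gnz: "g \<noteq> (\<lambda>_. 0)" using insert.prems(2) fg by (metis mult_zero_right)
  have anag: "g analytic_on {z}" for z
    using holg by (simp add: analytic_on_open analytic_on_subset[of _ UNIV])
  have zo: "zorder f z = zorder (\<lambda>w. w - Z k) z + zorder g z" for z
  proof -
    have "zorder (\<lambda>w. (w - Z k) * g w) z = zorder (\<lambda>w. w - Z k) z + zorder g z"
    proof (rule zorder_times_analytic)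
      show "(\<lambda>w. w - Z k) analytic_on {z}" by (intro analytic_intros)
      show "\<forall>\<^sub>F w in at z. (w - Z k) * g w \<noteq> 0" using ev[of z] by (simp add: fg)
    qed (rule anag)
    then show ?thesis using fg by presburger
  qed
  have z1: "zorder (\<lambda>w. w - Z k) (Z k) = 1"
    by (rule zorder_eqI[of UNIV _ "\<lambda>_. 1"]) auto
  have z2: "zorder (\<lambda>w. w - Z k) z = 0" if "z \<noteq> Z k" for z
    by (rule zorder_eq_0I) (use that in \<open>auto intro!: analytic_intros\<close>)
  have "int (card {i\<in>I. Z i = z}) \<le> zorder g z" for z
  proof (cases "z = Z k")
    case True
    have "{i\<in>insert k I. Z i = z} = insert k {i\<in>I. Z i = z}" using True by auto
    then have "card {i\<in>insert k I. Z i = z} = Suc (card {i\<in>I. Z i = z})"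
      using insert.hyps by simp
    then show ?thesis using insert.prems(3)[of z] zo[of z] z1 True by simp
  next
    case False
    then have "{i\<in>insert k I. Z i = z} = {i\<in>I. Z i = z}" by auto
    then show ?thesis using insert.prems(3)[of z] zo[of z] z2[OF False] by simp
  qed
  then obtain h where h: "h holomorphic_on UNIV" "\<And>z. g z = (\<Prod>k\<in>I. z - Z k) * h z"
    using insert.IH[OF holg gnz] by blast
  show ?case
    by (rule exI[of _ h]) (use h fg insert.hyps in \<open>auto simp: mult_ac\<close>)
qed

text \<open>
  An upper bound by a power of \<open>norm (z - w)\<close> passes to pointwise limits of functions, whereas the
  order of a zero is not visible in a pointwise limit.
\<close>

lemma zorder_ge_of_bound:
  fixes f :: "complex \<Rightarrow> complex"
  assumes hol: "f holomorphic_on UNIV" and nz: "f \<noteq> (\<lambda>_. 0)"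
    and \<rho>: "0 < \<rho>" and bd: "\<And>z. z \<in> ball w \<rho> \<Longrightarrow> norm (f z) \<le> B * norm (z - w) ^ p"
  shows "int p \<le> zorder f w"
proof -
  obtain z0 where z0: "f z0 \<noteq> 0" using nz by auto
  have "\<exists>w\<in>UNIV. f w \<noteq> 0" using z0 by auto
  from zorder_exist_zero[OF hol open_UNIV connected_UNIV UNIV_I this]
  obtain g r where g: "if f w = 0 then zorder f w > 0 else zorder f w = 0"
     "r > 0" "cball w r \<subseteq> UNIV" "g holomorphic_on cball w r"
     "\<forall>z\<in>cball w r. f z = g z * (z - w) ^ nat (zorder f w) \<and> g z \<noteq> 0"
    by blast
  define q where "q = nat (zorder f w)"
  have q: "zorder f w = int q" using g(1) by (auto simp: q_def split: if_splits)
  show ?thesis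
  proof (rule ccontr)
    assume "\<not> int p \<le> zorder f w"
    then have qp: "q < p" using q by simp
    have contg: "g \<midarrow>w\<rightarrow> g w"
      using g(2) holomorphic_on_imp_continuous_on[OF g(4)]
      by (metis centre_in_ball continuous_on_interior interior_cball isCont_def)
    have "eventually (\<lambda>z. norm (g z) \<le> B * norm (z - w) ^ (p - q)) (at w)"
    proof -
      have "eventually (\<lambda>z. z \<in> ball w (min \<rho> r) - {w}) (at w)"
        using g(2) \<rho> by (intro eventually_at_in_open) auto
      then show ?thesis
      proof eventually_elim
        case (elim z)
        then have "norm (f z) \<le> B * norm (z - w) ^ p" by (intro bd) auto
        moreover have "f z = g z * (z - w) ^ q" using elim g(5) q_def by auto
        moreover have "norm (z - w) ^ p = norm (z - w) ^ (p - q) * norm (z - w) ^ q"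
          using qp by (simp flip: power_add)
        moreover have "norm (z - w) ^ q > 0" using elim by simp
        ultimately show ?case
          by (simp add: norm_mult norm_power flip: mult.assoc)
      qed
    qed
    moreover have "((\<lambda>z. B * norm (z - w) ^ (p - q)) \<longlongrightarrow> B * norm (w - w) ^ (p - q)) (at w)"
      by (intro tendsto_intros)
    ultimately have "norm (g w) \<le> B * norm (w - w) ^ (p - q)"
      using contg by (intro tendsto_le[OF _ _ tendsto_norm]) auto
    then have "norm (g w) \<le> 0" using qp by (simp add: zero_power)
    then have "g w = 0" by simp
    then show False using g(2,5) by auto
  qed
qed

lemma holomorphic_reflect:
  fixes f :: "complex \<Rightarrow> complex"
  assumes "f holomorphic_on S"
  shows "(\<lambda>z. f (- z)) holomorphic_on {z. - z \<in> S}"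
  using holomorphic_on_compose_gen[OF holomorphic_on_minus[OF holomorphic_on_ident] assms, of "{z. - z \<in> S}"]
  by (auto simp: o_def)

section \<open>Growth in the right half plane\<close>

text \<open>
  Any closed set around \<open>S\<close> will do for \<open>K\<close>, so the frontier of \<open>S\<close> never has to be determined.
\<close>

lemma max_modulus_closed:
  assumes "open S" "bounded S" "closed K" "S \<subseteq> K" "f holomorphic_on S" "continuous_on K f"
    and "\<And>z. z \<in> K - S \<Longrightarrow> norm (f z) \<le> B" "\<xi> \<in> K"
  shows "norm (f \<xi>) \<le> B"
proof (cases "\<xi> \<in> S")
  case True
  have cl: "closure S \<subseteq> K" using assms by (simp add: closure_minimal)
  show ?thesis
  proof (rule maximum_modulus_frontier[OF _ _ assms(2) _ True])
    show "f holomorphic_on interior S" using assms by (simp add: interior_open)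
    show "continuous_on (closure S) f" using assms(6) cl by (rule continuous_on_subset)
    show "norm (f z) \<le> B" if "z \<in> frontier S" for z
      using that cl assms(1,7) by (auto simp: frontier_def interior_open)
  qed
qed (use assms in auto)

lemma exponential_type_bound:
  assumes "entire_of_exponential_type f"
  obtains A \<sigma> where "1 \<le> A" "0 \<le> \<sigma>" "\<And>z. norm (f z) \<le> A * exp (\<sigma> * norm z)"
proof -
  have hol: "f holomorphic_on UNIV"
    and lim: "Limsup at_infinity (\<lambda>z. ln_norm (f z) / ereal (norm z)) < \<infinity>"
    using assms by (auto simp: entire_of_exponential_type_def)
  obtain c :: real where c: "Limsup at_infinity (\<lambda>z. ln_norm (f z) / ereal (norm z)) < ereal c"
    using lim less_PInf_Ex_of_nat by (metis ereal_dense2)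
  from Limsup_lessD[OF c] obtain \<rho> where \<rho>:
      "\<And>z. \<rho> \<le> norm z \<Longrightarrow> ln_norm (f z) / ereal (norm z) < ereal c"
    by (auto simp: eventually_at_infinity)
  define \<sigma> where "\<sigma> = max 0 c"
  have far: "norm (f z) \<le> exp (\<sigma> * norm z)" if z: "max 1 \<rho> \<le> norm z" for z
  proof (cases "f z = 0")
    case False
    have nz: "norm z > 0" using z by linarith
    have "ln (norm (f z)) / norm z < c"
      using \<rho>[of z] z False nz by (simp add: ln_norm_def)
    then have "ln (norm (f z)) < c * norm z" using nz by (simp add: field_simps)
    also have "\<dots> \<le> \<sigma> * norm z" unfolding \<sigma>_def by (intro mult_right_mono) auto
    finally have "exp (ln (norm (f z))) < exp (\<sigma> * norm z)" by simp
    then show ?thesis using False by simp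
  qed auto
  have "bounded (f ` cball 0 (max 1 \<rho>))"
    by (intro compact_imp_bounded compact_continuous_image holomorphic_on_imp_continuous_on
        holomorphic_on_subset[OF hol]) auto
  then obtain M where M: "\<And>z. norm z \<le> max 1 \<rho> \<Longrightarrow> norm (f z) \<le> M"
    unfolding bounded_iff by (force simp: mem_cball_0)
  show thesis
  proof (rule that [of "max 1 M" \<sigma>])
    show "norm (f z) \<le> max 1 M * exp (\<sigma> * norm z)" for z
    proof (cases "norm z \<le> max 1 \<rho>")
      case True
      have "norm (f z) \<le> max 1 M * 1" using M[OF True] by simp
      also have "\<dots> \<le> max 1 M * exp (\<sigma> * norm z)"
        by (intro mult_left_mono) (auto simp: \<sigma>_def)
      finally show ?thesis .
    next
      case False
      then have "max 1 \<rho> \<le> norm z" by linarith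
      then have "norm (f z) \<le> 1 * exp (\<sigma> * norm z)" using far[of z] by simp
      also have "\<dots> \<le> max 1 M * exp (\<sigma> * norm z)" by (intro mult_right_mono) auto
      finally show ?thesis .
    qed
  qed (auto simp: \<sigma>_def)
qed

lemma growth_indicator_bound:
  assumes "growth_indicator f \<theta> \<le> ereal g" "0 < \<epsilon>"
  obtains Y where "\<And>r. Y \<le> r \<Longrightarrow> norm (f (of_real r * cis \<theta>)) \<le> exp ((g + \<epsilon>) * r)"
proof -
  have "growth_indicator f \<theta> < ereal (g + \<epsilon>)"
    using assms by (meson ereal_less_eq(3) less_add_same_cancel1 less_ereal.simps(1) order_le_less_trans)
  from Limsup_lessD[OF this[unfolded growth_indicator_def]] obtain Y where Y:
      "\<And>r. Y \<le> r \<Longrightarrow> ln_norm (f (of_real r * cis \<theta>)) / ereal r < ereal (g + \<epsilon>)"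
    by (auto simp: eventually_at_top_linorder)
  show thesis
  proof (rule that [of "max 1 Y"])
    show "norm (f (of_real r * cis \<theta>)) \<le> exp ((g + \<epsilon>) * r)" if r: "max 1 Y \<le> r" for r
    proof (cases "f (of_real r * cis \<theta>) = 0")
      case False
      have "ln (norm (f (of_real r * cis \<theta>))) / r < g + \<epsilon>"
        using Y[of r] r False by (simp add: ln_norm_def)
      then have "ln (norm (f (of_real r * cis \<theta>))) < (g + \<epsilon>) * r"
        using r by (simp add: field_simps)
      then have "exp (ln (norm (f (of_real r * cis \<theta>)))) < exp ((g + \<epsilon>) * r)" by simp
      then show ?thesis using False by simp
    qed auto
  qed
qed

lemma imaginary_axis_bound:
  assumes f: "1 \<le> A" "0 \<le> \<sigma>" "\<And>z. norm (f z) \<le> A * exp (\<sigma> * norm z)"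
    and gr: "growth_indicator f (pi / 2) \<le> ereal g" "growth_indicator f (- pi / 2) \<le> ereal g"
    and pos: "0 \<le> g" "0 < \<epsilon>"
  obtains M where "A \<le> M" "\<And>y. norm (f (\<i> * of_real y)) \<le> M * exp ((g + \<epsilon>) * \<bar>y\<bar>)"
proof -
  obtain Y1 where Y1: "\<And>r. Y1 \<le> r \<Longrightarrow> norm (f (of_real r * cis (pi/2))) \<le> exp ((g + \<epsilon>) * r)"
    using growth_indicator_bound[OF gr(1) pos(2)] by blast
  obtain Y2 where Y2: "\<And>r. Y2 \<le> r \<Longrightarrow> norm (f (of_real r * cis (-pi/2))) \<le> exp ((g + \<epsilon>) * r)"
    using growth_indicator_bound[OF gr(2) pos(2)] by blast
  define Y where "Y = max 0 (max Y1 Y2)"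
  define M where "M = A * exp (\<sigma> * Y)"
  have cm: "cis (- pi / 2) = - \<i>" by (simp add: complex_eq_iff)
  have MA: "A \<le> M" unfolding M_def using f(1,2) by (simp add: Y_def)
  show thesis
  proof (rule that [OF MA])
    fix y :: real
    have e1: "1 \<le> exp ((g + \<epsilon>) * \<bar>y\<bar>)" using pos by simp
    show "norm (f (\<i> * of_real y)) \<le> M * exp ((g + \<epsilon>) * \<bar>y\<bar>)"
    proof (cases "\<bar>y\<bar> \<le> Y")
      case True
      have "norm (f (\<i> * of_real y)) \<le> A * exp (\<sigma> * \<bar>y\<bar>)" using f(3)[of "\<i> * of_real y"] by (simp add: norm_mult)
      also have "\<dots> \<le> M * 1" unfolding M_def using f(1,2) True by (simp add: mult_left_mono)
      also have "\<dots> \<le> M * exp ((g + \<epsilon>) * \<bar>y\<bar>)" using e1 MA f(1) by (intro mult_left_mono) auto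
      finally show ?thesis .
    next
      case False
      have "norm (f (\<i> * of_real y)) \<le> 1 * exp ((g + \<epsilon>) * \<bar>y\<bar>)"
      proof (cases "y \<ge> 0")
        case True
        then show ?thesis using Y1[of y] False by (simp add: Y_def mult.commute)
      next
        case neg: False
        then show ?thesis using Y2[of "-y"] False cm by (simp add: Y_def mult.commute)
      qed
      also have "\<dots> \<le> M * exp ((g + \<epsilon>) * \<bar>y\<bar>)" using MA f(1) by (intro mult_right_mono) auto
      finally show ?thesis .
    qed
  qed
qed

text \<open>
  In the sector \<open>|arg w| \<le> \<pi> / 4\<close> the power \<open>w powr (3 / 2)\<close> has an argument of at most
  \<open>3 * \<pi> / 8\<close>, so its real part is comparable with its modulus and outgrows every linear function.
\<close>

lemma Re_mult_csqrt_ge: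
  assumes "\<bar>Im w\<bar> \<le> Re w" "w \<noteq> 0"
  shows "norm w * sqrt (norm w) / 8 \<le> Re (w * csqrt w)"
proof -
  define u where "u = Re (csqrt w)" define v where "v = Im (csqrt w)"
  have sq: "csqrt w * csqrt w = w" by (metis power2_csqrt power2_eq_square)
  have re: "Re w = u\<^sup>2 - v\<^sup>2" using arg_cong[OF sq, of Re] by (simp add: u_def v_def power2_eq_square)
  have u0: "0 \<le> u" unfolding u_def by (rule csqrt_principal [of w, THEN disjE]) auto
  have rw: "0 < Re w" using assms by (metis abs_ge_zero abs_le_zero_iff complex_eqI less_eq_real_def
        order_antisym_conv order_trans zero_complex.sel)
  have nc: "norm (csqrt w) = sqrt (norm w)" by (simp add: norm_csqrt)
  have ub: "u \<le> sqrt (norm w)" "\<bar>v\<bar> \<le> sqrt (norm w)"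
    unfolding u_def v_def nc [symmetric] by (rule complex_Re_le_cmod, rule abs_Im_le_cmod)
  have n2: "norm w \<le> 2 * Re w"
    using cmod_le[of w] assms rw by linarith
  have pos: "0 < sqrt (norm w)" using assms by simp
  have vu: "\<bar>v\<bar> \<le> u"
    using re rw u0 by (metis abs_ge_zero abs_le_square_iff abs_of_nonneg less_eq_real_def diff_gt_0_iff_gt)
  have prod: "(u - \<bar>v\<bar>) * (u + \<bar>v\<bar>) = Re w" using re by (simp add: algebra_simps power2_eq_square)
  have "Re w \<le> (u - \<bar>v\<bar>) * (2 * sqrt (norm w))"
    unfolding prod [symmetric] using ub vu by (intro mult_left_mono) auto
  then have k: "Re w / (2 * sqrt (norm w)) \<le> u - \<bar>v\<bar>" using pos by (simp add: field_simps)
  have "Im w * v \<le> \<bar>Im w\<bar> * \<bar>v\<bar>" by (metis abs_ge_self abs_mult)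
  also have "\<dots> \<le> Re w * \<bar>v\<bar>" using assms by (intro mult_right_mono) auto
  finally have "Re w * (u - \<bar>v\<bar>) \<le> Re (w * csqrt w)"
    by (simp add: u_def v_def algebra_simps)
  moreover have "Re w * (Re w / (2 * sqrt (norm w))) \<le> Re w * (u - \<bar>v\<bar>)"
    using k rw by (intro mult_left_mono) auto
  moreover have "norm w * sqrt (norm w) / 8 \<le> Re w * (Re w / (2 * sqrt (norm w)))"
  proof -
    have "(norm w / 2) * (norm w / 2) \<le> Re w * Re w" using n2 rw by (intro mult_mono) auto
    then have "norm w * norm w / 4 / (2 * sqrt (norm w)) \<le> Re w * Re w / (2 * sqrt (norm w))"
      using pos by (intro divide_right_mono) auto
    moreover have "norm w * norm w / 4 / (2 * sqrt (norm w)) = norm w * sqrt (norm w) / 8"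
      using pos by (simp add: field_simps)
    ultimately show ?thesis by simp
  qed
  ultimately show ?thesis by linarith
qed

text \<open>
  The order \<open>3 / 2\<close> lies strictly between the order \<open>1\<close> of \<open>g\<close> and the critical order \<open>2\<close> of the
  quadrant. With \<open>W\<close> mapping the quadrant into the sector \<open>|arg w| \<le> \<pi> / 4\<close>, the damping factor
  \<open>exp (- \<delta> * W powr (3 / 2))\<close> makes the arc of a large circle harmless in the maximum principle, and
  \<open>\<delta>\<close> tends to \<open>0\<close> at the end.
\<close>

lemma phragmen_lindelof_quadrant:
  assumes hol: "g holomorphic_on UNIV" and \<sigma>: "0 \<le> \<sigma>" "0 < A" and M: "0 < M"
    and bd: "\<And>z. norm (g z) \<le> A * exp (\<sigma> * norm z)"
    and re: "\<And>x. 0 \<le> x \<Longrightarrow> norm (g (of_real x)) \<le> M"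
    and im: "\<And>y. 0 \<le> y \<Longrightarrow> norm (g (\<i> * of_real y)) \<le> M"
    and z: "0 \<le> Re z" "0 \<le> Im z"
  shows "norm (g z) \<le> M"
proof -
  define W where "W = (\<lambda>\<zeta>::complex. (1 - \<i>) * \<zeta> + 1)"
  define p where "p = (\<lambda>\<zeta>. W \<zeta> * csqrt (W \<zeta>))"
  define Q where "Q = {\<zeta>::complex. 0 \<le> Re \<zeta> \<and> 0 \<le> Im \<zeta>}"
  have ReW: "Re (W \<zeta>) = Re \<zeta> + Im \<zeta> + 1" and ImW: "Im (W \<zeta>) = Im \<zeta> - Re \<zeta>" for \<zeta>
    by (simp_all add: W_def)
  have pge: "norm \<zeta> * sqrt (norm \<zeta>) / 8 \<le> Re (p \<zeta>)" if "\<zeta> \<in> Q" for \<zeta>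
  proof -
    have le: "norm \<zeta> \<le> norm (W \<zeta>)"
      using cmod_le[of \<zeta>] complex_Re_le_cmod[of "W \<zeta>"] that ReW[of \<zeta>] by (simp add: Q_def)
    have "norm \<zeta> * sqrt (norm \<zeta>) \<le> norm (W \<zeta>) * sqrt (norm (W \<zeta>))"
      using le by (intro mult_mono) auto
    also have "norm (W \<zeta>) * sqrt (norm (W \<zeta>)) / 8 \<le> Re (p \<zeta>)"
      unfolding p_def
    proof (rule Re_mult_csqrt_ge)
      show "\<bar>Im (W \<zeta>)\<bar> \<le> Re (W \<zeta>)" using that unfolding ReW ImW Q_def by auto
      show "W \<zeta> \<noteq> 0" using ReW[of \<zeta>] that by (auto simp: Q_def)
    qed
    finally show ?thesis by simp
  qed
  have main: "norm (g z) \<le> M * exp (\<delta> * Re (p z))" if \<delta>: "0 < \<delta>" for \<delta>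
  proof -
    define G where "G = (\<lambda>\<zeta>. g \<zeta> * exp (- (of_real \<delta> * p \<zeta>)))"
    have nG: "norm (G \<zeta>) = norm (g \<zeta>) * exp (- (\<delta> * Re (p \<zeta>)))" for \<zeta>
      by (simp add: G_def norm_mult)
    define q where "q = 8 * (\<sigma> + \<bar>ln (A / M)\<bar>) / \<delta>"
    have q0: "0 \<le> q" unfolding q_def using \<sigma> \<delta> by simp
    define R where "R = max (q\<^sup>2) (norm z + 1)"
    have R1: "1 \<le> R" and Rz: "norm z < R" unfolding R_def
      using norm_ge_zero[of z] by linarith+
    have "q\<^sup>2 \<le> R" by (simp add: R_def)
    then have sq: "q \<le> sqrt R" using q0 by (metis real_sqrt_unique real_sqrt_le_iff)
    have far: "A * exp (\<sigma> * R - \<delta> * (R * sqrt R / 8)) \<le> M"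
    proof -
      have "\<sigma> + \<bar>ln (A / M)\<bar> \<le> \<delta> * sqrt R / 8"
        using sq \<delta> by (simp add: q_def field_simps)
      then have "(\<sigma> + \<bar>ln (A / M)\<bar>) * R \<le> (\<delta> * sqrt R / 8) * R"
        using R1 by (intro mult_right_mono) auto
      moreover have "\<bar>ln (A / M)\<bar> * 1 \<le> \<bar>ln (A / M)\<bar> * R" using R1 by (intro mult_left_mono) auto
      ultimately have "ln (A / M) \<le> - (\<sigma> * R - \<delta> * (R * sqrt R / 8))"
        by (simp add: algebra_simps abs_le_iff)
      then have "A / M \<le> exp (- (\<sigma> * R - \<delta> * (R * sqrt R / 8)))"
        using \<sigma> M by (metis divide_pos_pos exp_le_cancel_iff exp_ln)
      then show ?thesis using M by (simp add: exp_minus field_simps)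
    qed
    have "norm (G z) \<le> M"
    proof (rule max_modulus_closed[of "{\<zeta>. 0 < Re \<zeta>} \<inter> {\<zeta>. 0 < Im \<zeta>} \<inter> ball 0 R" "Q \<inter> cball 0 R" G M z])
      show "open ({\<zeta>. 0 < Re \<zeta>} \<inter> {\<zeta>. 0 < Im \<zeta>} \<inter> ball 0 R)"
        by (intro open_Int open_halfspace_Re_gt open_halfspace_Im_gt open_ball)
      show "bounded ({\<zeta>. 0 < Re \<zeta>} \<inter> {\<zeta>. 0 < Im \<zeta>} \<inter> ball 0 R)" by (rule bounded_subset[of "ball 0 R"]) auto
      have "Q = {\<zeta>. Re \<zeta> \<ge> 0} \<inter> {\<zeta>. Im \<zeta> \<ge> 0}" by (auto simp: Q_def)
      then show "closed (Q \<inter> cball 0 R)"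
        by (simp add: closed_Int closed_halfspace_Re_ge closed_halfspace_Im_ge)
      have holG: "G holomorphic_on {\<zeta>. W \<zeta> \<notin> \<real>\<^sub>\<le>\<^sub>0}"
        unfolding G_def p_def W_def
        by (intro holomorphic_intros holomorphic_on_subset[OF hol]) auto
      have nonp: "W \<zeta> \<notin> \<real>\<^sub>\<le>\<^sub>0" if "\<zeta> \<in> Q" for \<zeta>
        using that ReW[of \<zeta>] by (auto simp: complex_nonpos_Reals_iff Q_def)
      show "G holomorphic_on {\<zeta>. 0 < Re \<zeta>} \<inter> {\<zeta>. 0 < Im \<zeta>} \<inter> ball 0 R"
        by (rule holomorphic_on_subset[OF holG]) (auto intro!: nonp simp: Q_def)
      show "continuous_on (Q \<inter> cball 0 R) G"
        by (intro holomorphic_on_imp_continuous_on holomorphic_on_subset[OF holG]) (auto intro!: nonp)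
      show "z \<in> Q \<inter> cball 0 R" using z Rz by (auto simp: Q_def)
      show "{\<zeta>. 0 < Re \<zeta>} \<inter> {\<zeta>. 0 < Im \<zeta>} \<inter> ball 0 R \<subseteq> Q \<inter> cball 0 R" by (auto simp: Q_def)
      fix \<zeta> assume \<zeta>: "\<zeta> \<in> Q \<inter> cball 0 R - {\<zeta>. 0 < Re \<zeta>} \<inter> {\<zeta>. 0 < Im \<zeta>} \<inter> ball 0 R"
      then have \<zeta>Q: "\<zeta> \<in> Q" by auto
      have "0 \<le> norm \<zeta> * sqrt (norm \<zeta>) / 8" by simp
      then have p0: "0 \<le> Re (p \<zeta>)" using pge[OF \<zeta>Q] by linarith
      have gG: "norm (G \<zeta>) \<le> norm (g \<zeta>)"
        unfolding nG using p0 \<delta> by (intro mult_right_le_one_le) auto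
      consider "Im \<zeta> = 0" | "Re \<zeta> = 0" | "norm \<zeta> = R" using \<zeta> by (force simp: Q_def)
      then show "norm (G \<zeta>) \<le> M"
      proof cases
        case 1
        then have "\<zeta> = of_real (Re \<zeta>)" by (simp add: complex_eq_iff)
        then show ?thesis using re[of "Re \<zeta>"] \<zeta>Q gG by (auto simp: Q_def)
      next
        case 2
        then have "\<zeta> = \<i> * of_real (Im \<zeta>)" by (simp add: complex_eq_iff)
        then show ?thesis using im[of "Im \<zeta>"] \<zeta>Q gG by (auto simp: Q_def)
      next
        case 3
        have "norm (G \<zeta>) \<le> (A * exp (\<sigma> * R)) * exp (- (\<delta> * (R * sqrt R / 8)))"
          unfolding nG using bd[of \<zeta>] pge[OF \<zeta>Q] 3 \<delta> \<sigma> by (intro mult_mono) auto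
        also have "\<dots> = A * exp (\<sigma> * R - \<delta> * (R * sqrt R / 8))"
          by (simp add: mult.assoc flip: exp_add)
        finally show ?thesis using far by linarith
      qed
    qed
    then show ?thesis unfolding nG by (simp add: exp_minus field_simps)
  qed
  have "((\<lambda>\<delta>. M * exp (\<delta> * Re (p z))) \<longlongrightarrow> M * exp (0 * Re (p z))) (at_right 0)"
    by (intro tendsto_intros)
  moreover have "\<forall>\<^sub>F \<delta> in at_right 0. norm (g z) \<le> M * exp (\<delta> * Re (p z))"
    using main by (auto simp: eventually_at_right_field intro!: exI[of _ 1])
  ultimately have "norm (g z) \<le> M * exp (0 * Re (p z))"
    by (intro tendsto_lowerbound) auto
  then show ?thesis by simp
qed

text \<open>
  The factor \<open>exp (- \<alpha> * z + \<i> * \<beta> * z)\<close> has modulus \<open>exp (- \<alpha> * Re z - \<beta> * Im z)\<close> and reduces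
  the assertion to bounded boundary values.
\<close>

lemma quadrant_bound:
  assumes hol: "F holomorphic_on UNIV" and \<sigma>: "0 \<le> \<sigma>" "0 < A" "0 < M"
    and bd: "\<And>z. norm (F z) \<le> A * exp (\<sigma> * norm z)"
    and re: "\<And>x. 0 \<le> x \<Longrightarrow> norm (F (of_real x)) \<le> M * exp (\<alpha> * x)"
    and im: "\<And>y. 0 \<le> y \<Longrightarrow> norm (F (\<i> * of_real y)) \<le> M * exp (\<beta> * y)"
    and z: "0 \<le> Re z" "0 \<le> Im z"
  shows "norm (F z) \<le> M * exp (\<alpha> * Re z + \<beta> * Im z)"
proof -
  define g where "g = (\<lambda>z. F z * exp (- of_real \<alpha> * z + \<i> * of_real \<beta> * z))"
  have ng: "norm (g z) = norm (F z) * exp (- (\<alpha> * Re z + \<beta> * Im z))" for z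
    by (simp add: g_def norm_mult)
  have "norm (g z) \<le> M"
  proof (rule phragmen_lindelof_quadrant[where g = g and z = z and \<sigma> = "\<sigma> + \<bar>\<alpha>\<bar> + \<bar>\<beta>\<bar>", OF _ _ \<sigma>(2,3)])
    show "g holomorphic_on UNIV" unfolding g_def by (intro holomorphic_intros hol)
    show "norm (g z) \<le> A * exp ((\<sigma> + \<bar>\<alpha>\<bar> + \<bar>\<beta>\<bar>) * norm z)" for z
    proof -
      have "- (\<alpha> * Re z) \<le> \<bar>\<alpha>\<bar> * norm z"
        by (metis abs_Re_le_cmod abs_ge_minus_self abs_ge_zero abs_mult mult_left_mono order_trans)
      moreover have "- (\<beta> * Im z) \<le> \<bar>\<beta>\<bar> * norm z"
        by (metis abs_Im_le_cmod abs_ge_minus_self abs_ge_zero abs_mult mult_left_mono order_trans)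
      ultimately have "norm (g z) \<le> (A * exp (\<sigma> * norm z)) * exp (\<bar>\<alpha>\<bar> * norm z + \<bar>\<beta>\<bar> * norm z)"
        unfolding ng using \<sigma> by (intro mult_mono bd) auto
      also have "\<dots> = A * exp ((\<sigma> + \<bar>\<alpha>\<bar> + \<bar>\<beta>\<bar>) * norm z)"
        by (simp add: algebra_simps flip: exp_add)
      finally show ?thesis .
    qed
    show "norm (g (of_real x)) \<le> M" if "0 \<le> x" for x
      unfolding ng using re[OF that] by (simp add: exp_minus field_simps)
    show "norm (g (\<i> * of_real y)) \<le> M" if "0 \<le> y" for y
      unfolding ng using im[OF that] by (simp add: exp_minus field_simps)
  qed (use \<sigma> z in auto)
  then show ?thesis unfolding ng by (simp only: exp_minus) (simp add: field_simps)
qed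

text \<open>
  On the positive real axis the exponential type itself is the boundary growth, so the half plane
  splits into two quadrants; multiplication by \<open>\<i>\<close> carries the lower one to the upper one.
\<close>

lemma right_half_plane_bound:
  assumes hol: "f holomorphic_on UNIV" and \<sigma>: "0 \<le> \<sigma>" "0 < A" "A \<le> M"
    and bd: "\<And>z. norm (f z) \<le> A * exp (\<sigma> * norm z)"
    and im: "\<And>y. norm (f (\<i> * of_real y)) \<le> M * exp (q * \<bar>y\<bar>)"
    and z: "0 \<le> Re z"
  shows "norm (f z) \<le> M * exp (\<sigma> * Re z + q * \<bar>Im z\<bar>)"
proof (cases "0 \<le> Im z")
  case True
  have "norm (f (of_real x)) \<le> M * exp (\<sigma> * x)" if "0 \<le> x" for x
    using bd[of "of_real x"] that \<sigma> by (auto intro: order_trans mult_right_mono)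
  then show ?thesis
    using quadrant_bound[OF hol \<sigma>(1,2) _ bd, of M \<sigma> q z] im \<sigma> z True
    by (metis abs_of_nonneg less_le_trans)
next
  case False
  define F where "F = (\<lambda>w. f (- \<i> * w))"
  have "norm (F (\<i> * z)) \<le> M * exp (q * Re (\<i> * z) + \<sigma> * Im (\<i> * z))"
  proof (rule quadrant_bound[where F = F and z = "\<i> * z", OF _ \<sigma>(1,2)])
    have "(f \<circ> (\<lambda>w. - \<i> * w)) holomorphic_on UNIV"
      by (rule holomorphic_on_compose_gen[OF _ hol]) (auto intro!: holomorphic_intros)
    then show "F holomorphic_on UNIV" by (simp add: F_def o_def)
    show "norm (F z) \<le> A * exp (\<sigma> * norm z)" for z
      using bd[of "- \<i> * z"] by (simp add: F_def norm_mult)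
    show "norm (F (of_real x)) \<le> M * exp (q * x)" if "0 \<le> x" for x
      using im[of "-x"] that by (simp add: F_def)
    show "norm (F (\<i> * of_real y)) \<le> M * exp (\<sigma> * y)" if "0 \<le> y" for y
    proof -
      have "norm (F (\<i> * of_real y)) \<le> A * exp (\<sigma> * y)"
        using bd[of "of_real y"] that by (simp add: F_def flip: mult.assoc)
      also have "\<dots> \<le> M * exp (\<sigma> * y)" using \<sigma> by (intro mult_right_mono) auto
      finally show ?thesis .
    qed
  qed (use \<sigma> z False in auto)
  moreover have "F (\<i> * z) = f z" by (simp add: F_def flip: mult.assoc)
  ultimately show ?thesis using False by (simp add: add.commute)
qed

section \<open>Counting zeros and lower bounds\<close>

lemma finite_norm_le:
  assumes "no_limit_points Z"
  shows "finite {k. norm (Z k) \<le> t}"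
proof -
  have "finite {k. Z k \<in> cball 0 t}" using assms bounded_cball unfolding no_limit_points_def by blast
  then show ?thesis by simp
qed

lemma nearby_nonzero:
  assumes hol: "f holomorphic_on UNIV" and nz: "f \<noteq> (\<lambda>_. 0)"
  obtains c :: complex where "norm c < 1" "f c \<noteq> 0"
proof -
  have "\<forall>\<^sub>F w in at 0. f w \<noteq> 0" by (rule entire_nonzero(1)[OF hol nz])
  moreover have "\<forall>\<^sub>F w in at 0. w \<in> ball (0::complex) 1 - {0}"
    by (intro eventually_at_in_open) auto
  ultimately have "\<forall>\<^sub>F w in at 0. f w \<noteq> 0 \<and> norm w < 1"
    by eventually_elim auto
  then have "\<exists>w. f w \<noteq> 0 \<and> norm w < 1" by (rule eventually_happens'[rotated]) simp
  then show thesis using that by blast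
qed

text \<open>
  A crude form of Jensen's inequality: after division by the zeros of modulus at most \<open>t\<close>, the
  quotient at \<open>c\<close> is compared with its values on a circle about \<open>c\<close>. Each factor is at least twice as
  large on the circle as at \<open>c\<close>, so each zero costs a factor \<open>2\<close> out of \<open>exp (O(t))\<close>.
\<close>

lemma zero_count_linear:
  fixes f :: "complex \<Rightarrow> complex"
  assumes hol: "f holomorphic_on UNIV" and nz: "f \<noteq> (\<lambda>_. 0)"
    and A: "0 < A" "0 \<le> \<sigma>" and bd: "\<And>z. norm (f z) \<le> A * exp (\<sigma> * norm z)"
    and Z: "no_limit_points Z"
    and van: "\<And>z. int (card {k. Z k = z}) \<le> zorder f z"
  obtains N where "0 \<le> N" "\<And>t. 1 \<le> t \<Longrightarrow> real (card {k. norm (Z k) \<le> t}) \<le> N * t"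
proof -
  obtain c where c: "norm c < 1" "f c \<noteq> 0" using nearby_nonzero[OF hol nz] .
  define L where "L = max 0 (ln (A / norm (f c)))"
  define N where "N = (L + 7 * \<sigma>) / ln 2"
  show thesis
  proof (rule that [of N])
    show "0 \<le> N" unfolding N_def L_def using A by simp
    fix t :: real assume t: "1 \<le> t"
    define I where "I = {k. norm (Z k) \<le> t}"
    have fin: "finite I" unfolding I_def by (rule finite_norm_le[OF Z])
    have "int (card {k\<in>I. Z k = z}) \<le> zorder f z" for z
    proof -
      have "finite {k. Z k = z}" by (rule finite_subset[OF _ finite_norm_le[OF Z, of "norm z"]]) auto
      then have "card {k\<in>I. Z k = z} \<le> card {k. Z k = z}" by (intro card_mono) auto
      then show ?thesis using van[of z] by linarith
    qed
    then obtain h where h: "h holomorphic_on UNIV" "\<And>z. f z = (\<Prod>k\<in>I. z - Z k) * h z"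
      using entire_divide_by_zeros[OF fin hol nz] by blast
    define n where "n = card I"
    define s where "s = 2 * t"
    have s0: "0 < s" using t by (simp add: s_def)
    have near: "norm (Z k - c) \<le> s" if "k \<in> I" for k
      using that c t norm_triangle_ineq4[of "Z k" c] by (simp add: I_def s_def)
    have hc: "norm (h c) \<le> A * exp (\<sigma> * (7 * t)) / (2 * s) ^ n"
    proof (rule max_modulus_closed[of "ball c (3 * s)" "cball c (3 * s)" h])
      show "h holomorphic_on ball c (3 * s)" using h(1) by (rule holomorphic_on_subset) auto
      show "continuous_on (cball c (3 * s)) h"
        by (intro holomorphic_on_imp_continuous_on holomorphic_on_subset[OF h(1)]) auto
      fix z assume "z \<in> cball c (3 * s) - ball c (3 * s)"
      then have z: "norm (z - c) = 3 * s" by (auto simp: dist_norm norm_minus_commute)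
      have "(2 * s) ^ n = (\<Prod>k\<in>I. 2 * s)" by (simp add: n_def)
      also have "\<dots> \<le> (\<Prod>k\<in>I. norm (z - Z k))"
      proof (rule prod_mono)
        fix k assume k: "k \<in> I"
        have "norm (z - c) \<le> norm (z - Z k) + norm (Z k - c)"
          using norm_triangle_ineq[of "z - Z k" "Z k - c"] by simp
        then show "0 \<le> 2 * s \<and> 2 * s \<le> norm (z - Z k)" using near[OF k] z s0 by linarith
      qed
      finally have P: "(2 * s)^n \<le> norm (\<Prod>k\<in>I. z - Z k)" by (simp add: prod_norm)
      have "norm z \<le> 7 * t" using z c t norm_triangle_ineq[of "z - c" c] by (simp add: s_def)
      then have "\<sigma> * norm z \<le> \<sigma> * (7 * t)" using A by (intro mult_left_mono) auto
      then have "A * exp (\<sigma> * norm z) \<le> A * exp (\<sigma> * (7 * t))" using A by simp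
      then have "norm (f z) \<le> A * exp (\<sigma> * (7 * t))" using bd[of z] by linarith
      moreover have "(2 * s)^n * norm (h z) \<le> norm (f z)"
        unfolding h(2) norm_mult by (intro mult_right_mono P) auto
      moreover have "0 < (2 * s)^n" using s0 by simp
      ultimately show "norm (h z) \<le> A * exp (\<sigma> * (7 * t)) / (2 * s) ^ n"
        by (simp add: field_simps)
    qed (use s0 in auto)
    have "norm (\<Prod>k\<in>I. c - Z k) \<le> s ^ n"
    proof -
      have "norm (\<Prod>k\<in>I. c - Z k) = (\<Prod>k\<in>I. norm (c - Z k))" by (simp add: prod_norm)
      also have "\<dots> \<le> (\<Prod>k\<in>I. s)" by (intro prod_mono) (use near in \<open>auto simp: norm_minus_commute\<close>)
      finally show ?thesis by (simp add: n_def)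
    qed
    then have "norm (f c) \<le> s ^ n * (A * exp (\<sigma> * (7 * t)) / (2 * s) ^ n)"
      unfolding h(2)[of c] norm_mult using hc s0 by (intro mult_mono) auto
    also have "\<dots> = A * exp (\<sigma> * (7 * t)) / 2 ^ n" using s0 by (simp add: power_mult_distrib)
    finally have "2 ^ n \<le> A / norm (f c) * exp (\<sigma> * (7 * t))" using c by (simp add: field_simps)
    also have "A / norm (f c) = exp (ln (A / norm (f c)))" using A c by simp
    also have "exp (ln (A / norm (f c))) * exp (\<sigma> * (7 * t)) \<le> exp (L * t + \<sigma> * (7 * t))"
    proof -
      have "L \<le> L * t" using t by (simp add: L_def mult_le_cancel_left1)
      then show ?thesis unfolding exp_add [symmetric] by (simp add: L_def)
    qed
    finally have "(2::real) ^ n \<le> exp (L * t + \<sigma> * (7 * t))" .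
    then have "ln (2 ^ n) \<le> L * t + \<sigma> * (7 * t)" by (metis ln_exp ln_le_cancel_iff exp_gt_zero zero_less_numeral zero_less_power)
    then have "real n * ln 2 \<le> (L + 7 * \<sigma>) * t" by (simp add: ln_realpow algebra_simps)
    then show "real (card {k. norm (Z k) \<le> t}) \<le> N * t"
      by (simp add: N_def n_def I_def field_simps)
  qed
qed

text \<open>
  This replaces the three circles theorem. If \<open>f\<close> were tiny on the disc about \<open>r\<close>, then
  \<open>f z * (r / (z - r)) ^ m\<close>, with \<open>m\<close> proportional to \<open>r\<close>, would be smaller on both circles
  \<open>norm (z - r) = r / 4\<close> and \<open>norm (z - r) = 2 * r\<close> than at a point \<open>c\<close> near the origin.
\<close>

lemma large_value_near_positive_axis:
  fixes f :: "complex \<Rightarrow> complex"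
  assumes hol: "f holomorphic_on UNIV" and nz: "f \<noteq> (\<lambda>_. 0)"
    and A: "0 < A" "0 \<le> \<sigma>" and bd: "\<And>z. norm (f z) \<le> A * exp (\<sigma> * norm z)"
  obtains C where "0 \<le> C"
    "\<And>r. 4 \<le> r \<Longrightarrow> \<exists>z. norm (z - of_real r) \<le> r / 4 \<and> exp (- C * r) \<le> norm (f z)"
proof -
  obtain c where c: "norm c < 1" "f c \<noteq> 0" using nearby_nonzero[OF hol nz] .
  define L where "L = max 0 (ln (A / norm (f c))) + max 0 (- ln (norm (f c))) + 1"
  have L1: "A / norm (f c) < exp L" and L2: "exp (- L) < norm (f c)" and L0: "1 \<le> L"
  proof -
    have "ln (A / norm (f c)) < L" by (simp add: L_def)
    then show "A / norm (f c) < exp L" using A c by (metis divide_pos_pos exp_less_cancel_iff exp_ln zero_less_norm_iff)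
    have "- L < ln (norm (f c))" by (simp add: L_def)
    then show "exp (- L) < norm (f c)" using c by (metis exp_less_cancel_iff exp_ln zero_less_norm_iff)
    show "1 \<le> L" by (simp add: L_def)
  qed
  (* The factor r / norm (z - r) is at least 4/5 at c, and it is 1/2 and 4 on the outer and the inner
     circle; hence the ratios 8/5 and 5. *)
  define K where "K = (3 * \<sigma> + L) / ln (8/5)"
  have K0: "0 \<le> K" unfolding K_def using A L0 by simp
  define C where "C = ln 5 * (K + 1) + L"
  show thesis
  proof (rule that [of C])
    show "0 \<le> C" unfolding C_def using K0 L0 by (auto intro!: add_nonneg_nonneg mult_nonneg_nonneg)
    fix r :: real assume r: "4 \<le> r"
    show "\<exists>z. norm (z - of_real r) \<le> r / 4 \<and> exp (- C * r) \<le> norm (f z)"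
    proof (rule ccontr)
      assume "\<not> ?thesis"
      then have small: "norm (f z) < exp (- C * r)" if "norm (z - of_real r) \<le> r / 4" for z
        using that by force
      define m where "m = nat \<lceil>K * r\<rceil>"
      have m: "K * r \<le> real m" "real m \<le> K * r + 1" unfolding m_def using K0 r by (auto simp: mult_nonneg_nonneg)
      define h where "h = (\<lambda>z. f z * (of_real r / (z - of_real r)) ^ m)"
      have nh: "norm (h z) = norm (f z) * (r / norm (z - of_real r)) ^ m" for z
        using r by (simp add: h_def norm_mult norm_power norm_divide)
      have p1: "A * exp (3 * \<sigma> * r) < norm (f c) * (8/5) ^ m"
      proof -
        have "(8/5::real) ^ m = exp (real m * ln (8/5))" by (simp add: exp_of_nat_mult)
        moreover have "K * r * ln (8/5) \<le> real m * ln (8/5)" using m by (intro mult_right_mono) auto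
        moreover have "K * r * ln (8/5) = (3 * \<sigma> + L) * r" by (simp add: K_def)
        ultimately have "exp ((3 * \<sigma> + L) * r) \<le> (8/5) ^ m" by simp
        moreover have "L + 3 * \<sigma> * r \<le> (3 * \<sigma> + L) * r" using L0 r by (simp add: algebra_simps)
        ultimately have "exp L * exp (3 * \<sigma> * r) \<le> (8/5) ^ m" unfolding exp_add [symmetric]
          by (meson exp_le_cancel_iff order_trans)
        moreover have "A / norm (f c) * exp (3 * \<sigma> * r) < exp L * exp (3 * \<sigma> * r)"
          using L1 by (intro mult_strict_right_mono) auto
        ultimately have "A / norm (f c) * exp (3 * \<sigma> * r) < (8/5) ^ m" by linarith
        then show ?thesis using c by (simp add: field_simps)
      qed
      have p2: "exp (- C * r) * 5 ^ m < norm (f c)"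
      proof -
        have "(5::real) ^ m = exp (real m * ln 5)" by (simp add: exp_of_nat_mult)
        moreover have "real m * ln 5 \<le> (K + 1) * r * ln 5"
          using m r by (intro mult_right_mono) (auto simp: algebra_simps)
        ultimately have "exp (- C * r) * 5 ^ m \<le> exp (- C * r + (K + 1) * r * ln 5)"
          unfolding exp_add by (intro mult_left_mono) auto
        also have "- C * r + (K + 1) * r * ln 5 = - (L * r)" by (simp add: C_def algebra_simps)
        also have "exp (- (L * r)) \<le> exp (- L)" using L0 r by simp
        finally show ?thesis using L2 by linarith
      qed
      have cr: "norm (c - of_real r) \<le> 5/4 * r" "3/4 * r \<le> norm (c - of_real r)"
        using c r norm_triangle_ineq4[of c "of_real r"] norm_triangle_ineq2[of "of_real r" c]
        by (auto simp: norm_minus_commute)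
      define B where "B = max (A * exp (3 * \<sigma> * r) * (1/2) ^ m) (exp (- C * r) * 4 ^ m)"
      have "norm (h c) \<le> B"
      proof (rule max_modulus_closed[of "ball (complex_of_real r) (2*r) - cball (complex_of_real r) (r/4)"
              "cball (complex_of_real r) (2*r) - ball (complex_of_real r) (r/4)" h])
        have holh: "h holomorphic_on (UNIV - {of_real r})"
          unfolding h_def by (intro holomorphic_intros holomorphic_on_subset[OF hol]) auto
        show "h holomorphic_on ball (complex_of_real r) (2*r) - cball (complex_of_real r) (r/4)"
          by (rule holomorphic_on_subset[OF holh]) (use r in auto)
        show "continuous_on (cball (complex_of_real r) (2*r) - ball (complex_of_real r) (r/4)) h"
          by (intro holomorphic_on_imp_continuous_on holomorphic_on_subset[OF holh]) (use r in auto)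
        show "bounded (ball (complex_of_real r) (2*r) - cball (complex_of_real r) (r/4))"
          by (rule bounded_subset[OF bounded_ball]) auto
        show "c \<in> cball (complex_of_real r) (2*r) - ball (complex_of_real r) (r/4)"
          using cr r by (auto simp: dist_norm norm_minus_commute)
        fix z assume z: "z \<in> cball (complex_of_real r) (2*r) - ball (complex_of_real r) (r/4)
              - (ball (complex_of_real r) (2*r) - cball (complex_of_real r) (r/4))"
        then consider "norm (z - of_real r) = 2 * r" | "norm (z - of_real r) = r/4"
          by (force simp: dist_norm norm_minus_commute)
        then show "norm (h z) \<le> B"
        proof cases
          case 1
          have "norm z \<le> 3 * r" using 1 r norm_triangle_ineq[of "z - of_real r" "of_real r"] by simp
          then have "\<sigma> * norm z \<le> \<sigma> * (3 * r)" using A by (intro mult_left_mono) auto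
          then have "A * exp (\<sigma> * norm z) \<le> A * exp (3 * \<sigma> * r)" using A by (simp add: mult_ac)
          then have "norm (f z) \<le> A * exp (3 * \<sigma> * r)" using bd[of z] by linarith
          then have "norm (h z) \<le> A * exp (3 * \<sigma> * r) * (1/2) ^ m"
            unfolding nh 1 using r A by (intro mult_mono) auto
          then show ?thesis by (simp add: B_def)
        next
          case 2
          have "norm (h z) \<le> exp (- C * r) * 4 ^ m"
            unfolding nh 2 using small[of z] 2 r by (intro mult_mono) auto
          then show ?thesis by (simp add: B_def)
        qed
      qed (use r in auto)
      moreover have "B < norm (f c) * (4/5) ^ m"
      proof -
        have "A * exp (3 * \<sigma> * r) * (1/2) ^ m < norm (f c) * (8/5) ^ m * (1/2) ^ m"
          using p1 by (intro mult_strict_right_mono) auto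
        also have "\<dots> = norm (f c) * (4/5) ^ m" by (simp add: power_mult_distrib [symmetric] mult.assoc)
        finally have "A * exp (3 * \<sigma> * r) * (1/2) ^ m < norm (f c) * (4/5) ^ m" .
        moreover have "exp (- C * r) * 5 ^ m * (4/5) ^ m < norm (f c) * (4/5) ^ m"
          using p2 by (intro mult_strict_right_mono) auto
        then have "exp (- C * r) * 4 ^ m < norm (f c) * (4/5) ^ m"
          by (simp add: power_mult_distrib [symmetric] mult.assoc)
        ultimately show ?thesis by (simp add: B_def)
      qed
      moreover have "norm (f c) * (4/5) ^ m \<le> norm (h c)"
      proof -
        have "0 < norm (c - of_real r)" using cr r by linarith
        then have "4/5 \<le> r / norm (c - of_real r)" using cr r by (simp add: field_simps)
        then show ?thesis unfolding nh by (intro mult_left_mono power_mono) auto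
      qed
      ultimately show False by linarith
    qed
  qed
qed

section \<open>Sums over the zeros in a half plane\<close>

text \<open>
  The first-order terms of \<open>ln (norm (1 + z / cnj w)) - ln (norm (1 - z / w))\<close> add up to
  \<open>Re (z / cnj w) + Re (z / w) = 2 * Re z * Re (1 / w)\<close>.
\<close>

lemma reflect_ratio_ge:
  fixes z w :: complex
  assumes "w \<noteq> 0" "norm z \<le> norm w / 5"
  shows "exp (2 * Re z * Re (1 / w) - 6 * ((norm z)\<^sup>2 / (norm w)\<^sup>2)) * norm (z - w) \<le> norm (z + cnj w)"
proof -
  define t where "t = (norm z)\<^sup>2 / (norm w)\<^sup>2"
  have w0: "0 < norm w" using assms by simp
  have "norm (z / cnj w) \<le> 1/5" using assms w0 by (simp add: norm_divide field_simps)
  from norm_one_plus_ge[OF this]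
  have "exp (Re (z / cnj w) - 5 * t) \<le> norm (1 + z / cnj w)"
    by (simp add: norm_divide power_divide t_def)
  also have "norm (1 + z / cnj w) = norm (z + cnj w) / norm w"
  proof -
    have "1 + z / cnj w = (z + cnj w) / cnj w" using assms by (simp add: field_simps)
    then show ?thesis by (simp add: norm_divide)
  qed
  finally have 1: "exp (Re (z / cnj w) - 5 * t) * norm w \<le> norm (z + cnj w)"
    using w0 by (simp add: field_simps)
  have "norm (1 + (- z / w)) \<le> exp (Re (- z / w) + t)"
    using norm_one_plus_le[of "- z / w"] by (simp add: norm_divide power_divide t_def)
  moreover have "norm (1 + (- z / w)) = norm (z - w) / norm w"
  proof -
    have "1 + (- z / w) = (w - z) / w" using assms by (simp add: field_simps)
    then show ?thesis by (simp add: norm_divide norm_minus_commute)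
  qed
  ultimately have "norm (z - w) / norm w \<le> exp (Re (- z / w) + t)" by metis
  then have 2: "norm (z - w) \<le> exp (Re (- z / w) + t) * norm w"
    using w0 by (subst (asm) pos_divide_le_eq)
  have re: "2 * Re z * Re (1 / w) = Re (z / cnj w) + Re (z / w)"
    by (simp add: Re_divide algebra_simps flip: add_divide_distrib)
  have "exp (2 * Re z * Re (1 / w) - 6 * t) * norm (z - w)
      \<le> exp (2 * Re z * Re (1 / w) - 6 * t) * (exp (Re (- z / w) + t) * norm w)"
    using 2 by (intro mult_left_mono) auto
  also have "\<dots> = exp (Re (z / cnj w) - 5 * t) * norm w"
    unfolding re by (simp flip: exp_add mult.assoc)
  also note 1
  finally show ?thesis unfolding t_def .
qed

lemma reflect_ratio_le:
  fixes z w :: complex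
  assumes "w \<noteq> 0" "norm z \<le> norm w / 5"
  shows "norm (z + cnj w) \<le> exp (2 * Re z * Re (1 / w) + 6 * ((norm z)\<^sup>2 / (norm w)\<^sup>2)) * norm (z - w)"
proof -
  have "exp (2 * Re (- z) * Re (1 / cnj w) - 6 * ((norm (-z))\<^sup>2 / (norm (cnj w))\<^sup>2)) * norm (- z - cnj w)
      \<le> norm (- z + cnj (cnj w))"
    using assms by (intro reflect_ratio_ge) auto
  moreover have "Re (1 / cnj w) = Re (1 / w)" by (simp add: Re_divide)
  moreover have "norm (- z - cnj w) = norm (z + cnj w)"
    by (metis minus_add_distrib norm_minus_cancel uminus_add_conv_diff add_uminus_conv_diff)
  ultimately have *: "exp (- (2 * Re z * Re (1 / w) + 6 * ((norm z)\<^sup>2 / (norm w)\<^sup>2))) * norm (z + cnj w) \<le> norm (z - w)"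
    by (simp add: norm_minus_commute)
  then show ?thesis by (simp only: exp_minus) (simp add: field_simps)
qed

lemma norm_reflect_sq: "(norm (z + cnj w))\<^sup>2 = (norm (z - w))\<^sup>2 + 4 * Re z * Re w"
  by (simp add: cmod_power2) (simp add: power2_eq_square algebra_simps)

text \<open>
  The squares of the two distances differ by \<open>4 * Re z * Re w\<close>, which is small relative to \<open>R\<^sup>2\<close>
  near the imaginary axis; the loss is therefore exponential in \<open>Re z\<close> only.
\<close>

lemma reflect_ratio_far:
  fixes z w :: complex
  assumes "0 < R" "norm w \<le> R" "R \<le> norm (z - w)" "0 \<le> Re z" "0 \<le> Re w"
  shows "norm (z + cnj w) \<le> exp (2 * Re z / R) * norm (z - w)"
proof -
  have "Re w \<le> R" using assms complex_Re_le_cmod[of w] by linarith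
  then have "4 * Re z * Re w \<le> 4 * Re z * R" using assms by (intro mult_left_mono) auto
  also have "\<dots> = (4 * Re z / R) * R\<^sup>2" using assms by (simp add: power2_eq_square)
  also have "\<dots> \<le> (4 * Re z / R) * (norm (z - w))\<^sup>2"
    using assms by (intro mult_left_mono power_mono) auto
  finally have "(norm (z + cnj w))\<^sup>2 \<le> (1 + 4 * Re z / R) * (norm (z - w))\<^sup>2"
    unfolding norm_reflect_sq by (simp add: algebra_simps)
  also have "\<dots> \<le> exp (4 * Re z / R) * (norm (z - w))\<^sup>2"
    by (intro mult_right_mono exp_ge_add_one_self) auto
  also have "\<dots> = (exp (2 * Re z / R) * norm (z - w))\<^sup>2"
    by (simp add: power_mult_distrib exp_double [symmetric])
  finally show ?thesis by (rule power2_le_imp_le) simp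
qed

text \<open>
  This is the part of \<open>Re (- (z * Ln (1 + z)))\<close> that supplies the growth \<open>\<pi> / 2 * |Im z|\<close> along the
  imaginary axis.
\<close>

lemma Im_mult_Im_Ln_ge:
  assumes "0 \<le> Re z"
  shows "pi / 2 * \<bar>Im z\<bar> - (1 + Re z) \<le> Im z * Im (Ln (1 + z))"
proof -
  have im: "Im (Ln (1 + z)) = arctan (Im z / (1 + Re z))"
    using assms by (subst Im_Ln_eq) (auto simp: complex_eq_iff)
  have *: "pi / 2 * y - (1 + x) \<le> y * arctan (y / (1 + x))" if "0 < y" "0 \<le> x" for x y :: real
  proof -
    have "arctan (y / (1 + x)) = pi / 2 - arctan ((1 + x) / y)"
      using arctan_inverse[of "(1+x)/y"] that by simp
    moreover have "arctan ((1 + x) / y) \<le> (1 + x) / y" using that by (intro arctan_le_self) auto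
    ultimately have "pi / 2 - (1 + x) / y \<le> arctan (y / (1 + x))" by linarith
    then have "y * (pi / 2 - (1 + x) / y) \<le> y * arctan (y / (1 + x))" using that by (intro mult_left_mono) auto
    moreover have "y * (pi / 2 - (1 + x) / y) = pi / 2 * y - (1 + x)" using that by (simp add: right_diff_distrib)
    ultimately show ?thesis by simp
  qed
  show ?thesis
  proof (cases "Im z" "0 :: real" rule: linorder_cases)
    case less
    then show ?thesis using *[of "- Im z" "Re z"] assms unfolding im by (simp add: arctan_minus)
  next
    case greater
    then show ?thesis using *[of "Im z" "Re z"] assms unfolding im by simp
  qed (use assms im in auto)
qed

text \<open>
  The constant \<open>C\<close> is chosen before \<open>\<epsilon>\<close>. This works because \<open>\<epsilon>\<close> enters the estimate only through the
  bounded number \<open>\<beta> = b + \<epsilon>\<close> and through \<open>M\<close>, and \<open>ln M\<close> is absorbed into \<open>r\<close> once \<open>r\<close> is large.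
\<close>

lemma zero_sum_right_half_plane:
  fixes f :: "complex \<Rightarrow> complex" and b :: real
  assumes hol: "f holomorphic_on UNIV" and nz: "f \<noteq> (\<lambda>_. 0)"
    and A: "1 \<le> A" "0 \<le> \<sigma>" and bd: "\<And>z. norm (f z) \<le> A * exp (\<sigma> * norm z)"
    and b: "0 \<le> b"
    and im: "\<And>\<epsilon>. 0 < \<epsilon> \<Longrightarrow> \<exists>M\<ge>A. \<forall>y. norm (f (\<i> * of_real y)) \<le> M * exp ((pi * b + \<epsilon>) * \<bar>y\<bar>)"
    and Z: "no_limit_points Z"
    and van: "\<And>z. int (card {k. Z k = z}) \<le> zorder f z"
    and N: "0 \<le> N" "\<And>t. 1 \<le> t \<Longrightarrow> real (card {k. norm (Z k) \<le> t}) \<le> N * t"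
    and C1: "0 \<le> C1" "\<And>r. 4 \<le> r \<Longrightarrow> \<exists>z. norm (z - of_real r) \<le> r / 4 \<and> exp (- C1 * r) \<le> norm (f z)"
  shows "\<exists>C\<ge>0. \<forall>\<epsilon>. 0 < \<epsilon> \<and> \<epsilon> \<le> 1 \<longrightarrow> (\<exists>\<rho>\<ge>1. \<forall>r R. \<rho> \<le> r \<and> r < R \<longrightarrow>
     (\<Sum>k\<in>{k. r < norm (Z k) \<and> norm (Z k) \<le> R \<and> 0 < Re (Z k)}. Re (1 / Z k)) \<le> (b + \<epsilon>) * ln (R / r) + C)"
proof -
  define B where "B = b + 1"
  (* 4 * B compensates for the error terms of Ln (1 + z), \<sigma> for the growth of f, and 2 * N for the
     reflected factors on the circle of radius 2 * R. *)
  define K where "K = 4 * B + \<sigma> + 2 * N"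
  define C' where "C' = 5 * B + B + 5/4 * K + 1 + 2 * B + C1 + 42 * N"
  have B1: "1 \<le> B" using b by (simp add: B_def)
  have C'0: "0 \<le> C'" unfolding C'_def K_def using B1 A N C1 by simp
  have fin: "finite {k. norm (Z k) \<le> t}" for t by (rule finite_norm_le[OF Z])
  have main: "(\<Sum>k\<in>{k. r < norm (Z k) \<and> norm (Z k) \<le> R \<and> 0 < Re (Z k)}. Re (1 / Z k))
       \<le> (b + \<epsilon>) * ln (R / r) + (C' + 10 * N)"
    if \<epsilon>: "0 < \<epsilon>" "\<epsilon> \<le> 1" and M: "A \<le> M" "\<And>y. norm (f (\<i> * of_real y)) \<le> M * exp ((pi * b + pi * \<epsilon>) * \<bar>y\<bar>)"
      and r: "4 \<le> r" "ln M \<le> r" "r < R" for \<epsilon> M r R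
  proof -
    define \<beta> where "\<beta> = b + \<epsilon>"
    have \<beta>: "0 < \<beta>" "\<beta> \<le> B" using b \<epsilon> by (auto simp: \<beta>_def B_def)
    have M0: "0 < M" using M A by linarith
    have R1: "1 \<le> R" using r by linarith
    (* The factor 10 makes norm z <= norm (Z k) / 5 for all z at a distance of at most r / 4 from r.
       The zeros between r and 10 * r contribute O(1) because their number is O(r). *)
    define I where "I = {k. 10 * r < norm (Z k) \<and> norm (Z k) \<le> R \<and> 0 < Re (Z k)}"
    have finI: "finite I" by (rule finite_subset[OF _ fin[of R]]) (auto simp: I_def)
    have ZI: "10 * r < norm (Z k)" "norm (Z k) \<le> R" "0 < Re (Z k)" "Z k \<noteq> 0" if "k \<in> I" for k
      using that r by (auto simp: I_def)
    define T where "T = (\<Sum>k\<in>I. Re (1 / Z k))"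
    have "int (card {k\<in>I. Z k = z}) \<le> zorder f z" for z
    proof -
      have "finite {k. Z k = z}" by (rule finite_subset[OF _ fin[of "norm z"]]) auto
      then have "card {k\<in>I. Z k = z} \<le> card {k. Z k = z}" by (intro card_mono) auto
      then show ?thesis using van[of z] by linarith
    qed
    then obtain h where h: "h holomorphic_on UNIV" "\<And>z. f z = (\<Prod>k\<in>I. z - Z k) * h z"
      using entire_divide_by_zeros[OF finI hol nz] by blast
    define F where "F = (\<lambda>z. (\<Prod>k\<in>I. z + cnj (Z k)) * h z)"
    (* Up to the constant 2 * \<beta>, the real part of V dominates pi * \<beta> * |Im z| on the half disc, while
       on the positive axis it is only 2 * \<beta> * x * ln (2 * R / x) + O(x). *)
    define V where "V = (\<lambda>z. - (2 * of_real \<beta> * (z * (Ln (1 + z) - of_real (ln (2 * R))))) + of_real K * z)"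
    have ReV: "Re (V z) = - 2 * \<beta> * Re z * (ln (norm (1 + z)) - ln (2 * R)) + 2 * \<beta> * (Im z * Im (Ln (1 + z))) + K * Re z"
      if "0 \<le> Re z" for z
    proof -
      have "1 + z \<noteq> 0" using that by (auto simp: complex_eq_iff)
      then show ?thesis by (simp add: V_def algebra_simps)
    qed
    have Vge: "pi * \<beta> * \<bar>Im z\<bar> - 2 * \<beta> + (K - 4 * \<beta>) * Re z \<le> Re (V z)"
      if z: "0 \<le> Re z" "norm z \<le> 2 * R" for z
    proof -
      have pos: "0 < norm (1 + z)" using z by (auto simp: complex_eq_iff)
      have "norm (1 + z) \<le> 1 + norm z" using norm_triangle_ineq[of 1 z] by simp
      also have "\<dots> \<le> 2 * R * exp 1"
      proof -
        have "2 * R * (1 + 1) \<le> 2 * R * exp 1" using R1 exp_ge_add_one_self[of 1] by (intro mult_left_mono) auto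
        then have "4 * R \<le> 2 * R * exp 1" by simp
        then show ?thesis using z R1 by linarith
      qed
      finally have "ln (norm (1 + z)) \<le> ln (2 * R * exp 1)" using pos R1 by (subst ln_le_cancel_iff) auto
      also have "\<dots> = ln (2 * R) + 1" using R1 by (simp add: ln_mult)
      finally have "(2 * \<beta> * Re z) * (ln (norm (1 + z)) - ln (2 * R)) \<le> (2 * \<beta> * Re z) * 1"
        using z \<beta> by (intro mult_left_mono) auto
      moreover have "2 * \<beta> * (pi / 2 * \<bar>Im z\<bar> - (1 + Re z)) \<le> 2 * \<beta> * (Im z * Im (Ln (1 + z)))"
        using Im_mult_Im_Ln_ge[OF z(1)] \<beta> by (intro mult_left_mono) auto
      ultimately show ?thesis unfolding ReV[OF z(1)] by (simp add: algebra_simps)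
    qed
    have fle: "norm (f z) \<le> M * exp (\<sigma> * Re z + pi * \<beta> * \<bar>Im z\<bar>)" if "0 \<le> Re z" for z
      by (rule right_half_plane_bound[OF hol A(2) _ M(1) bd _ that])
         (use A M(2) in \<open>auto simp: \<beta>_def algebra_simps\<close>)
    have nf: "norm (f z) = (\<Prod>k\<in>I. norm (z - Z k)) * norm (h z)" for z
      by (simp add: h(2) norm_mult prod_norm)
    have nF: "norm (F z) = (\<Prod>k\<in>I. norm (z + cnj (Z k))) * norm (h z)" for z
      by (simp add: F_def norm_mult prod_norm)
    have cardI: "real (card I) \<le> N * R"
    proof -
      have "card I \<le> card {k. norm (Z k) \<le> R}" by (intro card_mono fin) (auto simp: I_def)
      then show ?thesis using N(2)[OF R1] by linarith
    qed
    have Fle: "norm (F z) \<le> exp (2 * N * Re z) * norm (f z)"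
      if z: "0 \<le> Re z" "Re z = 0 \<or> norm z = 2 * R" for z
    proof -
      have one: "norm (z + cnj (Z k)) \<le> exp (2 * Re z / R) * norm (z - Z k)" if "k \<in> I" for k
        using z(2)
      proof
        assume "Re z = 0"
        then have "(norm (z + cnj (Z k)))\<^sup>2 = (norm (z - Z k))\<^sup>2" by (simp add: norm_reflect_sq)
        then have "norm (z + cnj (Z k)) = norm (z - Z k)" by simp
        then show ?thesis using \<open>Re z = 0\<close> by simp
      next
        assume "norm z = 2 * R"
        then have "R \<le> norm (z - Z k)" using norm_triangle_ineq2[of z "Z k"] ZI[OF that] by linarith
        then show ?thesis using ZI[OF that] R1 z by (intro reflect_ratio_far) auto
      qed
      have "(\<Prod>k\<in>I. norm (z + cnj (Z k))) \<le> (\<Prod>k\<in>I. exp (2 * Re z / R) * norm (z - Z k))"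
        using one by (intro prod_mono) auto
      also have "\<dots> = exp (2 * Re z / R) ^ card I * (\<Prod>k\<in>I. norm (z - Z k))"
        by (simp add: prod.distrib)
      also have "exp (2 * Re z / R) ^ card I = exp (real (card I) * (2 * Re z / R))"
        by (rule exp_of_nat_mult [symmetric])
      also have "\<dots> \<le> exp (2 * N * Re z)"
      proof -
        have "real (card I) * (2 * Re z / R) \<le> (N * R) * (2 * Re z / R)"
          using cardI z R1 by (intro mult_right_mono) auto
        then show ?thesis using R1 by (simp add: mult_ac)
      qed
      finally have "(\<Prod>k\<in>I. norm (z + cnj (Z k))) \<le> exp (2 * N * Re z) * (\<Prod>k\<in>I. norm (z - Z k))"
        by (simp add: mult_right_mono prod_nonneg)
      then show ?thesis unfolding nF nf by (simp add: mult_right_mono flip: mult.assoc)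
    qed
    define G where "G = (\<lambda>z. F z * exp (- V z))"
    have nG: "norm (G z) = norm (F z) * exp (- Re (V z))" for z by (simp add: G_def norm_mult)
    have Gle: "norm (G z) \<le> M * exp (2 * \<beta>)" if "0 \<le> Re z" "norm z \<le> 2 * R" for z
    proof (rule max_modulus_closed[of "{z. 0 < Re z} \<inter> ball 0 (2 * R)" "{z. 0 \<le> Re z} \<inter> cball 0 (2 * R)" G _ z])
      show "open ({z. 0 < Re z} \<inter> ball 0 (2 * R))" by (intro open_Int open_halfspace_Re_gt open_ball)
      show "bounded ({z. 0 < Re z} \<inter> ball 0 (2 * R))" by (rule bounded_subset[of "ball 0 (2 * R)"]) auto
      show "closed ({z. 0 \<le> Re z} \<inter> cball 0 (2 * R))"
        using closed_halfspace_Re_ge[of 0] by (intro closed_Int) auto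
      show "{z. 0 < Re z} \<inter> ball 0 (2 * R) \<subseteq> {z. 0 \<le> Re z} \<inter> cball 0 (2 * R)" by auto
      have holG: "G holomorphic_on {z. 0 < Re (1 + z)}"
        unfolding G_def F_def V_def
        by (intro holomorphic_intros holomorphic_on_subset[OF h(1)]) (auto simp: complex_nonpos_Reals_iff)
      show "G holomorphic_on {z. 0 < Re z} \<inter> ball 0 (2 * R)"
        by (rule holomorphic_on_subset[OF holG]) auto
      show "continuous_on ({z. 0 \<le> Re z} \<inter> cball 0 (2 * R)) G"
        by (intro holomorphic_on_imp_continuous_on holomorphic_on_subset[OF holG]) auto
      show "z \<in> {z. 0 \<le> Re z} \<inter> cball 0 (2 * R)" using that by auto
      fix z assume "z \<in> {z. 0 \<le> Re z} \<inter> cball 0 (2 * R) - {z. 0 < Re z} \<inter> ball 0 (2 * R)"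
      then have z: "0 \<le> Re z" "norm z \<le> 2 * R" "Re z = 0 \<or> norm z = 2 * R" by auto
      have "norm (G z) \<le> exp (2 * N * Re z) * (M * exp (\<sigma> * Re z + pi * \<beta> * \<bar>Im z\<bar>))
          * exp (- (pi * \<beta> * \<bar>Im z\<bar> - 2 * \<beta> + (K - 4 * \<beta>) * Re z))"
      proof -
        have "norm (F z) \<le> exp (2 * N * Re z) * (M * exp (\<sigma> * Re z + pi * \<beta> * \<bar>Im z\<bar>))"
          using Fle[OF z(1,3)] fle[OF z(1)] by (meson exp_ge_zero mult_left_mono order_trans)
        then show ?thesis unfolding nG using Vge[OF z(1,2)] M0 by (intro mult_mono) auto
      qed
      also have "\<dots> = M * exp (2 * N * Re z + (\<sigma> * Re z + pi * \<beta> * \<bar>Im z\<bar>)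
          + (- (pi * \<beta> * \<bar>Im z\<bar> - 2 * \<beta> + (K - 4 * \<beta>) * Re z)))"
        by (simp only: exp_add mult_ac)
      also have "\<dots> = M * exp (2 * \<beta> - 4 * (B - \<beta>) * Re z)"
        by (simp add: K_def algebra_simps)
      also have "\<dots> \<le> M * exp (2 * \<beta>)"
        using M0 \<beta> z by (intro mult_left_mono) auto
      finally show "norm (G z) \<le> M * exp (2 * \<beta>)" .
    qed
    obtain z where z: "norm (z - of_real r) \<le> r / 4" "exp (- C1 * r) \<le> norm (f z)"
      using C1(2)[OF r(1)] by blast
    define x where "x = Re z"
    have x: "3/4 * r \<le> x" "x \<le> 5/4 * r"
      using z(1) abs_Re_le_cmod[of "z - of_real r"] by (auto simp: x_def)
    have y: "\<bar>Im z\<bar> \<le> r / 4" using z(1) abs_Im_le_cmod[of "z - of_real r"] by auto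
    have nzr: "norm z \<le> 5/4 * r" using z(1) r norm_triangle_ineq[of "z - of_real r" "of_real r"] by simp
    have x0: "0 \<le> Re z" using x r by (simp add: x_def)
    have upper: "norm (F z) \<le> exp (r + 2 * B + Re (V z))"
    proof -
      have "norm (F z) * exp (- Re (V z)) \<le> M * exp (2 * \<beta>)"
        using Gle[of z] x0 nzr r unfolding nG by simp
      also have "M = exp (ln M)" using M0 by simp
      also have "exp (ln M) * exp (2 * \<beta>) \<le> exp (r + 2 * B)"
        using r \<beta> by (simp flip: exp_add)
      finally show ?thesis by (simp add: exp_add exp_minus field_simps)
    qed
    have lower: "exp (- C1 * r + (2 * x * T - 42 * N * r)) \<le> norm (F z)"
    proof -
      have one: "exp (2 * x * Re (1 / Z k) - 6 * ((norm z)\<^sup>2 / (norm (Z k))\<^sup>2)) * norm (z - Z k) \<le> norm (z + cnj (Z k))"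
        if "k \<in> I" for k
        unfolding x_def using ZI[OF that] nzr r by (intro reflect_ratio_ge) auto
      have "exp (\<Sum>k\<in>I. 2 * x * Re (1 / Z k) - 6 * ((norm z)\<^sup>2 / (norm (Z k))\<^sup>2)) * norm (f z)
         = (\<Prod>k\<in>I. exp (2 * x * Re (1 / Z k) - 6 * ((norm z)\<^sup>2 / (norm (Z k))\<^sup>2)) * norm (z - Z k)) * norm (h z)"
        unfolding nf exp_sum[OF finI] prod.distrib by simp
      also have "\<dots> \<le> norm (F z)"
        unfolding nF using one by (intro mult_right_mono prod_mono) auto
      finally have 1: "exp (\<Sum>k\<in>I. 2 * x * Re (1 / Z k) - 6 * ((norm z)\<^sup>2 / (norm (Z k))\<^sup>2)) * norm (f z) \<le> norm (F z)" .
      have "(\<Sum>k\<in>I. 1 / (norm (Z k))\<^sup>2) \<le> (\<Sum>k\<in>{k\<in>I. r < norm (Z k)}. 1 / (norm (Z k))\<^sup>2)"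
        using ZI r finI by (intro sum_mono2) force+
      also have "\<dots> \<le> 4 * N / r"
      proof (rule sum_inverse_square_tail[OF finI N(1)])
        fix t assume "r \<le> t"
        have "card {k\<in>I. norm (Z k) \<le> t} \<le> card {k. norm (Z k) \<le> t}" by (intro card_mono fin) auto
        then show "real (card {k\<in>I. norm (Z k) \<le> t}) \<le> N * t" using N(2)[of t] r \<open>r \<le> t\<close> by linarith
      qed (use r in auto)
      finally have sq: "(\<Sum>k\<in>I. 1 / (norm (Z k))\<^sup>2) \<le> 4 * N / r" .
      have "6 * (norm z)\<^sup>2 * (\<Sum>k\<in>I. 1 / (norm (Z k))\<^sup>2) \<le> 6 * (5/4 * r)\<^sup>2 * (4 * N / r)"
        using sq nzr by (intro mult_mono power_mono) (auto intro: sum_nonneg)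
      also have "\<dots> \<le> 42 * N * r" using r N by (simp add: power2_eq_square field_simps)
      finally have 2: "2 * x * T - 42 * N * r \<le> (\<Sum>k\<in>I. 2 * x * Re (1 / Z k) - 6 * ((norm z)\<^sup>2 / (norm (Z k))\<^sup>2))"
        by (simp add: T_def sum_subtractf sum_distrib_left mult_ac)
      have "exp (2 * x * T - 42 * N * r) * exp (- C1 * r) \<le> norm (F z)"
        using 1 2 z(2) by (meson exp_ge_zero exp_le_cancel_iff mult_mono norm_ge_zero order_trans)
      then show ?thesis by (subst exp_add, subst mult.commute)
    qed
    have "exp (- C1 * r + (2 * x * T - 42 * N * r)) \<le> exp (r + 2 * B + Re (V z))"
      using lower upper by linarith
    then have ineq: "- C1 * r + (2 * x * T - 42 * N * r) \<le> r + 2 * B + Re (V z)" by simp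
    have Vup: "Re (V z) \<le> 2 * \<beta> * x * ln (R / r) + 4 * \<beta> * x + B * r + K * x"
    proof -
      have "x \<le> norm (1 + z)" using complex_Re_le_cmod[of "1 + z"] by (simp add: x_def)
      then have "ln (3/4 * r) \<le> ln (norm (1 + z))" using x r by (subst ln_le_cancel_iff) auto
      moreover have "ln (2 * R) = ln (3/4 * r) + ln (R / r) + ln (8/3)"
      proof -
        have "ln (R / r) = ln R - ln r" "ln (2 * R) = ln 2 + ln R"
          using r R1 by (auto simp: ln_div ln_mult)
        moreover have "ln (3/4 * r) = ln (3/4) + ln r" by (rule ln_mult_pos) (use r in auto)
        moreover have "ln (2::real) = ln (3/4) + ln (8/3)"
          using ln_mult_pos[of "3/4::real" "8/3"] by simp
        ultimately show ?thesis by linarith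
      qed
      moreover have "ln (8/3 :: real) \<le> 2" using ln_le_minus_one[of "8/3::real"] by simp
      ultimately have "ln (2 * R) - ln (norm (1 + z)) \<le> ln (R / r) + 2" by linarith
      then have "(2 * \<beta> * x) * (ln (2 * R) - ln (norm (1 + z))) \<le> (2 * \<beta> * x) * (ln (R / r) + 2)"
        using \<beta> x r by (intro mult_left_mono) auto
      moreover have "2 * \<beta> * (Im z * Im (Ln (1 + z))) \<le> B * r"
      proof -
        have "\<bar>Im (Ln (1 + z))\<bar> < pi / 2" using x0 by (subst Re_Ln_pos_lt) (auto simp: complex_eq_iff)
        then have "\<bar>Im (Ln (1 + z))\<bar> \<le> 2" using pi_less_4 by linarith
        then have "\<bar>Im z\<bar> * \<bar>Im (Ln (1 + z))\<bar> \<le> r / 4 * 2" using y r by (intro mult_mono) auto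
        then have "Im z * Im (Ln (1 + z)) \<le> r / 2" by (simp add: abs_mult [symmetric])
        then have "2 * \<beta> * (Im z * Im (Ln (1 + z))) \<le> 2 * \<beta> * (r / 2)" using \<beta> by (intro mult_left_mono) auto
        also have "\<dots> \<le> B * r" using \<beta> r by simp
        finally show ?thesis .
      qed
      ultimately show ?thesis unfolding ReV[OF x0] x_def [symmetric] by (simp add: algebra_simps)
    qed
    have "2 * x * T \<le> 2 * x * (\<beta> * ln (R / r)) + C' * r"
    proof -
      have "4 * \<beta> * x \<le> 4 * B * (5/4 * r)" using x \<beta> r by (intro mult_mono) auto
      moreover have "K * x \<le> K * (5/4 * r)" using x B1 A N by (intro mult_left_mono) (auto simp: K_def)
      moreover have "2 * B \<le> 2 * B * r" using B1 r by simp
      ultimately show ?thesis using ineq Vup by (simp add: C'_def algebra_simps)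
    qed
    also have "C' * r \<le> 2 * x * C'"
    proof -
      have "C' * r \<le> C' * (2 * x)" using C'0 x r by (intro mult_left_mono) auto
      then show ?thesis by (simp add: mult_ac)
    qed
    finally have "2 * x * T \<le> 2 * x * (\<beta> * ln (R / r) + C')" by (simp add: algebra_simps)
    then have T: "T \<le> \<beta> * ln (R / r) + C'" using x r by simp
    define J where "J = {k. r < norm (Z k) \<and> norm (Z k) \<le> 10 * r \<and> norm (Z k) \<le> R \<and> 0 < Re (Z k)}"
    have finJ: "finite J" by (rule finite_subset[OF _ fin[of R]]) (auto simp: J_def)
    have "(\<Sum>k\<in>J. Re (1 / Z k)) \<le> (\<Sum>k\<in>J. 1 / r)"
    proof (rule sum_mono)
      fix k assume "k \<in> J"
      then have k: "r < norm (Z k)" by (auto simp: J_def)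
      have "Re (1 / Z k) \<le> norm (1 / Z k)" by (rule complex_Re_le_cmod)
      also have "\<dots> \<le> 1 / r" using k r by (simp add: norm_divide frac_le)
      finally show "Re (1 / Z k) \<le> 1 / r" .
    qed
    also have "\<dots> = real (card J) / r" by simp
    also have "\<dots> \<le> N * (10 * r) / r"
    proof -
      have "card J \<le> card {k. norm (Z k) \<le> 10 * r}" by (intro card_mono fin) (auto simp: J_def)
      then show ?thesis using N(2)[of "10 * r"] r by (intro divide_right_mono) auto
    qed
    also have "\<dots> = 10 * N" using r by simp
    finally have J: "(\<Sum>k\<in>J. Re (1 / Z k)) \<le> 10 * N" .
    have "{k. r < norm (Z k) \<and> norm (Z k) \<le> R \<and> 0 < Re (Z k)} = I \<union> J"
      using r by (auto simp: I_def J_def)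
    moreover have "(\<Sum>k\<in>I \<union> J. Re (1 / Z k)) = T + (\<Sum>k\<in>J. Re (1 / Z k))"
      unfolding T_def by (rule sum.union_disjoint[OF finI finJ]) (auto simp: I_def J_def)
    ultimately show ?thesis using T J by (simp add: \<beta>_def)
  qed
  show ?thesis
  proof (rule exI[of _ "C' + 10 * N"], intro conjI allI impI)
    show "0 \<le> C' + 10 * N" using C'0 N by simp
    fix \<epsilon> :: real assume \<epsilon>: "0 < \<epsilon> \<and> \<epsilon> \<le> 1"
    obtain M where M: "A \<le> M" "\<And>y. norm (f (\<i> * of_real y)) \<le> M * exp ((pi * b + pi * \<epsilon>) * \<bar>y\<bar>)"
      using im[of "pi * \<epsilon>"] \<epsilon> by auto
    show "\<exists>\<rho>\<ge>1. \<forall>r R. \<rho> \<le> r \<and> r < R \<longrightarrow>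
     (\<Sum>k\<in>{k. r < norm (Z k) \<and> norm (Z k) \<le> R \<and> 0 < Re (Z k)}. Re (1 / Z k)) \<le> (b + \<epsilon>) * ln (R / r) + (C' + 10 * N)"
      using main[OF _ _ M] \<epsilon> by (intro exI[of _ "max 4 (ln M)"]) auto
  qed
qed

section \<open>From entire functions to the logarithmic bound\<close>

text \<open>
  For \<open>d R\<close> one takes the least excess of the slope over \<open>b\<close> that works for all \<open>r < R\<close> with the
  constant obtained for \<open>\<epsilon> = 1\<close>. For other \<open>\<epsilon>\<close> the range below \<open>\<rho>\<close> costs an additional constant \<open>K\<close>,
  and \<open>K \<le> \<epsilon> * ln (R / \<rho>)\<close> as soon as \<open>R\<close> is large; hence \<open>d R \<le> 2 * \<epsilon>\<close> eventually.
\<close>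

lemma slope_error_function:
  fixes l :: "real \<Rightarrow> real \<Rightarrow> real" and b C :: real
  assumes sub: "\<And>r t R. 0 < r \<Longrightarrow> r < t \<Longrightarrow> t < R \<Longrightarrow> l r R \<le> l r t + l t R"
    and loc: "\<And>t. \<exists>K\<ge>0. \<forall>r R. 0 < r \<and> r < R \<and> R \<le> t \<longrightarrow> l r R \<le> K"
    and C: "0 \<le> C" and b: "0 \<le> b"
    and tail: "\<And>\<epsilon>. 0 < \<epsilon> \<Longrightarrow> \<epsilon> \<le> 1 \<Longrightarrow> \<exists>\<rho>\<ge>1. \<forall>r R. \<rho> \<le> r \<and> r < R \<longrightarrow> l r R \<le> (b + \<epsilon>) * ln (R / r) + C"
  shows "\<exists>C::real. \<exists>d::real \<Rightarrow> real.
              0 \<le> C \<and> (\<forall>x\<ge>0. 0 \<le> d x) \<and> bounded (d ` {0..}) \<and> (d \<longlongrightarrow> 0) at_top \<and>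
              (\<forall>r R. 0 < r \<and> r < R \<longrightarrow> l r R \<le> (b + d R) * ln (R / r) + C)"
proof -
  have glob: "\<exists>\<rho> K. 1 \<le> \<rho> \<and> 0 \<le> K \<and> (\<forall>r R. 0 < r \<and> r < R \<longrightarrow> l r R \<le> (b + \<epsilon>) * ln (R / r) + C \<or>
       l r R \<le> (b + \<epsilon>) * ln (R / r) + C + K \<and> r < \<rho>) \<and>
       (\<forall>r R. 0 < r \<and> r < \<rho> \<and> \<rho> < R \<longrightarrow> l r R \<le> (b + \<epsilon>) * ln (R / \<rho>) + C + K)" if \<epsilon>: "0 < \<epsilon>" "\<epsilon> \<le> 1" for \<epsilon>
  proof -
    obtain \<rho> where \<rho>: "1 \<le> \<rho>" "\<And>r R. \<rho> \<le> r \<Longrightarrow> r < R \<Longrightarrow> l r R \<le> (b + \<epsilon>) * ln (R / r) + C"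
      using tail[OF \<epsilon>] by blast
    obtain K where K: "0 \<le> K" "\<And>r R. 0 < r \<Longrightarrow> r < R \<Longrightarrow> R \<le> \<rho> \<Longrightarrow> l r R \<le> K"
      using loc[of \<rho>] by blast
    have cross: "l r R \<le> (b + \<epsilon>) * ln (R / \<rho>) + C + K" if "0 < r" "r < \<rho>" "\<rho> < R" for r R
      using sub[OF that] K(2)[of r \<rho>] \<rho>(2)[of \<rho> R] that by simp
    have pos: "0 \<le> (b + \<epsilon>) * ln (R / r)" if "0 < r" "r < R" for r R
      using that b \<epsilon> by (intro mult_nonneg_nonneg) auto
    have "l r R \<le> (b + \<epsilon>) * ln (R / r) + C \<or> l r R \<le> (b + \<epsilon>) * ln (R / r) + C + K \<and> r < \<rho>"
      if r: "0 < r" "r < R" for r R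
    proof (cases "\<rho> \<le> r")
      case True
      then show ?thesis using \<rho>(2) r by auto
    next
      case False
      show ?thesis
      proof (cases "R \<le> \<rho>")
        case True
        then show ?thesis using K(2)[OF r] pos[OF r] C False by linarith
      next
        case R: False
        have "ln (R / \<rho>) \<le> ln (R / r)" using r False \<rho>(1) R by (intro ln_mono) (auto intro!: divide_left_mono)
        then have "(b + \<epsilon>) * ln (R / \<rho>) \<le> (b + \<epsilon>) * ln (R / r)" using b \<epsilon> by (intro mult_left_mono) auto
        then show ?thesis using cross[of r R] r False R by linarith
      qed
    qed
    then show ?thesis using \<rho>(1) K(1) cross by (intro exI[of _ \<rho>] exI[of _ K]) blast
  qed
  from glob[OF zero_less_one order_refl] obtain \<rho>1 K1 where K1: "1 \<le> \<rho>1" "0 \<le> K1" and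
     K1': "\<forall>r R. 0 < r \<and> r < R \<longrightarrow> l r R \<le> (b + 1) * ln (R / r) + C \<or>
       l r R \<le> (b + 1) * ln (R / r) + C + K1 \<and> r < \<rho>1"
    by (elim exE conjE)
  define C1 where "C1 = C + K1"
  have C1: "C \<le> C1" "0 \<le> C1" using C K1 by (auto simp: C1_def)
  have all: "l r R \<le> (b + 1) * ln (R / r) + C1" if "0 < r" "r < R" for r R
    using K1'[rule_format, of r R] that K1(2) unfolding C1_def by linarith
  (* The element 0 makes d nonnegative and keeps the set nonempty when no r is below R. *)
  define S where "S = (\<lambda>R. insert 0 ((\<lambda>r. (l r R - C1) / ln (R / r) - b) ` {0<..<R}))"
  define d where "d = (\<lambda>R. Sup (S R))"
  have le: "s \<le> \<delta>" if bnd: "\<And>r. 0 < r \<Longrightarrow> r < R \<Longrightarrow> l r R \<le> (b + \<delta>) * ln (R / r) + C1" and "0 \<le> \<delta>" "s \<in> S R" for R \<delta> s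
  proof -
    have "(l r R - C1) / ln (R / r) - b \<le> \<delta>" if r: "0 < r" "r < R" for r
    proof -
      have "0 < ln (R / r)" using r by simp
      moreover have "l r R - C1 \<le> (b + \<delta>) * ln (R / r)" using bnd[OF r] by simp
      ultimately have "(l r R - C1) / ln (R / r) \<le> b + \<delta>" by (simp add: pos_divide_le_eq)
      then show ?thesis by simp
    qed
    then show ?thesis using that by (auto simp: S_def)
  qed
  have bdd: "bdd_above (S R)" for R using le[of R 1] all by (intro bdd_aboveI[of _ 1]) auto
  have ne: "S R \<noteq> {}" for R by (auto simp: S_def)
  have d0: "0 \<le> d R" for R unfolding d_def by (rule cSup_upper[OF _ bdd]) (auto simp: S_def)
  have dle: "d R \<le> \<delta>" if "\<And>r. 0 < r \<Longrightarrow> r < R \<Longrightarrow> l r R \<le> (b + \<delta>) * ln (R / r) + C1" "0 \<le> \<delta>" for R \<delta>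
    unfolding d_def by (rule cSup_least[OF ne]) (use le that in blast)
  have d1: "d R \<le> 1" for R using all by (intro dle) auto
  have main: "l r R \<le> (b + d R) * ln (R / r) + C1" if r: "0 < r" "r < R" for r R
  proof -
    have "(l r R - C1) / ln (R / r) - b \<le> d R" unfolding d_def
      by (rule cSup_upper[OF _ bdd]) (use r in \<open>auto simp: S_def\<close>)
    then have "(l r R - C1) / ln (R / r) \<le> b + d R" by simp
    moreover have "0 < ln (R / r)" using r by simp
    ultimately show ?thesis by (simp add: pos_divide_le_eq)
  qed
  have lim: "(d \<longlongrightarrow> 0) at_top"
  proof (rule tendstoI)
    fix e :: real assume e: "0 < e"
    define \<epsilon> where "\<epsilon> = min 1 (e / 4)"
    have \<epsilon>: "0 < \<epsilon>" "\<epsilon> \<le> 1" "2 * \<epsilon> < e" using e by (auto simp: \<epsilon>_def min_def)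
    from glob[OF \<epsilon>(1,2)] obtain \<rho> K where K: "1 \<le> \<rho>" "0 \<le> K" and
      K3: "\<forall>r R. 0 < r \<and> r < R \<longrightarrow> l r R \<le> (b + \<epsilon>) * ln (R / r) + C \<or> l r R \<le> (b + \<epsilon>) * ln (R / r) + C + K \<and> r < \<rho>" and
      K4: "\<forall>r R. 0 < r \<and> r < \<rho> \<and> \<rho> < R \<longrightarrow> l r R \<le> (b + \<epsilon>) * ln (R / \<rho>) + C + K"
      by (elim exE conjE)
    have "d R \<le> 2 * \<epsilon>" if R: "\<rho> * exp (K / \<epsilon>) + 1 \<le> R" for R
    proof (rule dle)
      have "1 \<le> exp (K / \<epsilon>)" using K \<epsilon> by simp
      then have "\<rho> * 1 \<le> \<rho> * exp (K / \<epsilon>)" using K by (intro mult_left_mono) auto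
      then have R\<rho>: "\<rho> < R" using R by linarith
      fix r assume r: "0 < r" "r < R"
      have pos: "0 \<le> \<epsilon> * ln (R / r)" using r \<epsilon> by simp
      show "l r R \<le> (b + 2 * \<epsilon>) * ln (R / r) + C1"
      proof (cases "r < \<rho>")
        case True
        have "exp (K / \<epsilon>) \<le> R / \<rho>" using R K by (simp add: field_simps)
        then have "K / \<epsilon> \<le> ln (R / \<rho>)" using K R\<rho> by (subst ln_ge_iff) auto
        then have "K \<le> \<epsilon> * ln (R / \<rho>)" using \<epsilon> by (simp add: field_simps)
        moreover have lnle: "ln (R / \<rho>) \<le> ln (R / r)" using r True K R\<rho> by (intro ln_mono) (auto intro!: divide_left_mono)
        then have "(b + 2 * \<epsilon>) * ln (R / \<rho>) \<le> (b + 2 * \<epsilon>) * ln (R / r)" using b \<epsilon> by (intro mult_left_mono) auto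
        ultimately show ?thesis using K4[rule_format, of r R] r(1) True R\<rho> C1 by (simp add: algebra_simps)
      next
        case False
        then show ?thesis using K3[rule_format, of r R] r pos C1 by (auto simp: algebra_simps)
      qed
    qed (use \<epsilon> in auto)
    then show "\<forall>\<^sub>F x in at_top. dist (d x) 0 < e"
      using d0 \<epsilon>(3) unfolding eventually_at_top_linorder
      by (intro exI[of _ "\<rho> * exp (K / \<epsilon>) + 1"]) (force simp: dist_real_def)
  qed
  show ?thesis
    using C1 d0 d1 main lim
    by (intro exI[of _ C1] exI[of _ d]) (auto simp: bounded_iff intro!: exI[of _ 1])
qed

lemma log_submeasure_bound_of_entire_function:
  fixes Z :: "nat \<Rightarrow> complex" and b :: real
  assumes Z: "no_limit_points Z" and b: "0 \<le> b"
    and f: "entire_of_exponential_type f" "f \<noteq> (\<lambda>_. 0)" "vanishes_on f Z"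
    and gr: "growth_indicator f (pi / 2) \<le> ereal (pi * b)" "growth_indicator f (- pi / 2) \<le> ereal (pi * b)"
  shows "\<exists>C::real. \<exists>d::real \<Rightarrow> real.
              0 \<le> C \<and> (\<forall>x\<ge>0. 0 \<le> d x) \<and> bounded (d ` {0..}) \<and> (d \<longlongrightarrow> 0) at_top \<and>
              (\<forall>r R. 0 < r \<and> r < R \<longrightarrow> log_submeasure Z r R \<le> (b + d R) * ln (R / r) + C)"
proof -
  have hol: "f holomorphic_on UNIV" using f by (simp add: entire_of_exponential_type_def)
  have van: "int (card {k. Z k = z}) \<le> zorder f z" for z
    using f by (simp add: vanishes_on_def)
  obtain A \<sigma> where A: "1 \<le> A" "0 \<le> \<sigma>" "\<And>z. norm (f z) \<le> A * exp (\<sigma> * norm z)"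
    using exponential_type_bound[OF f(1)] by metis
  have im: "\<exists>M\<ge>A. \<forall>y. norm (f (\<i> * of_real y)) \<le> M * exp ((pi * b + \<epsilon>) * \<bar>y\<bar>)" if "0 < \<epsilon>" for \<epsilon>
    using imaginary_axis_bound[OF A gr _ that] b by (metis mult_nonneg_nonneg pi_ge_zero)
  obtain N where N: "0 \<le> N" "\<And>t. 1 \<le> t \<Longrightarrow> real (card {k. norm (Z k) \<le> t}) \<le> N * t"
    using zero_count_linear[OF hol f(2) _ A(2,3) Z van] A(1) by auto
  (* The zeros of f in the left half plane are those of g in the right half plane, up to sign. *)
  define g where "g = (\<lambda>z. f (- z))"
  have holg: "g holomorphic_on UNIV" using holomorphic_reflect[OF hol] by (simp add: g_def)
  have nzg: "g \<noteq> (\<lambda>_. 0)" using f(2) unfolding g_def by (metis minus_minus)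
  have bg: "norm (g z) \<le> A * exp (\<sigma> * norm z)" for z using A(3)[of "-z"] by (simp add: g_def)
  have img: "\<exists>M\<ge>A. \<forall>y. norm (g (\<i> * of_real y)) \<le> M * exp ((pi * b + \<epsilon>) * \<bar>y\<bar>)" if \<epsilon>: "0 < \<epsilon>" for \<epsilon>
  proof -
    obtain M where M: "A \<le> M" "\<And>y. norm (f (\<i> * of_real y)) \<le> M * exp ((pi * b + \<epsilon>) * \<bar>y\<bar>)" using im[OF \<epsilon>] by blast
    have "norm (g (\<i> * of_real y)) \<le> M * exp ((pi * b + \<epsilon>) * \<bar>y\<bar>)" for y
      using M(2)[of "-y"] by (simp add: g_def)
    then show ?thesis using M(1) by blast
  qed
  have Zg: "no_limit_points (\<lambda>k. - Z k)"
    unfolding no_limit_points_def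
  proof (intro allI impI)
    fix S :: "complex set" assume "bounded S"
    then have "finite {k. Z k \<in> uminus ` S}" using Z by (auto simp: no_limit_points_def)
    then show "finite {k. - Z k \<in> S}" by (rule finite_subset[rotated]) force
  qed
  have vang: "int (card {k. - Z k = z}) \<le> zorder g z" for z
  proof -
    have "f analytic_on {- z}" using hol by (simp add: analytic_on_open analytic_on_subset[of _ UNIV])
    then have "zorder g z = zorder f (- z)"
      unfolding g_def by (intro Meromorphic.zorder_uminus analytic_on_imp_meromorphic_on)
    moreover have "{k. - Z k = z} = {k. Z k = - z}" by auto
    ultimately show ?thesis using van[of "-z"] by simp
  qed
  have Ng: "real (card {k. norm (- Z k) \<le> t}) \<le> N * t" if "1 \<le> t" for t using N(2)[OF that] by simp
  obtain C1 where C1: "0 \<le> C1"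
    "\<And>r. 4 \<le> r \<Longrightarrow> \<exists>z. norm (z - of_real r) \<le> r / 4 \<and> exp (- C1 * r) \<le> norm (f z)"
    using large_value_near_positive_axis[OF hol f(2) _ A(2,3)] A(1) by auto
  obtain C2 where C2: "0 \<le> C2"
    "\<And>r. 4 \<le> r \<Longrightarrow> \<exists>z. norm (z - of_real r) \<le> r / 4 \<and> exp (- C2 * r) \<le> norm (g z)"
    using large_value_near_positive_axis[OF holg nzg _ A(2) bg] A(1) by auto
  define lp where "lp = (\<lambda>r R. \<Sum>k\<in>{k. r < norm (Z k) \<and> norm (Z k) \<le> R \<and> Re (Z k) > 0}. Re (1 / Z k))"
  define lm where "lm = (\<lambda>r R. \<Sum>k\<in>{k. r < norm (Z k) \<and> norm (Z k) \<le> R \<and> Re (Z k) < 0}. Re (- (1 / Z k)))"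
  have lse: "log_submeasure Z r R = max (lp r R) (lm r R)" for r R
    by (simp add: log_submeasure_def lp_def lm_def)
  obtain Cp where Cp: "0 \<le> Cp" "\<forall>\<epsilon>. 0 < \<epsilon> \<and> \<epsilon> \<le> 1 \<longrightarrow> (\<exists>\<rho>\<ge>1. \<forall>r R. \<rho> \<le> r \<and> r < R \<longrightarrow> lp r R \<le> (b + \<epsilon>) * ln (R / r) + Cp)"
    using zero_sum_right_half_plane[OF hol f(2) A b im Z van N C1] unfolding lp_def by blast
  obtain Cm where Cm: "0 \<le> Cm" "\<forall>\<epsilon>. 0 < \<epsilon> \<and> \<epsilon> \<le> 1 \<longrightarrow> (\<exists>\<rho>\<ge>1. \<forall>r R. \<rho> \<le> r \<and> r < R \<longrightarrow> lm r R \<le> (b + \<epsilon>) * ln (R / r) + Cm)"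
    using zero_sum_right_half_plane[OF holg nzg A(1,2) bg b img Zg vang N(1) Ng C2] unfolding lm_def by simp blast
  have split: "lp r R = lp r t + lp t R" "lm r R = lm r t + lm t R" if "r < t" "t < R" for r t R
  proof -
    have fin: "finite {k. norm (Z k) \<le> t}" for t by (rule finite_norm_le[OF Z])
    have "{k. r < norm (Z k) \<and> norm (Z k) \<le> R \<and> Re (Z k) > 0} =
       {k. r < norm (Z k) \<and> norm (Z k) \<le> t \<and> Re (Z k) > 0} \<union> {k. t < norm (Z k) \<and> norm (Z k) \<le> R \<and> Re (Z k) > 0}"
      using that by auto
    then show "lp r R = lp r t + lp t R" unfolding lp_def
      by (simp only:) (rule sum.union_disjoint; auto intro: finite_subset[OF _ fin[of R]] finite_subset[OF _ fin[of t]])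
    have "{k. r < norm (Z k) \<and> norm (Z k) \<le> R \<and> Re (Z k) < 0} =
       {k. r < norm (Z k) \<and> norm (Z k) \<le> t \<and> Re (Z k) < 0} \<union> {k. t < norm (Z k) \<and> norm (Z k) \<le> R \<and> Re (Z k) < 0}"
      using that by auto
    then show "lm r R = lm r t + lm t R" unfolding lm_def
      by (simp only:) (rule sum.union_disjoint; auto intro: finite_subset[OF _ fin[of R]] finite_subset[OF _ fin[of t]])
  qed
  show ?thesis
  proof (rule slope_error_function[where C = "max Cp Cm"])
    show "log_submeasure Z r R \<le> log_submeasure Z r t + log_submeasure Z t R"
      if "0 < r" "r < t" "t < R" for r t R
      using split[OF that(2,3)] unfolding lse by linarith
    show "0 \<le> max Cp Cm" using Cp by simp
    show "\<exists>K\<ge>0. \<forall>r R. 0 < r \<and> r < R \<and> R \<le> t \<longrightarrow> log_submeasure Z r R \<le> K" for t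
    proof -
      define K where "K = (\<Sum>k\<in>{k. norm (Z k) \<le> t}. norm (1 / Z k))"
      have fin: "finite {k. norm (Z k) \<le> t}" by (rule finite_norm_le[OF Z])
      have "lp r R \<le> K" "lm r R \<le> K" if "R \<le> t" for r R
      proof -
        have "lp r R \<le> (\<Sum>k\<in>{k. r < norm (Z k) \<and> norm (Z k) \<le> R \<and> Re (Z k) > 0}. norm (1 / Z k))"
          unfolding lp_def by (intro sum_mono complex_Re_le_cmod)
        also have "\<dots> \<le> K" unfolding K_def using that by (intro sum_mono2 fin) auto
        finally show "lp r R \<le> K" .
        have "lm r R \<le> (\<Sum>k\<in>{k. r < norm (Z k) \<and> norm (Z k) \<le> R \<and> Re (Z k) < 0}. norm (- (1 / Z k)))"
          unfolding lm_def by (intro sum_mono complex_Re_le_cmod)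
        also have "\<dots> \<le> K" unfolding K_def norm_minus_cancel using that by (intro sum_mono2 fin) auto
        finally show "lm r R \<le> K" .
      qed
      moreover have "0 \<le> K" unfolding K_def by (intro sum_nonneg) auto
      ultimately show ?thesis by (intro exI[of _ K]) (auto simp: lse)
    qed
    show "\<exists>\<rho>\<ge>1. \<forall>r R. \<rho> \<le> r \<and> r < R \<longrightarrow> log_submeasure Z r R \<le> (b + \<epsilon>) * ln (R / r) + max Cp Cm"
      if \<epsilon>: "0 < \<epsilon>" "\<epsilon> \<le> 1" for \<epsilon>
    proof -
      obtain \<rho>p where p: "1 \<le> \<rho>p" "\<And>r R. \<rho>p \<le> r \<Longrightarrow> r < R \<Longrightarrow> lp r R \<le> (b + \<epsilon>) * ln (R / r) + Cp"
        using Cp(2) \<epsilon> by blast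
      obtain \<rho>m where m: "1 \<le> \<rho>m" "\<And>r R. \<rho>m \<le> r \<Longrightarrow> r < R \<Longrightarrow> lm r R \<le> (b + \<epsilon>) * ln (R / r) + Cm"
        using Cm(2) \<epsilon> by blast
      show ?thesis
      proof (rule exI[of _ "max \<rho>p \<rho>m"], intro conjI allI impI)
        fix r R assume "max \<rho>p \<rho>m \<le> r \<and> r < R"
        then show "log_submeasure Z r R \<le> (b + \<epsilon>) * ln (R / r) + max Cp Cm"
          using p(2)[of r R] m(2)[of r R] unfolding lse by linarith
      qed (use p in auto)
    qed
  qed (use b in auto)
qed

section \<open>Integer multiplicities and fillers\<close>

text \<open>
  The numbers \<open>\<theta>\<close> are rounding errors. Only their increments occur, and summation by parts against
  the decreasing weights \<open>1 / u\<close> keeps the total bounded.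
\<close>

lemma sum_increment_theta_le:
  fixes \<theta> :: "nat \<Rightarrow> real"
  assumes "\<And>j. 0 \<le> \<theta> j" "\<And>j. \<theta> j \<le> 1" "1 \<le> i" "i \<le> J"
  shows "(\<Sum>u\<in>{i<..J}. (\<theta> u - \<theta> (u - 1)) / real u) \<le> \<theta> J / real J + (1 - 1 / real J)"
  using assms(4)
proof (induction J rule: dec_induct)
  case base
  then show ?case using assms by simp
next
  case (step J)
  have J: "1 \<le> J" using step assms by simp
  have "{i<..Suc J} = insert (Suc J) {i<..J}" using step by auto
  then have "(\<Sum>u\<in>{i<..Suc J}. (\<theta> u - \<theta> (u - 1)) / real u)
     = (\<theta> (Suc J) - \<theta> J) / real (Suc J) + (\<Sum>u\<in>{i<..J}. (\<theta> u - \<theta> (u - 1)) / real u)" by simp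
  also have "\<dots> \<le> (\<theta> (Suc J) - \<theta> J) / real (Suc J) + (\<theta> J / real J + (1 - 1 / real J))"
    using step.IH by simp
  also have "\<dots> \<le> \<theta> (Suc J) / real (Suc J) + (1 - 1 / real (Suc J))"
  proof -
    have "\<theta> J * (1 / real J - 1 / real (Suc J)) \<le> 1 * (1 / real J - 1 / real (Suc J))"
      using assms(2) J by (intro mult_right_mono) (auto simp: field_simps)
    then show ?thesis by (simp add: algebra_simps diff_divide_distrib)
  qed
  finally show ?case .
qed

lemma sum_inverse_consecutive:
  assumes "1 \<le> i" "i \<le> J"
  shows "(\<Sum>u\<in>{i<..J}. 1 / (real u * (real u - 1))) \<le> 1 - 1 / real J"
  using assms(2)
proof (induction J rule: dec_induct)
  case base
  then show ?case using assms by simp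
next
  case (step J)
  have J: "1 \<le> J" using step assms by simp
  have "{i<..Suc J} = insert (Suc J) {i<..J}" using step by auto
  then have "(\<Sum>u\<in>{i<..Suc J}. 1 / (real u * (real u - 1))) = 1 / (real (Suc J) * real J) + (\<Sum>u\<in>{i<..J}. 1 / (real u * (real u - 1)))"
    by simp
  also have "\<dots> \<le> 1 / (real (Suc J) * real J) + (1 - 1 / real J)" using step.IH by simp
  also have "\<dots> = 1 - 1 / real (Suc J)"
  proof -
    have "0 < real J + real J * real J" using J by (intro add_pos_nonneg) auto
    then show ?thesis using J by (simp add: field_simps)
  qed
  finally show ?case .
qed

text \<open>
  Let \<open>\<delta> j\<close> be the supremum of \<open>d\<close> on \<open>[j, \<infinity>)\<close> and \<open>\<mu> j\<close> the sum of \<open>b + \<delta> i\<close> for \<open>i \<le> j\<close>; then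
  \<open>m j\<close> is the increment of \<open>\<lfloor>\<mu>\<rfloor>\<close> at \<open>j\<close>. Since \<open>\<delta>\<close> is a decreasing majorant of \<open>d\<close>, the single value
  \<open>d J\<close> is below every \<open>\<delta> u\<close> with \<open>u \<le> J\<close>. Since \<open>\<lfloor>\<mu> j\<rfloor> \<le> \<mu> j\<close> for every \<open>j\<close>, rounding can only
  decrease a sum against nonnegative decreasing weights \<open>h\<close>; the last property holds for this reason.
\<close>

lemma reference_multiplicities:
  fixes d :: "real \<Rightarrow> real" and b :: real
  assumes b: "0 \<le> b" and d0: "\<And>x. 0 \<le> x \<Longrightarrow> 0 \<le> d x" and bdd: "bounded (d ` {0..})" and lim: "(d \<longlongrightarrow> 0) at_top"
  obtains m :: "nat \<Rightarrow> nat" and C B :: real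
  where "0 \<le> C" "\<And>j. real (m j) \<le> B"
    "\<And>i J. 1 \<le> i \<Longrightarrow> i \<le> J \<Longrightarrow> (b + d (real J)) * ln (real J / real i) \<le> (\<Sum>j\<in>{i<..J}. real (m j) / real j) + C"
    "\<And>\<epsilon>. 0 < \<epsilon> \<Longrightarrow> \<exists>K\<ge>0. \<forall>n h. (\<forall>j\<ge>1. 0 \<le> h j \<and> h (Suc j) \<le> h j) \<longrightarrow>
        (\<Sum>j=1..n. real (m j) * h j) \<le> (b + \<epsilon>) * (\<Sum>j=1..n. h j) + K * h (1::nat)"
proof -
  obtain D where D: "\<And>x. 0 \<le> x \<Longrightarrow> d x \<le> D"
    using bdd by (force simp: bounded_iff abs_le_iff)
  have D0: "0 \<le> D" using D[of 0] d0[of 0] by simp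
  define \<delta> where "\<delta> = (\<lambda>j::nat. Sup (d ` {real j..}))"
  have bd: "bdd_above (d ` {real j..})" for j by (rule bdd_aboveI[of _ D]) (use D in auto)
  have d\<delta>: "d (real J) \<le> \<delta> u" if "u \<le> J" for u J
    unfolding \<delta>_def by (rule cSup_upper[OF _ bd]) (use that in auto)
  have \<delta>D: "\<delta> j \<le> D" for j unfolding \<delta>_def by (rule cSup_least) (use D in auto)
  have \<delta>0: "0 \<le> \<delta> j" for j using d\<delta>[of j j] d0[of "real j"] by simp
  define c where "c = (\<lambda>j. b + \<delta> j)"
  have c0: "0 \<le> c j" and cB: "c j \<le> b + D" for j using b \<delta>0 \<delta>D by (auto simp: c_def)
  define \<mu> where "\<mu> = (\<lambda>j. \<Sum>i=1..j. c i)"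
  have \<mu>S: "\<mu> (Suc j) = \<mu> j + c (Suc j)" for j by (simp add: \<mu>_def)
  have \<mu>0: "0 \<le> \<mu> j" for j unfolding \<mu>_def by (intro sum_nonneg c0)
  define m where "m = (\<lambda>j. nat (\<lfloor>\<mu> j\<rfloor> - \<lfloor>\<mu> (j - 1)\<rfloor>))"
  define \<theta> where "\<theta> = (\<lambda>j. frac (\<mu> j))"
  have \<theta>: "0 \<le> \<theta> j" "\<theta> j \<le> 1" for j by (auto simp: \<theta>_def less_imp_le frac_lt_1)
  have mono: "\<lfloor>\<mu> (j - 1)\<rfloor> \<le> \<lfloor>\<mu> j\<rfloor>" for j
    using \<mu>S[of "j - 1"] c0[of j] by (cases j) (auto intro!: floor_mono)
  have m: "real (m j) = c j - (\<theta> j - \<theta> (j - 1))" if "1 \<le> j" for j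
  proof -
    have "real (m j) = of_int (\<lfloor>\<mu> j\<rfloor> - \<lfloor>\<mu> (j - 1)\<rfloor>)" using mono[of j] by (simp add: m_def)
    moreover have "\<mu> j = \<mu> (j - 1) + c j" using \<mu>S[of "j - 1"] that by simp
    ultimately show ?thesis by (simp add: \<theta>_def frac_def)
  qed
  have m0: "m 0 = 0" by (simp add: m_def)
  show thesis
  proof (rule that[of "b + D + 1" m "b + D + 1"])
    show "0 \<le> b + D + 1" using b D0 by simp
    show "real (m j) \<le> b + D + 1" for j
    proof (cases "j = 0")
      case False
      then show ?thesis using m[of j] cB[of j] \<theta>(1)[of j] \<theta>(2)[of "j - 1"] by simp
    qed (use b D0 m0 in simp)
    fix i J :: nat assume ij: "1 \<le> i" "i \<le> J"
    have "(b + d (real J)) * ln (real J / real i) \<le> (\<Sum>u\<in>{i<..J}. (b + d (real J)) * (1 / (real u - 1)))"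
    proof -
      have "ln (real J / real i) \<le> (\<Sum>u\<in>{i<..J}. 1 / (real u - 1))"
        using ij(2)
      proof (induction J rule: dec_induct)
        case base
        then show ?case using ij by simp
      next
        case (step J)
        have "{i<..Suc J} = insert (Suc J) {i<..J}" using step by auto
        moreover have "ln (real (Suc J) / real i) = ln (real J / real i) + ln (1 + 1 / real J)"
        proof -
          have "real (Suc J) / real i = (real J / real i) * (1 + 1 / real J)" using step ij by (simp add: field_simps)
          also have "ln \<dots> = ln (real J / real i) + ln (1 + 1 / real J)"
            by (rule ln_mult_pos) (use step ij in \<open>auto intro!: divide_pos_pos add_pos_pos\<close>)
          finally show ?thesis .
        qed
        moreover have "ln (1 + 1 / real J) \<le> 1 / real J" by (rule ln_add_one_self_le_self) simp
        ultimately show ?case using step.IH by (simp del: of_nat_Suc) simp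
      qed
      moreover have "0 \<le> b + d (real J)" using b d0 by simp
      ultimately show ?thesis unfolding sum_distrib_left [symmetric] by (rule mult_left_mono)
    qed
    also have "\<dots> \<le> (\<Sum>u\<in>{i<..J}. c u / real u + (b + D) * (1 / (real u * (real u - 1))))"
    proof (rule sum_mono)
      fix u assume u: "u \<in> {i<..J}"
      then have u1: "1 < real u" using ij by auto
      have "(b + d (real J)) * (1 / (real u - 1)) \<le> c u * (1 / (real u - 1))"
        using d\<delta>[of u J] u u1 by (intro mult_right_mono) (auto simp: c_def)
      also have "\<dots> = c u / real u + c u * (1 / (real u * (real u - 1)))"
        using u1 by (simp add: field_simps)
      also have "\<dots> \<le> c u / real u + (b + D) * (1 / (real u * (real u - 1)))"
        using cB[of u] u1 by (intro add_left_mono mult_right_mono) auto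
      finally show "(b + d (real J)) * (1 / (real u - 1)) \<le> c u / real u + (b + D) * (1 / (real u * (real u - 1)))" .
    qed
    also have "\<dots> = (\<Sum>u\<in>{i<..J}. c u / real u) + (b + D) * (\<Sum>u\<in>{i<..J}. 1 / (real u * (real u - 1)))"
      by (simp add: sum.distrib sum_distrib_left)
    also have "\<dots> \<le> (\<Sum>u\<in>{i<..J}. c u / real u) + (b + D) * 1"
    proof -
      have "1 - 1 / real J \<le> 1" by simp
      then show ?thesis using sum_inverse_consecutive[OF ij] b D0 by (intro add_left_mono mult_left_mono) linarith+
    qed
    also have "(\<Sum>u\<in>{i<..J}. c u / real u) = (\<Sum>u\<in>{i<..J}. real (m u) / real u) + (\<Sum>u\<in>{i<..J}. (\<theta> u - \<theta> (u - 1)) / real u)"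
      unfolding sum.distrib [symmetric]
    proof (rule sum.cong[OF refl])
      fix u assume "u \<in> {i<..J}"
      then have "1 \<le> u" using ij by auto
      from m[OF this] show "c u / real u = real (m u) / real u + (\<theta> u - \<theta> (u - 1)) / real u"
        by (simp add: diff_divide_distrib)
    qed
    also have "(\<Sum>u\<in>{i<..J}. (\<theta> u - \<theta> (u - 1)) / real u) \<le> 1"
    proof -
      have "(\<Sum>u\<in>{i<..J}. (\<theta> u - \<theta> (u - 1)) / real u) \<le> \<theta> J / real J + (1 - 1 / real J)"
        by (rule sum_increment_theta_le[OF \<theta> ij])
      also have "\<dots> \<le> 1" using \<theta>[of J] ij by (simp add: field_simps)
      finally show ?thesis .
    qed
    finally show "(b + d (real J)) * ln (real J / real i) \<le> (\<Sum>j\<in>{i<..J}. real (m j) / real j) + (b + D + 1)"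
      by simp
  next
    fix \<epsilon> :: real assume \<epsilon>: "0 < \<epsilon>"
    obtain X where X: "\<And>x. X \<le> x \<Longrightarrow> d x < \<epsilon>"
      using order_tendstoD(2)[OF lim \<epsilon>] by (auto simp: eventually_at_top_linorder)
    obtain J0 :: nat where J0: "X \<le> real J0" using real_arch_simple by blast
    have \<delta>\<epsilon>: "\<delta> j \<le> \<epsilon>" if "J0 \<le> j" for j
      unfolding \<delta>_def
    proof (rule cSup_least)
      fix x assume "x \<in> d ` {real j..}"
      then obtain t where "x = d t" "real j \<le> t" by auto
      then show "x \<le> \<epsilon>" using X[of t] J0 that by simp
    qed auto
    show "\<exists>K\<ge>0. \<forall>n h. (\<forall>j\<ge>1. 0 \<le> h j \<and> h (Suc j) \<le> h j) \<longrightarrow>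
        (\<Sum>j=1..n. real (m j) * h j) \<le> (b + \<epsilon>) * (\<Sum>j=1..n. h j) + K * h (1::nat)"
    proof (rule exI[of _ "real J0 * D"], intro conjI allI impI)
      show "0 \<le> real J0 * D" using D0 by simp
      fix n and h :: "nat \<Rightarrow> real" assume h: "\<forall>j\<ge>1. 0 \<le> h j \<and> h (Suc j) \<le> h j"
      have h1: "h j \<le> h 1" if "1 \<le> j" for j using that h by (induction j rule: dec_induct) (auto intro: order_trans)
      (* Summation by parts; the boundary term is nonnegative because rounding is downwards. *)
      have abel: "1 \<le> n \<Longrightarrow> \<theta> n * h n \<le> (\<Sum>j=1..n. (c j - real (m j)) * h j)"
      proof (induction n rule: dec_induct)
        case base
        have "\<theta> 0 = 0" by (simp add: \<theta>_def \<mu>_def)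
        then show ?case using m[of 1] by simp
      next
        case (step n)
        have "(c (Suc n) - real (m (Suc n))) * h (Suc n) = (\<theta> (Suc n) - \<theta> n) * h (Suc n)" using m[of "Suc n"] by simp
        moreover have "\<theta> n * h (Suc n) \<le> \<theta> n * h n" using h step \<theta> by (intro mult_left_mono) auto
        ultimately show ?case using step.IH by (simp add: algebra_simps)
      qed
      have "(\<Sum>j=1..n. real (m j) * h j) \<le> (\<Sum>j=1..n. c j * h j)"
      proof (cases "1 \<le> n")
        case True
        have "0 \<le> \<theta> n * h n" using \<theta> h True by simp
        then have "0 \<le> (\<Sum>j=1..n. (c j - real (m j)) * h j)" using abel[OF True] by linarith
        then show ?thesis by (simp add: left_diff_distrib sum_subtractf)
      qed auto
      also have "\<dots> \<le> (\<Sum>j=1..n. (b + \<epsilon>) * h j + (if j < J0 then D * h 1 else 0))"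
      proof (rule sum_mono)
        fix j assume "j \<in> {1..n}"
        then have j: "1 \<le> j" by simp
        have hj: "0 \<le> h j" using h j by blast
        show "c j * h j \<le> (b + \<epsilon>) * h j + (if j < J0 then D * h 1 else 0)"
        proof (cases "j < J0")
          case True
          have "c j * h j \<le> (b + D) * h j" using cB hj by (intro mult_right_mono) auto
          also have "\<dots> \<le> (b + \<epsilon>) * h j + D * h 1"
            using h1[OF j] D0 \<epsilon> hj by (simp add: distrib_right) (smt (verit) mult_left_mono mult_nonneg_nonneg)
          finally show ?thesis using True by simp
        next
          case False
          then show ?thesis using \<delta>\<epsilon>[of j] hj by (simp add: c_def mult_right_mono)
        qed
      qed
      also have "\<dots> = (b + \<epsilon>) * (\<Sum>j=1..n. h j) + (\<Sum>j=1..n. if j < J0 then D * h 1 else 0)"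
        by (simp add: sum.distrib sum_distrib_left)
      also have "(\<Sum>j=1..n. if j < J0 then D * h 1 else 0) \<le> real J0 * D * h 1"
      proof -
        have "(\<Sum>j=1..n. if j < J0 then D * h 1 else 0) = (\<Sum>j\<in>{1..n} \<inter> {j. j < J0}. D * h 1)"
          by (subst sum.If_cases) auto
        also have "\<dots> \<le> (\<Sum>j\<in>{..<J0}. D * h 1)"
          using D0 h by (intro sum_mono2) auto
        finally show ?thesis by (simp add: mult_ac)
      qed
      finally show "(\<Sum>j=1..n. real (m j) * h j) \<le> (b + \<epsilon>) * (\<Sum>j=1..n. h j) + real J0 * D * h 1" by simp
    qed
  qed
qed

text \<open>
  The greedy choice: step \<open>j\<close> adds the largest multiple of \<open>1 / j\<close> that does not exceed the target
  \<open>q j\<close>, or nothing if the target has been reached already.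
\<close>

primrec filler_sum :: "(nat \<Rightarrow> real) \<Rightarrow> nat \<Rightarrow> real" where
  "filler_sum q 0 = 0"
| "filler_sum q (Suc j) = filler_sum q j + real (nat \<lfloor>real (Suc j) * (q (Suc j) - filler_sum q j)\<rfloor>) / real (Suc j)"

text \<open>
  The greedy sum falls short of \<open>q J\<close> by at most \<open>1 / J\<close>. It exceeds \<open>q J\<close> only as a leftover from
  an earlier index \<open>i\<close>, and \<open>q i \<le> q J + C\<close>.
\<close>

lemma filler_multiplicities:
  fixes q :: "nat \<Rightarrow> real"
  assumes q0: "q 0 = 0" and q: "\<And>i J. i \<le> J \<Longrightarrow> q i \<le> q J + C" and C: "0 \<le> C"
  obtains a :: "nat \<Rightarrow> nat" where "\<And>J. \<bar>(\<Sum>j=1..J. real (a j) / real j) - q J\<bar> \<le> C + 1"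
proof -
  define a where "a = (\<lambda>j. nat \<lfloor>real j * (q j - filler_sum q (j - 1))\<rfloor>)"
  have S: "(\<Sum>j=1..J. real (a j) / real j) = filler_sum q J" for J
    by (induction J) (auto simp: a_def)
  have low: "q J - 1 \<le> filler_sum q J" for J
  proof (cases J)
    case (Suc j)
    define x where "x = real (Suc j) * (q (Suc j) - filler_sum q j)"
    have "x - 1 \<le> real (nat \<lfloor>x\<rfloor>)" by linarith
    then have "(x - 1) / real (Suc j) \<le> real (nat \<lfloor>x\<rfloor>) / real (Suc j)" by (intro divide_right_mono) auto
    moreover have "(x - 1) / real (Suc j) = (q (Suc j) - filler_sum q j) - 1 / real (Suc j)"
      by (simp add: x_def diff_divide_distrib)
    moreover have "1 / real (Suc j) \<le> 1" by simp
    ultimately show ?thesis unfolding Suc filler_sum.simps x_def [symmetric] by linarith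
  qed (use q0 in simp)
  have "\<exists>i\<le>J. filler_sum q J = filler_sum q i \<and> filler_sum q i \<le> q i" for J
  proof (induction J)
    case 0
    then show ?case using q0 by auto
  next
    case (Suc j)
    define x where "x = real (Suc j) * (q (Suc j) - filler_sum q j)"
    show ?case
    proof (cases "0 \<le> x")
      case True
      have "real (nat \<lfloor>x\<rfloor>) \<le> x" using True by linarith
      then have "real (nat \<lfloor>x\<rfloor>) / real (Suc j) \<le> x / real (Suc j)" by (intro divide_right_mono) auto
      also have "x / real (Suc j) = q (Suc j) - filler_sum q j" by (simp add: x_def)
      finally have "filler_sum q (Suc j) \<le> q (Suc j)" by (simp add: x_def)
      then show ?thesis by blast
    next
      case False
      then have "nat \<lfloor>x\<rfloor> = 0" by linarith
      then have "filler_sum q (Suc j) = filler_sum q j" by (simp add: x_def)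
      then show ?thesis using Suc by (metis le_SucI)
    qed
  qed
  then have up: "filler_sum q J \<le> q J + C" for J using q by (metis order_trans)
  show thesis
  proof (rule that[of a])
    show "\<bar>(\<Sum>j=1..J. real (a j) / real j) - q J\<bar> \<le> C + 1" for J
      unfolding S using low[of J] up[of J] C by (simp add: abs_le_iff)
  qed
qed

section \<open>Products with zeros in a cone\<close>

lemma sum_inverse_sqrt_le: "(\<Sum>j=1..T. 1 / sqrt (real j)) \<le> 2 * sqrt (real T)"
proof (induction T)
  case (Suc T)
  have a: "0 \<le> sqrt (real T)" "sqrt (real T) \<le> sqrt (real (Suc T))" "0 < sqrt (real (Suc T))" by auto
  have sq: "sqrt (real (Suc T)) * sqrt (real (Suc T)) - sqrt (real T) * sqrt (real T) = 1" by simp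
  have "(sqrt (real (Suc T)) - sqrt (real T)) * (sqrt (real (Suc T)) + sqrt (real T)) = 1"
    using sq by (simp add: algebra_simps)
  moreover have "(sqrt (real (Suc T)) - sqrt (real T)) * (sqrt (real (Suc T)) + sqrt (real T))
     \<le> (sqrt (real (Suc T)) - sqrt (real T)) * (2 * sqrt (real (Suc T)))"
    using a by (intro mult_left_mono) auto
  ultimately have "1 \<le> (sqrt (real (Suc T)) - sqrt (real T)) * (2 * sqrt (real (Suc T)))" by linarith
  then have "1 \<le> (sqrt (real (Suc T)) - sqrt (real T)) * 2 * sqrt (real (Suc T))" by (simp only: mult.assoc)
  then have "1 / sqrt (real (Suc T)) \<le> (sqrt (real (Suc T)) - sqrt (real T)) * 2"
    using a by (simp only: pos_divide_le_eq)
  with Suc.IH have "(\<Sum>j=1..T. 1 / sqrt (real j)) + 1 / sqrt (real (Suc T)) \<le> 2 * sqrt (real T) + (sqrt (real (Suc T)) - sqrt (real T)) * 2"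
    by (rule add_mono)
  also have "\<dots> = 2 * sqrt (real (Suc T))" by (simp add: algebra_simps)
  finally show ?case by simp
qed auto

lemma sum_inverse_squares_tail: "1 \<le> T \<Longrightarrow> (\<Sum>j\<in>{T<..n}. 1 / (real j)\<^sup>2) \<le> 1 / real T"
proof (cases "T \<le> n")
  case True
  assume T: "1 \<le> T"
  have "(\<Sum>j\<in>{T<..n}. 1 / (real j)\<^sup>2) \<le> 1 / real T - 1 / real n"
    using True
  proof (induction n rule: dec_induct)
    case (step n)
    have n: "1 \<le> n" using step T by simp
    have "{T<..Suc n} = insert (Suc n) {T<..n}" using step by auto
    then have "(\<Sum>j\<in>{T<..Suc n}. 1 / (real j)\<^sup>2) = 1 / (real (Suc n))\<^sup>2 + (\<Sum>j\<in>{T<..n}. 1 / (real j)\<^sup>2)" by simp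
    also have "1 / (real (Suc n))\<^sup>2 \<le> 1 / (real n * real (Suc n))"
      unfolding power2_eq_square using n by (intro divide_left_mono mult_right_mono mult_pos_pos) auto
    also have "\<dots> = 1 / real n - 1 / real (Suc n)"
    proof -
      have "0 < real n + real n * real n" using n by (intro add_pos_nonneg) auto
      then show ?thesis using n by (simp add: field_simps)
    qed
    finally show ?case using step.IH by simp
  qed auto
  then show ?thesis by (smt (verit) of_nat_0_le_iff zero_le_divide_1_iff)
qed auto

text \<open>
  With \<open>t = norm z / j\<close> and \<open>j \<le> O(norm z)\<close> these bounds multiply to \<open>exp (O(norm z))\<close>, whereas
  \<open>exp t\<close> would produce a logarithm.
\<close>

lemma one_plus_le_exp_sqrt: "0 \<le> t \<Longrightarrow> 1 + t \<le> exp (2 * sqrt t)"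
proof -
  assume t: "0 \<le> t"
  have "1 + t \<le> (1 + sqrt t)\<^sup>2" using t by (simp add: power2_eq_square algebra_simps)
  also have "\<dots> \<le> (exp (sqrt t))\<^sup>2" using t by (intro power_mono exp_ge_add_one_self) auto
  also have "\<dots> = exp (2 * sqrt t)" by (rule exp_double [symmetric])
  finally show ?thesis .
qed

text \<open>
  The first product is of Blaschke type for the right half plane, hence of modulus \<open>1\<close> on the
  imaginary axis. The second one has its zeros at the negative integers and makes up for the linear
  terms \<open>- 2 * Re z * Re (1 / P i)\<close> of the first.
\<close>

definition half_plane_product :: "('i \<Rightarrow> complex) \<Rightarrow> 'i set \<Rightarrow> (nat \<Rightarrow> nat) \<Rightarrow> nat \<Rightarrow> complex \<Rightarrow> complex" where
  "half_plane_product P F m n z =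
     (\<Prod>i\<in>F. (1 - z / P i) / (1 + z / cnj (P i))) * (\<Prod>j=1..n. (1 + z / of_nat j) ^ (2 * m j))"

text \<open>
  The assumption \<open>balance\<close> lets the linear terms of the two products cancel on every range of moduli.
  The bounds of this locale depend on \<open>\<kappa>\<close>, \<open>Q\<close> and \<open>B\<close> only; this is what makes them uniform in \<open>n\<close>
  and \<open>F\<close>.
\<close>

locale balanced_family =
  fixes P :: "'i \<Rightarrow> complex" and F :: "'i set" and m :: "nat \<Rightarrow> nat" and n :: nat and \<kappa> Q B :: real
  assumes fin: "finite F" and \<kappa>: "0 < \<kappa>" and Q0: "0 \<le> Q" and B0: "0 \<le> B"
    and cone: "\<And>i. i \<in> F \<Longrightarrow> \<kappa> * norm (P i) \<le> Re (P i)"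
    and large: "\<And>i. i \<in> F \<Longrightarrow> 1 < norm (P i)"
    and mB: "\<And>j. real (m j) \<le> B"
    and balance: "\<And>T. \<bar>(\<Sum>i\<in>{i\<in>F. real T < norm (P i)}. Re (1 / P i)) - (\<Sum>j\<in>{T<..n}. real (m j) / real j)\<bar> \<le> Q"
begin

definition N :: real where "N = 4 * (2 * Q + B) / \<kappa>"

lemma N0: "0 \<le> N" using \<kappa> Q0 B0 by (simp add: N_def)

lemma Re_inverse_ge: "i \<in> F \<Longrightarrow> \<kappa> / norm (P i) \<le> Re (1 / P i)"
proof -
  assume i: "i \<in> F"
  have p: "0 < norm (P i)" using large[OF i] by linarith
  have "\<kappa> / norm (P i) = \<kappa> * norm (P i) / (norm (P i))\<^sup>2" using p by (simp add: power2_eq_square)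
  also have "\<dots> \<le> Re (P i) / (norm (P i))\<^sup>2" using cone[OF i] by (intro divide_right_mono) auto
  also have "\<dots> = Re (1 / P i)" by (simp add: Re_divide cmod_power2)
  finally show ?thesis .
qed

text \<open>
  On the shell between \<open>T\<close> and \<open>2 * T\<close> each \<open>Re (1 / P i)\<close> is at least \<open>\<kappa> / (2 * T)\<close> by the cone
  condition, and \<open>balance\<close> bounds their sum.
\<close>

lemma dyadic_count:
  assumes T: "1 \<le> T"
  shows "real (card {i\<in>F. real T < norm (P i) \<and> norm (P i) \<le> real (2 * T)}) \<le> N / 2 * real T"
proof -
  define S where "S = {i\<in>F. real T < norm (P i) \<and> norm (P i) \<le> real (2 * T)}"
  have finS: "finite S" using fin by (simp add: S_def)
  have "real (card S) * (\<kappa> / (2 * real T)) = (\<Sum>i\<in>S. \<kappa> / (2 * real T))" by simp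
  also have "\<dots> \<le> (\<Sum>i\<in>S. Re (1 / P i))"
  proof (rule sum_mono)
    fix i assume i: "i \<in> S"
    then have "norm (P i) \<le> 2 * real T" "0 < norm (P i)" "i \<in> F" using large by (force simp: S_def)+
    then show "\<kappa> / (2 * real T) \<le> Re (1 / P i)"
    proof -
      have "\<kappa> / (2 * real T) \<le> \<kappa> / norm (P i)"
        using \<kappa> \<open>norm (P i) \<le> 2 * real T\<close> \<open>0 < norm (P i)\<close> T by (intro divide_left_mono mult_pos_pos) auto
      then show ?thesis using Re_inverse_ge[OF \<open>i \<in> F\<close>] by linarith
    qed
  qed
  also have "\<dots> = (\<Sum>i\<in>{i\<in>F. real T < norm (P i)}. Re (1 / P i)) - (\<Sum>i\<in>{i\<in>F. real (2 * T) < norm (P i)}. Re (1 / P i))"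
  proof -
    have "{i\<in>F. real T < norm (P i)} = S \<union> {i\<in>F. real (2 * T) < norm (P i)}" by (auto simp: S_def)
    moreover have "(\<Sum>i\<in>S \<union> {i\<in>F. real (2 * T) < norm (P i)}. Re (1 / P i)) = (\<Sum>i\<in>S. Re (1 / P i)) + (\<Sum>i\<in>{i\<in>F. real (2 * T) < norm (P i)}. Re (1 / P i))"
      by (rule sum.union_disjoint) (use fin in \<open>auto simp: S_def\<close>)
    ultimately show ?thesis by simp
  qed
  also have "\<dots> \<le> 2 * Q + ((\<Sum>j\<in>{T<..n}. real (m j) / real j) - (\<Sum>j\<in>{2*T<..n}. real (m j) / real j))"
    using balance[of T] balance[of "2 * T"] by linarith
  also have "(\<Sum>j\<in>{T<..n}. real (m j) / real j) - (\<Sum>j\<in>{2*T<..n}. real (m j) / real j) \<le> B"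
  proof -
    have "(\<Sum>j\<in>{T<..n}. real (m j) / real j) \<le> (\<Sum>j\<in>{T<..2*T} \<union> {2*T<..n}. real (m j) / real j)"
      by (rule sum_mono2) auto
    also have "\<dots> = (\<Sum>j\<in>{T<..2*T}. real (m j) / real j) + (\<Sum>j\<in>{2*T<..n}. real (m j) / real j)"
      by (rule sum.union_disjoint) auto
    also have "(\<Sum>j\<in>{T<..2*T}. real (m j) / real j) \<le> (\<Sum>j\<in>{T<..2*T}. B / real T)"
      using mB B0 T by (intro sum_mono frac_le) auto
    also have "\<dots> = B" using T by simp
    finally show ?thesis by simp
  qed
  finally have "real (card S) * (\<kappa> / (2 * real T)) \<le> 2 * Q + B" by simp
  then have "real (card S) \<le> (2 * Q + B) * (2 * real T) / \<kappa>" using \<kappa> T by (simp add: field_simps)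
  also have "\<dots> = N / 2 * real T" using \<kappa> by (simp add: N_def field_simps)
  finally show ?thesis unfolding S_def .
qed

lemma count_le:
  assumes "0 \<le> t"
  shows "real (card {i\<in>F. norm (P i) \<le> t}) \<le> N * t"
proof (cases "1 \<le> t")
  case False
  then have "{i\<in>F. norm (P i) \<le> t} = {}" using large by force
  then show ?thesis using N0 assms by (metis card.empty mult_nonneg_nonneg of_nat_0)
next
  case True
  have pow: "real (card {i\<in>F. norm (P i) \<le> real (2 ^ k)}) \<le> N / 2 * real (2 ^ k)" for k
  proof (induction k)
    case 0
    then have "{i\<in>F. norm (P i) \<le> real (2 ^ 0)} = {}" using large by force
    then show ?case using N0 by (metis card.empty mult_nonneg_nonneg of_nat_0 of_nat_0_le_iff divide_nonneg_nonneg zero_le_numeral)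
  next
    case (Suc k)
    have "{i\<in>F. norm (P i) \<le> real (2 ^ Suc k)} \<subseteq> {i\<in>F. norm (P i) \<le> real (2 ^ k)} \<union>
        {i\<in>F. real (2 ^ k) < norm (P i) \<and> norm (P i) \<le> real (2 * 2 ^ k)}" by auto
    then have "card {i\<in>F. norm (P i) \<le> real (2 ^ Suc k)} \<le> card ({i\<in>F. norm (P i) \<le> real (2 ^ k)} \<union>
        {i\<in>F. real (2 ^ k) < norm (P i) \<and> norm (P i) \<le> real (2 * 2 ^ k)})"
      by (intro card_mono) (use fin in auto)
    also have "\<dots> \<le> card {i\<in>F. norm (P i) \<le> real (2 ^ k)} + card {i\<in>F. real (2 ^ k) < norm (P i) \<and> norm (P i) \<le> real (2 * 2 ^ k)}"
      by (rule card_Un_le)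
    finally show ?case using Suc.IH dyadic_count[of "2 ^ k"] by simp
  qed
  obtain k where k: "2 ^ k \<le> t" "t < 2 ^ Suc k"
  proof -
    define k where "k = nat \<lfloor>log 2 t\<rfloor>"
    have "real k \<le> log 2 t" "log 2 t < real (Suc k)" unfolding k_def using True by (auto simp: zero_le_log_cancel_iff) linarith
    then have "2 powr real k \<le> t" "t < 2 powr real (Suc k)" using True by (auto simp: le_log_iff log_less_iff)
    then show thesis using that[of k] by (simp only: powr_realpow zero_less_numeral)
  qed
  have "card {i\<in>F. norm (P i) \<le> t} \<le> card {i\<in>F. norm (P i) \<le> real (2 ^ Suc k)}"
    using k fin by (intro card_mono) auto
  then have "real (card {i\<in>F. norm (P i) \<le> t}) \<le> N / 2 * real (2 ^ Suc k)" using pow[of "Suc k"] by linarith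
  also have "\<dots> \<le> N * t" using mult_left_mono[OF k(1) N0] by simp
  finally show ?thesis .
qed

lemma norm_factor:
  assumes "i \<in> F"
  shows "norm ((1 - z / P i) / (1 + z / cnj (P i))) = norm (z - P i) / norm (z + cnj (P i))"
proof -
  have p: "P i \<noteq> 0" using large[OF assms] by auto
  have e: "1 - z / P i = (P i - z) / P i" "1 + z / cnj (P i) = (z + cnj (P i)) / cnj (P i)"
    using p by (auto simp: field_simps)
  show ?thesis unfolding norm_divide e using p by (simp add: norm_minus_commute)
qed

definition growth_const :: "real \<Rightarrow> real" where
  "growth_const \<eta> = 5 * N * ln (1 / \<eta>) + 5 * N + 26 * B + 10 * B + 2 * Q"

text \<open>
  Factors beyond the threshold \<open>T\<close> are expanded to first order, which requires \<open>5 * norm z \<le> T\<close>. The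
  others are estimated one by one, and there are only \<open>O(1 + norm z)\<close> of them.
\<close>

context
  fixes z :: complex and T :: nat
  assumes T: "5 * norm z \<le> real T" "1 \<le> T" "real T \<le> 5 * norm z + 2"
begin

lemma far_sum: "(\<Sum>i\<in>{i\<in>F. real T < norm (P i)}. 6 * ((norm z)\<^sup>2 / (norm (P i))\<^sup>2)) \<le> 5 * N * norm z"
proof -
  have "(\<Sum>i\<in>{i\<in>F. real T < norm (P i)}. 1 / (norm (P i))\<^sup>2) \<le> 4 * N / real T"
    by (rule sum_inverse_square_tail[OF fin N0]) (use T count_le in auto)
  then have "6 * (norm z)\<^sup>2 * (\<Sum>i\<in>{i\<in>F. real T < norm (P i)}. 1 / (norm (P i))\<^sup>2) \<le> 6 * (norm z)\<^sup>2 * (4 * N / real T)"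
    by (intro mult_left_mono) auto
  also have "\<dots> = (24 * N / real T) * norm z * norm z" by (simp add: power2_eq_square)
  also have "\<dots> \<le> (24 * N / real T) * norm z * (real T / 5)"
    using T N0 by (intro mult_left_mono) auto
  also have "\<dots> \<le> 5 * N * norm z" using T N0 by (simp add: field_simps mult_right_mono)
  finally show ?thesis by (simp add: sum_distrib_left)
qed

lemma far_multiplicities: "(\<Sum>j\<in>{T<..n}. real (2 * m j) * ((norm z)\<^sup>2 / (real j)\<^sup>2)) \<le> 2 * B * norm z"
proof -
  have "(\<Sum>j\<in>{T<..n}. real (2 * m j) * ((norm z)\<^sup>2 / (real j)\<^sup>2)) \<le> (\<Sum>j\<in>{T<..n}. (2 * B) * ((norm z)\<^sup>2 / (real j)\<^sup>2))"
    using mB by (intro sum_mono mult_right_mono) auto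
  also have "\<dots> = 2 * B * (norm z)\<^sup>2 * (\<Sum>j\<in>{T<..n}. 1 / (real j)\<^sup>2)" by (simp add: sum_distrib_left)
  also have "\<dots> \<le> 2 * B * (norm z)\<^sup>2 * (1 / real T)"
    using sum_inverse_squares_tail[OF T(2)] B0 by (intro mult_left_mono) auto
  also have "\<dots> = 2 * B * norm z * (norm z / real T)" by (simp add: power2_eq_square)
  also have "\<dots> \<le> 2 * B * norm z * 1" using T B0 by (intro mult_left_mono) auto
  finally show ?thesis by simp
qed

lemma near_count: "real (card {i\<in>F. norm (P i) \<le> real T}) \<le> 5 * N * (1 + norm z)"
proof -
  have "N * real T \<le> N * (5 * norm z + 2)" using T N0 by (intro mult_left_mono) auto
  also have "\<dots> \<le> 5 * N * (1 + norm z)" using N0 by (simp add: algebra_simps)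
  finally show ?thesis using count_le[of "real T"] by simp
qed

lemma balance_far:
  "\<bar>2 * Re z * (\<Sum>i\<in>{i\<in>F. real T < norm (P i)}. Re (1 / P i)) - 2 * Re z * (\<Sum>j\<in>{T<..n}. real (m j) / real j)\<bar> \<le> 2 * Q * norm z"
proof -
  have "\<bar>2 * Re z * ((\<Sum>i\<in>{i\<in>F. real T < norm (P i)}. Re (1 / P i)) - (\<Sum>j\<in>{T<..n}. real (m j) / real j))\<bar> \<le> 2 * norm z * Q"
    unfolding abs_mult using balance[of T] abs_Re_le_cmod[of z] by (intro mult_mono) auto
  then show ?thesis by (simp add: algebra_simps)
qed

lemma split_F: "(\<Prod>i\<in>F. f i) = (\<Prod>i\<in>{i\<in>F. norm (P i) \<le> real T}. f i) * (\<Prod>i\<in>{i\<in>F. real T < norm (P i)}. f i)"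
  for f :: "'i \<Rightarrow> real"
proof -
  have "F = {i\<in>F. norm (P i) \<le> real T} \<union> {i\<in>F. real T < norm (P i)}" by auto
  then show ?thesis using fin by (metis (no_types, lifting) prod.union_disjoint disjoint_iff finite_Un linorder_not_le mem_Collect_eq)
qed

lemma split_n: "(\<Prod>j=1..n. f j) = (\<Prod>j\<in>{1..min T n}. f j) * (\<Prod>j\<in>{T<..n}. f j)"
  for f :: "nat \<Rightarrow> real"
proof -
  have "{1..n} = {1..min T n} \<union> {T<..n}" by auto
  moreover have "(\<Prod>j\<in>{1..min T n} \<union> {T<..n}. f j) = (\<Prod>j\<in>{1..min T n}. f j) * (\<Prod>j\<in>{T<..n}. f j)"
    by (rule prod.union_disjoint) auto
  ultimately show ?thesis by simp
qed

lemma far_factors: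
  assumes "i \<in> F" "real T < norm (P i)"
  shows "norm (z - P i) / norm (z + cnj (P i)) \<le> exp (- (2 * Re z * Re (1 / P i)) + 6 * ((norm z)\<^sup>2 / (norm (P i))\<^sup>2))"
    and "exp (- (2 * Re z * Re (1 / P i)) - 6 * ((norm z)\<^sup>2 / (norm (P i))\<^sup>2)) \<le> norm (z - P i) / norm (z + cnj (P i))"
proof -
  have 1: "P i \<noteq> 0" "norm z \<le> norm (P i) / 5" using assms T large[of i] by auto
  have 2: "0 < norm (z + cnj (P i))"
  proof -
    have "norm (P i) \<le> norm (z + cnj (P i)) + norm z" using norm_triangle_ineq4[of "z + cnj (P i)" z] by simp
    moreover have "0 < norm (P i)" using 1 by simp
    ultimately show ?thesis using 1 by linarith
  qed
  show "norm (z - P i) / norm (z + cnj (P i)) \<le> exp (- (2 * Re z * Re (1 / P i)) + 6 * ((norm z)\<^sup>2 / (norm (P i))\<^sup>2))"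
    using reflect_ratio_ge[OF 1] 2 by (simp add: exp_diff exp_add exp_minus field_simps)
  show "exp (- (2 * Re z * Re (1 / P i)) - 6 * ((norm z)\<^sup>2 / (norm (P i))\<^sup>2)) \<le> norm (z - P i) / norm (z + cnj (P i))"
    using reflect_ratio_le[OF 1] 2 by (simp add: exp_diff exp_add exp_minus field_simps)
qed

end

lemma threshold: obtains T :: nat where "5 * norm (z::complex) \<le> real T" "1 \<le> T" "real T \<le> 5 * norm z + 2"
proof (rule that[of "nat \<lceil>5 * norm z\<rceil> + 1"])
  have "0 \<le> 5 * norm z" by simp
  then show "5 * norm z \<le> real (nat \<lceil>5 * norm z\<rceil> + 1)" "real (nat \<lceil>5 * norm z\<rceil> + 1) \<le> 5 * norm z + 2"
    by linarith+
qed auto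

text \<open>
  The linear terms beyond \<open>T\<close> cancel by \<open>balance_far\<close>. Below \<open>T\<close>, the separation hypothesis bounds each
  quotient by \<open>1 / \<eta>\<close>, and the factors \<open>1 + z / j\<close> are controlled by \<open>one_plus_le_exp_sqrt\<close>.
\<close>

lemma half_plane_product_le:
  assumes \<eta>: "0 < \<eta>" "\<eta> \<le> 1" and sep: "\<And>i. i \<in> F \<Longrightarrow> \<eta> * (norm z + norm (P i)) \<le> norm (z + cnj (P i))"
  shows "norm (half_plane_product P F m n z) \<le> exp (growth_const \<eta> * (1 + norm z))"
proof -
  obtain T :: nat where T: "5 * norm z \<le> real T" "1 \<le> T" "real T \<le> 5 * norm z + 2" by (rule threshold)
  have ln0: "0 \<le> ln (1 / \<eta>)" using \<eta> by simp
  let ?S = "{i\<in>F. norm (P i) \<le> real T}" and ?L = "{i\<in>F. real T < norm (P i)}"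
  define q where "q = (\<lambda>i. norm (z - P i) / norm (z + cnj (P i)))"
  have near: "(\<Prod>i\<in>?S. q i) \<le> exp (5 * N * (1 + norm z) * ln (1 / \<eta>))"
  proof -
    have "(\<Prod>i\<in>?S. q i) \<le> (\<Prod>i\<in>?S. exp (ln (1 / \<eta>)))"
    proof (rule prod_mono)
      fix i assume i: "i \<in> ?S"
      then have "1 < norm (P i)" using large by blast
      then have pos: "0 < norm z + norm (P i)" using norm_ge_zero[of z] by linarith
      have iF: "i \<in> F" using i by simp
      have "0 < \<eta> * (norm z + norm (P i))" using pos \<eta> by simp
      then have "0 < norm (z + cnj (P i))" using sep[OF iF] by linarith
      moreover have "\<eta> * norm (z - P i) \<le> norm (z + cnj (P i))"
      proof -
        have "\<eta> * norm (z - P i) \<le> \<eta> * (norm z + norm (P i))"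
          using \<eta> norm_triangle_ineq4[of z "P i"] by (intro mult_left_mono) auto
        then show ?thesis using sep[OF iF] by linarith
      qed
      ultimately show "0 \<le> q i \<and> q i \<le> exp (ln (1 / \<eta>))" using \<eta> by (simp add: q_def field_simps)
    qed
    also have "\<dots> = exp (real (card ?S) * ln (1 / \<eta>))" unfolding prod_constant by (rule exp_of_nat_mult [symmetric])
    also have "\<dots> \<le> exp (5 * N * (1 + norm z) * ln (1 / \<eta>))"
      using near_count[OF T] ln0 by (simp only: exp_le_cancel_iff) (rule mult_right_mono)
    finally show ?thesis .
  qed
  have far: "(\<Prod>i\<in>?L. q i) \<le> exp (- (2 * Re z * (\<Sum>i\<in>?L. Re (1 / P i))) + 5 * N * norm z)"
  proof -
    have "(\<Prod>i\<in>?L. q i) \<le> (\<Prod>i\<in>?L. exp (- (2 * Re z * Re (1 / P i)) + 6 * ((norm z)\<^sup>2 / (norm (P i))\<^sup>2)))"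
      unfolding q_def using far_factors(1)[OF T] by (intro prod_mono) auto
    also have "\<dots> = exp (\<Sum>i\<in>?L. - (2 * Re z * Re (1 / P i)) + 6 * ((norm z)\<^sup>2 / (norm (P i))\<^sup>2))"
      by (rule exp_sum [symmetric]) (use fin in auto)
    also have "\<dots> \<le> exp (- (2 * Re z * (\<Sum>i\<in>?L. Re (1 / P i))) + 5 * N * norm z)"
      unfolding exp_le_cancel_iff sum.distrib sum_negf sum_distrib_left using far_sum[OF T] by linarith
    finally show ?thesis .
  qed
  define w where "w = (\<lambda>j. norm (1 + z / of_nat j) ^ (2 * m j))"
  have low: "(\<Prod>j\<in>{1..min T n}. w j) \<le> exp (24 * B * (1 + norm z))"
  proof -
    have "(\<Prod>j\<in>{1..min T n}. w j) \<le> (\<Prod>j\<in>{1..min T n}. exp (4 * B * sqrt (norm z) * (1 / sqrt (real j))))"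
    proof (rule prod_mono)
      fix j assume j: "j \<in> {1..min T n}"
      have "norm (1 + z / of_nat j) \<le> 1 + norm z / real j"
        using norm_triangle_ineq[of 1 "z / of_nat j"] by (simp add: norm_divide)
      also have "\<dots> \<le> exp (2 * sqrt (norm z / real j))" by (rule one_plus_le_exp_sqrt) auto
      finally have "w j \<le> exp (2 * sqrt (norm z / real j)) ^ (2 * m j)" unfolding w_def by (rule power_mono) auto
      also have "\<dots> = exp (real (2 * m j) * (2 * sqrt (norm z / real j)))" by (rule exp_of_nat_mult [symmetric])
      also have "\<dots> \<le> exp ((2 * B) * (2 * sqrt (norm z / real j)))"
        unfolding exp_le_cancel_iff using mB[of j] by (intro mult_right_mono) auto
      also have "(2 * B) * (2 * sqrt (norm z / real j)) = 4 * B * sqrt (norm z) * (1 / sqrt (real j))"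
        by (simp add: real_sqrt_divide)
      finally show "0 \<le> w j \<and> w j \<le> exp (4 * B * sqrt (norm z) * (1 / sqrt (real j)))" by (simp add: w_def)
    qed
    also have "\<dots> = exp (\<Sum>j\<in>{1..min T n}. 4 * B * sqrt (norm z) * (1 / sqrt (real j)))" by (rule exp_sum [symmetric]) auto
    also have "\<dots> = exp (4 * B * sqrt (norm z) * (\<Sum>j=1..min T n. 1 / sqrt (real j)))" by (simp only: sum_distrib_left)
    also have "\<dots> \<le> exp (24 * B * (1 + norm z))"
    proof -
      have "(\<Sum>j=1..min T n. 1 / sqrt (real j)) \<le> 2 * sqrt (real (min T n))" by (rule sum_inverse_sqrt_le)
      also have "\<dots> \<le> 2 * sqrt (real T)" by simp
      finally have "4 * B * sqrt (norm z) * (\<Sum>j=1..min T n. 1 / sqrt (real j)) \<le> 4 * B * sqrt (norm z) * (2 * sqrt (real T))"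
        using B0 by (intro mult_left_mono) auto
      also have "\<dots> = 8 * B * sqrt (norm z * real T)" by (simp add: real_sqrt_mult)
      also have "\<dots> \<le> 8 * B * (3 * norm z + 2)"
      proof -
        have "norm z * real T \<le> norm z * (5 * norm z + 2)" using T by (intro mult_left_mono) auto
        also have "\<dots> \<le> (3 * norm z + 2)\<^sup>2" by (simp add: power2_eq_square algebra_simps)
        finally have "sqrt (norm z * real T) \<le> 3 * norm z + 2" by (rule real_le_lsqrt[rotated]) auto
        then show ?thesis using B0 by (intro mult_left_mono) auto
      qed
      also have "\<dots> \<le> 24 * B * (1 + norm z)" using B0 by (simp add: algebra_simps)
      finally show ?thesis by simp
    qed
    finally show ?thesis .
  qed
  have high: "(\<Prod>j\<in>{T<..n}. w j) \<le> exp (2 * Re z * (\<Sum>j\<in>{T<..n}. real (m j) / real j) + 2 * B * norm z)"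
  proof -
    have "(\<Prod>j\<in>{T<..n}. w j) \<le> (\<Prod>j\<in>{T<..n}. exp (2 * Re z * (real (m j) / real j) + real (2 * m j) * ((norm z)\<^sup>2 / (real j)\<^sup>2)))"
    proof (rule prod_mono)
      fix j
      have "norm (1 + z / of_nat j) \<le> exp (Re z / real j + (norm z)\<^sup>2 / (real j)\<^sup>2)"
        using norm_one_plus_le[of "z / of_nat j"] by (simp add: norm_divide power_divide)
      then have "w j \<le> exp (Re z / real j + (norm z)\<^sup>2 / (real j)\<^sup>2) ^ (2 * m j)" unfolding w_def by (rule power_mono) auto
      also have "\<dots> = exp (real (2 * m j) * (Re z / real j + (norm z)\<^sup>2 / (real j)\<^sup>2))" by (rule exp_of_nat_mult [symmetric])
      also have "real (2 * m j) * (Re z / real j + (norm z)\<^sup>2 / (real j)\<^sup>2) = 2 * Re z * (real (m j) / real j) + real (2 * m j) * ((norm z)\<^sup>2 / (real j)\<^sup>2)"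
        by (simp add: algebra_simps)
      finally show "0 \<le> w j \<and> w j \<le> exp (2 * Re z * (real (m j) / real j) + real (2 * m j) * ((norm z)\<^sup>2 / (real j)\<^sup>2))" by (simp add: w_def)
    qed
    also have "\<dots> = exp (\<Sum>j\<in>{T<..n}. 2 * Re z * (real (m j) / real j) + real (2 * m j) * ((norm z)\<^sup>2 / (real j)\<^sup>2))" by (rule exp_sum [symmetric]) auto
    also have "\<dots> \<le> exp (2 * Re z * (\<Sum>j\<in>{T<..n}. real (m j) / real j) + 2 * B * norm z)"
      unfolding exp_le_cancel_iff sum.distrib sum_distrib_left [symmetric] using far_multiplicities[OF T] by simp
    finally show ?thesis .
  qed
  have "norm (half_plane_product P F m n z) = (\<Prod>i\<in>F. q i) * (\<Prod>j=1..n. w j)"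
    unfolding half_plane_product_def norm_mult prod_norm [symmetric] norm_power q_def w_def
    by (simp add: norm_factor cong: prod.cong)
  also have "\<dots> = ((\<Prod>i\<in>?S. q i) * (\<Prod>i\<in>?L. q i)) * ((\<Prod>j\<in>{1..min T n}. w j) * (\<Prod>j\<in>{T<..n}. w j))"
    by (simp only: split_F[OF T] split_n[OF T])
  also have "\<dots> \<le> (exp (5 * N * (1 + norm z) * ln (1 / \<eta>)) * exp (- (2 * Re z * (\<Sum>i\<in>?L. Re (1 / P i))) + 5 * N * norm z)) *
      (exp (24 * B * (1 + norm z)) * exp (2 * Re z * (\<Sum>j\<in>{T<..n}. real (m j) / real j) + 2 * B * norm z))"
    by (intro mult_mono near far low high mult_nonneg_nonneg prod_nonneg) (auto simp: q_def w_def)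
  also have "\<dots> = exp ((5 * N * (1 + norm z) * ln (1 / \<eta>) + (- (2 * Re z * (\<Sum>i\<in>?L. Re (1 / P i))) + 5 * N * norm z)) +
      (24 * B * (1 + norm z) + (2 * Re z * (\<Sum>j\<in>{T<..n}. real (m j) / real j) + 2 * B * norm z)))"
    by (simp only: exp_add)
  also have "\<dots> \<le> exp (growth_const \<eta> * (1 + norm z))"
  proof -
    have nn: "0 \<le> N * ln (1 / \<eta>)" "0 \<le> B * norm z" using N0 ln0 B0 by simp_all
    show ?thesis unfolding exp_le_cancel_iff growth_const_def using balance_far[OF T]
      by (simp add: algebra_simps abs_le_iff) (use nn N0 B0 Q0 in linarith)
  qed
  finally show ?thesis .
qed

text \<open>
  In comparison with the upper bound, zeros and poles exchange their roles; in the right half plane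
  the factors \<open>1 + z / j\<close> below \<open>T\<close> have modulus at least \<open>1\<close>.
\<close>

lemma half_plane_product_ge:
  assumes \<eta>: "0 < \<eta>" "\<eta> \<le> 1" and sep: "\<And>i. i \<in> F \<Longrightarrow> \<eta> * (norm z + norm (P i)) \<le> norm (z - P i)"
    and z: "0 \<le> Re z"
  shows "exp (- growth_const \<eta> * (1 + norm z)) \<le> norm (half_plane_product P F m n z)"
proof -
  obtain T :: nat where T: "5 * norm z \<le> real T" "1 \<le> T" "real T \<le> 5 * norm z + 2" by (rule threshold)
  have ln0: "0 \<le> ln (1 / \<eta>)" using \<eta> by simp
  let ?S = "{i\<in>F. norm (P i) \<le> real T}" and ?L = "{i\<in>F. real T < norm (P i)}"
  define q where "q = (\<lambda>i. norm (z - P i) / norm (z + cnj (P i)))"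
  have near: "exp (- (5 * N * (1 + norm z) * ln (1 / \<eta>))) \<le> (\<Prod>i\<in>?S. q i)"
  proof -
    have "exp (- (5 * N * (1 + norm z) * ln (1 / \<eta>))) \<le> exp (real (card ?S) * (- ln (1 / \<eta>)))"
      using near_count[OF T] ln0 by (simp add: mult_right_mono)
    also have "\<dots> = (\<Prod>i\<in>?S. exp (- ln (1 / \<eta>)))" unfolding prod_constant by (rule exp_of_nat_mult)
    also have "\<dots> \<le> (\<Prod>i\<in>?S. q i)"
    proof (rule prod_mono)
      fix i assume i: "i \<in> ?S"
      have "0 < Re (P i)" using cone[of i] large[of i] i \<kappa> by (smt (verit) mem_Collect_eq mult_pos_pos)
      then have "0 < Re (z + cnj (P i))" using z by simp
      then have pos: "0 < norm (z + cnj (P i))" using complex_Re_le_cmod[of "z + cnj (P i)"] by linarith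
      have "\<eta> * norm (z + cnj (P i)) \<le> \<eta> * (norm z + norm (P i))"
        using \<eta> norm_triangle_ineq[of z "cnj (P i)"] by (intro mult_left_mono) auto
      also have "\<dots> \<le> norm (z - P i)" using sep i by blast
      finally have "\<eta> \<le> q i" using pos by (simp add: q_def field_simps)
      moreover have "exp (- ln (1 / \<eta>)) = \<eta>" using \<eta> by (simp add: ln_div)
      ultimately show "0 \<le> exp (- ln (1 / \<eta>)) \<and> exp (- ln (1 / \<eta>)) \<le> q i" using \<eta> by simp
    qed
    finally show ?thesis .
  qed
  have far: "exp (- (2 * Re z * (\<Sum>i\<in>?L. Re (1 / P i))) - 5 * N * norm z) \<le> (\<Prod>i\<in>?L. q i)"
  proof -
    have "exp (- (2 * Re z * (\<Sum>i\<in>?L. Re (1 / P i))) - 5 * N * norm z)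
        \<le> exp (\<Sum>i\<in>?L. - (2 * Re z * Re (1 / P i)) - 6 * ((norm z)\<^sup>2 / (norm (P i))\<^sup>2))"
      unfolding exp_le_cancel_iff sum_subtractf sum_negf sum_distrib_left using far_sum[OF T] by linarith
    also have "\<dots> = (\<Prod>i\<in>?L. exp (- (2 * Re z * Re (1 / P i)) - 6 * ((norm z)\<^sup>2 / (norm (P i))\<^sup>2)))"
      by (rule exp_sum) (use fin in auto)
    also have "\<dots> \<le> (\<Prod>i\<in>?L. q i)"
      unfolding q_def using far_factors(2)[OF T] by (intro prod_mono) auto
    finally show ?thesis .
  qed
  define w where "w = (\<lambda>j. norm (1 + z / of_nat j) ^ (2 * m j))"
  have low: "1 \<le> (\<Prod>j\<in>{1..min T n}. w j)"
  proof (rule prod_ge_1)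
    fix j
    have "1 \<le> Re (1 + z / of_nat j)" using z by simp
    then have "1 \<le> norm (1 + z / of_nat j)" using complex_Re_le_cmod[of "1 + z / of_nat j"] by linarith
    then show "1 \<le> w j" by (simp add: w_def)
  qed
  have high: "exp (2 * Re z * (\<Sum>j\<in>{T<..n}. real (m j) / real j) - 10 * B * norm z) \<le> (\<Prod>j\<in>{T<..n}. w j)"
  proof -
    have "exp (2 * Re z * (\<Sum>j\<in>{T<..n}. real (m j) / real j) - 10 * B * norm z)
      \<le> exp (\<Sum>j\<in>{T<..n}. 2 * Re z * (real (m j) / real j) - 5 * (real (2 * m j) * ((norm z)\<^sup>2 / (real j)\<^sup>2)))"
      unfolding exp_le_cancel_iff sum_subtractf sum_distrib_left [symmetric] using far_multiplicities[OF T] by simp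
    also have "\<dots> = (\<Prod>j\<in>{T<..n}. exp (2 * Re z * (real (m j) / real j) - 5 * (real (2 * m j) * ((norm z)\<^sup>2 / (real j)\<^sup>2))))" by (rule exp_sum) auto
    also have "\<dots> \<le> (\<Prod>j\<in>{T<..n}. w j)"
    proof (rule prod_mono)
      fix j assume j: "j \<in> {T<..n}"
      have "5 * norm z \<le> real j" using T(1) j by (simp add: order_trans)
      then have "norm (z / of_nat j) \<le> 1/5" using j by (simp add: norm_divide field_simps)
      from norm_one_plus_ge[OF this]
      have "exp (Re z / real j - 5 * ((norm z)\<^sup>2 / (real j)\<^sup>2)) \<le> norm (1 + z / of_nat j)"
        by (simp add: norm_divide power_divide)
      then have "exp (Re z / real j - 5 * ((norm z)\<^sup>2 / (real j)\<^sup>2)) ^ (2 * m j) \<le> w j" unfolding w_def by (rule power_mono) auto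
      moreover have "exp (Re z / real j - 5 * ((norm z)\<^sup>2 / (real j)\<^sup>2)) ^ (2 * m j) = exp (real (2 * m j) * (Re z / real j - 5 * ((norm z)\<^sup>2 / (real j)\<^sup>2)))" by (rule exp_of_nat_mult [symmetric])
      moreover have "real (2 * m j) * (Re z / real j - 5 * ((norm z)\<^sup>2 / (real j)\<^sup>2)) = 2 * Re z * (real (m j) / real j) - 5 * (real (2 * m j) * ((norm z)\<^sup>2 / (real j)\<^sup>2))"
        by (simp add: algebra_simps)
      ultimately show "0 \<le> exp (2 * Re z * (real (m j) / real j) - 5 * (real (2 * m j) * ((norm z)\<^sup>2 / (real j)\<^sup>2))) \<and>
         exp (2 * Re z * (real (m j) / real j) - 5 * (real (2 * m j) * ((norm z)\<^sup>2 / (real j)\<^sup>2))) \<le> w j" by simp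
    qed
    finally show ?thesis .
  qed
  have "exp (- growth_const \<eta> * (1 + norm z)) \<le> exp ((- (5 * N * (1 + norm z) * ln (1 / \<eta>)) + (- (2 * Re z * (\<Sum>i\<in>?L. Re (1 / P i))) - 5 * N * norm z)) +
      (0 + (2 * Re z * (\<Sum>j\<in>{T<..n}. real (m j) / real j) - 10 * B * norm z)))"
  proof -
    have nn: "0 \<le> N * ln (1 / \<eta>)" "0 \<le> B * norm z" using N0 ln0 B0 by simp_all
    show ?thesis unfolding exp_le_cancel_iff growth_const_def using balance_far[OF T]
      by (simp add: algebra_simps abs_le_iff) (use nn N0 B0 Q0 in linarith)
  qed
  also have "\<dots> = (exp (- (5 * N * (1 + norm z) * ln (1 / \<eta>))) * exp (- (2 * Re z * (\<Sum>i\<in>?L. Re (1 / P i))) - 5 * N * norm z)) *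
      (exp 0 * exp (2 * Re z * (\<Sum>j\<in>{T<..n}. real (m j) / real j) - 10 * B * norm z))"
    by (simp only: exp_add)
  also have "\<dots> \<le> ((\<Prod>i\<in>?S. q i) * (\<Prod>i\<in>?L. q i)) * ((\<Prod>j\<in>{1..min T n}. w j) * (\<Prod>j\<in>{T<..n}. w j))"
    unfolding exp_zero
    by (intro mult_mono near far low high mult_nonneg_nonneg prod_nonneg) (auto simp: q_def w_def)
  also have "\<dots> = (\<Prod>i\<in>F. q i) * (\<Prod>j=1..n. w j)"
    by (simp only: split_F[OF T] split_n[OF T])
  also have "\<dots> = norm (half_plane_product P F m n z)"
    unfolding half_plane_product_def norm_mult prod_norm [symmetric] norm_power q_def w_def
    by (simp add: norm_factor cong: prod.cong)
  finally show ?thesis .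
qed

lemma half_plane_product_imaginary:
  "norm (half_plane_product P F m n (\<i> * of_real y)) = (\<Prod>j=1..n. (1 + y\<^sup>2 / (real j)\<^sup>2) ^ m j)"
proof -
  have one: "norm (\<i> * of_real y - P i) / norm (\<i> * of_real y + cnj (P i)) = 1" if i: "i \<in> F" for i
  proof -
    have "(norm (\<i> * of_real y + cnj (P i)))\<^sup>2 = (norm (\<i> * of_real y - P i))\<^sup>2" by (simp add: norm_reflect_sq)
    then have eq: "norm (\<i> * of_real y + cnj (P i)) = norm (\<i> * of_real y - P i)" by simp
    have "0 < Re (P i)" using cone[OF i] large[OF i] \<kappa> by (smt (verit) mult_pos_pos)
    then have "\<i> * of_real y + cnj (P i) \<noteq> 0" by (auto simp: complex_eq_iff)
    then show ?thesis unfolding eq [symmetric] by simp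
  qed
  have two: "norm (1 + \<i> * of_real y / of_nat j) ^ (2 * m j) = (1 + y\<^sup>2 / (real j)\<^sup>2) ^ m j" for j
  proof -
    have "(norm (1 + \<i> * of_real y / of_nat j))\<^sup>2 = 1 + y\<^sup>2 / (real j)\<^sup>2"
      by (simp add: cmod_power2 power_divide)
    then show ?thesis by (simp add: power_mult)
  qed
  show ?thesis
    unfolding half_plane_product_def norm_mult prod_norm [symmetric] norm_power two
    by (simp add: norm_factor one cong: prod.cong)
qed

end

section \<open>Splitting a function along a triangle\<close>

text \<open>
  An isosceles triangle with apex \<open>s\<close>, sides of slope \<open>k\<close> and \<open>-k\<close>, and a vertical side at \<open>L - s\<close>.
  As \<open>s\<close> increases all three sides move inwards, so the values \<open>s = 1, \<dots>, 5\<close> give nested triangles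
  with gaps of a fixed width.
\<close>

definition open_triangle :: "real \<Rightarrow> real \<Rightarrow> real \<Rightarrow> complex set" where
  "open_triangle k L s = {z. \<bar>Im z\<bar> < k * (Re z - s) \<and> Re z < L - s}"

definition closed_triangle :: "real \<Rightarrow> real \<Rightarrow> real \<Rightarrow> complex set" where
  "closed_triangle k L s = {z. \<bar>Im z\<bar> \<le> k * (Re z - s) \<and> Re z \<le> L - s}"

definition triangle_path :: "real \<Rightarrow> real \<Rightarrow> real \<Rightarrow> real \<Rightarrow> complex" where
  "triangle_path k L s =
     (let a = of_real s; b = Complex (L - s) (- (k * (L - 2 * s))); c = Complex (L - s) (k * (L - 2 * s))
      in linepath a b +++ linepath b c +++ linepath c a)"

lemma open_open_triangle: "open (open_triangle k L s)"
proof -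
  have "open_triangle k L s = {z. \<bar>Im z\<bar> < k * (Re z - s)} \<inter> {z. Re z < L - s}"
    by (auto simp: open_triangle_def)
  moreover have "open {z. \<bar>Im z\<bar> < k * (Re z - s)}" "open {z. Re z < L - s}"
    by (intro open_Collect_less continuous_intros)+
  ultimately show ?thesis by auto
qed

lemma closed_closed_triangle: "closed (closed_triangle k L s)"
proof -
  have "closed_triangle k L s = {z. \<bar>Im z\<bar> \<le> k * (Re z - s)} \<inter> {z. Re z \<le> L - s}"
    by (auto simp: closed_triangle_def)
  moreover have "closed {z. \<bar>Im z\<bar> \<le> k * (Re z - s)}" "closed {z. Re z \<le> L - s}"
    by (intro closed_Collect_le continuous_intros)+
  ultimately show ?thesis by auto
qed

lemma convex_closed_triangle: "convex (closed_triangle k L s)"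
proof -
  have "closed_triangle k L s = {z. Im z - k * Re z \<le> - k * s} \<inter> {z. - Im z - k * Re z \<le> - k * s} \<inter> {z. Re z \<le> L - s}"
    by (auto simp: closed_triangle_def abs_le_iff algebra_simps)
  moreover have "convex {z. Im z - k * Re z \<le> - k * s}"
    using convex_halfspace_le[of "Complex (-k) 1" "- k * s"] by (simp add: inner_complex_def algebra_simps)
  moreover have "convex {z. - Im z - k * Re z \<le> - k * s}"
    using convex_halfspace_le[of "Complex (-k) (-1)" "- k * s"] by (simp add: inner_complex_def algebra_simps)
  moreover have "convex {z. Re z \<le> L - s}" by (rule convex_halfspace_Re_le)
  ultimately show ?thesis by (auto intro: convex_Int)
qed

text \<open>
  The integrand is differentiated in \<open>z\<close> under the integral sign; the path need not be closed.
\<close>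

lemma holomorphic_linepath_cauchy:
  assumes "continuous_on (closed_segment a b) g" "S \<inter> closed_segment a b = {}" "open S"
  shows "(\<lambda>z. contour_integral (linepath a b) (\<lambda>\<zeta>. g \<zeta> / (\<zeta> - z))) holomorphic_on S"
proof -
  have int: "((\<lambda>\<zeta>. g \<zeta> / (\<zeta> - w) ^ 1) has_contour_integral contour_integral (linepath a b) (\<lambda>\<zeta>. g \<zeta> / (\<zeta> - w))) (linepath a b)"
    if "w \<in> S - path_image (linepath a b)" for w
  proof -
    have "continuous_on (closed_segment a b) (\<lambda>\<zeta>. g \<zeta> / (\<zeta> - w))"
    proof (rule continuous_on_divide[OF assms(1)])
      show "continuous_on (closed_segment a b) (\<lambda>\<zeta>. \<zeta> - w)" by (intro continuous_intros)
      show "\<forall>\<zeta>\<in>closed_segment a b. \<zeta> - w \<noteq> 0" using that by auto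
    qed
    then have "(\<lambda>\<zeta>. g \<zeta> / (\<zeta> - w)) contour_integrable_on linepath a b"
      by (rule contour_integrable_continuous_linepath)
    then have "((\<lambda>\<zeta>. g \<zeta> / (\<zeta> - w)) has_contour_integral contour_integral (linepath a b) (\<lambda>\<zeta>. g \<zeta> / (\<zeta> - w))) (linepath a b)"
      by (rule has_contour_integral_integral)
    moreover have "(\<lambda>\<zeta>. g \<zeta> / (\<zeta> - w) ^ 1) = (\<lambda>\<zeta>. g \<zeta> / (\<zeta> - w))" by (simp only: power_one_right)
    ultimately show ?thesis by metis
  qed
  have "\<exists>f'. ((\<lambda>z. contour_integral (linepath a b) (\<lambda>\<zeta>. g \<zeta> / (\<zeta> - z))) has_field_derivative f') (at w)" if "w \<in> S" for w
  proof -
    have "w \<in> S - path_image (linepath a b)" using that assms(2) by auto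
    have "((\<lambda>z. contour_integral (linepath a b) (\<lambda>\<zeta>. g \<zeta> / (\<zeta> - z))) has_field_derivative
        (of_nat 1 * contour_integral (linepath a b) (\<lambda>\<zeta>. g \<zeta> / (\<zeta> - w) ^ Suc 1))) (at w)"
    proof (rule Cauchy_next_derivative(2)[where B = "norm (b - a)" and S = S])
      show "continuous_on (path_image (linepath a b)) g" using assms(1) by simp
      show "w \<in> S - path_image (linepath a b)" by fact
      show "((\<lambda>\<zeta>. g \<zeta> / (\<zeta> - w) ^ 1) has_contour_integral contour_integral (linepath a b) (\<lambda>\<zeta>. g \<zeta> / (\<zeta> - w))) (linepath a b)"
        if "w \<in> S - path_image (linepath a b)" for w using int[OF that] .
    qed (use assms(3) in auto)
    then show ?thesis by blast
  qed
  then show ?thesis unfolding holomorphic_on_open[OF assms(3)] by blast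
qed

lemma segment_integral_bound:
  fixes h :: "complex \<Rightarrow> complex"
  assumes c: "continuous_on (closed_segment a b) h"
    and le: "\<And>t. 0 \<le> t \<Longrightarrow> t \<le> 1 \<Longrightarrow> norm (h (linepath a b t)) * norm (b - a) \<le> H t"
    and H: "(H has_integral I) {0..1}"
  shows "norm (contour_integral (linepath a b) h) \<le> I"
proof -
  have int: "h contour_integrable_on linepath a b" by (rule contour_integrable_continuous_linepath[OF c])
  then have i: "((\<lambda>t. h (linepath a b t) * (b - a)) has_integral contour_integral (linepath a b) h) {0..1}"
    using has_contour_integral_integral has_contour_integral_linepath by blast
  have le: "norm (integral {0..1} (\<lambda>t. h (linepath a b t) * (b - a))) \<le> integral {0..1} H"
    by (rule integral_norm_bound_integral) (use i H assms(2) in \<open>auto simp: norm_mult has_integral_integrable\<close>)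
  show ?thesis using le unfolding integral_unique[OF i] integral_unique[OF H] .
qed

lemma inverse_square_integral:
  fixes s l :: real
  assumes "0 < s" "0 \<le> l"
  shows "((\<lambda>t. l / (s + t * l)\<^sup>2) has_integral (1 / s - 1 / (s + l))) {0..1}"
proof -
  have "((\<lambda>t. l / (s + t * l)\<^sup>2) has_integral ((- 1 / (s + 1 * l)) - (- 1 / (s + 0 * l)))) {0..1}"
  proof (rule fundamental_theorem_of_calculus[of 0 1 "\<lambda>t. - 1 / (s + t * l)"])
    fix t :: real assume "t \<in> {0..1}"
    then have "0 \<le> t * l" using assms by simp
    then have "s + t * l \<noteq> 0" using assms by linarith
    then show "((\<lambda>t. - 1 / (s + t * l)) has_vector_derivative l / (s + t * l)\<^sup>2) (at t within {0..1})"
      unfolding has_real_derivative_iff_has_vector_derivative [symmetric]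
      by (auto intro!: derivative_eq_intros simp: power2_eq_square)
  qed auto
  then show ?thesis by simp
qed

locale triangle =
  fixes k L :: real
  assumes k: "1 \<le> k" and L: "20 < L"
begin

abbreviation "T \<equiv> open_triangle k L"
abbreviation "T' \<equiv> closed_triangle k L"

definition va where "va s = complex_of_real s"
definition vb where "vb s = Complex (L - s) (- (k * (L - 2 * s)))"
definition vc where "vc s = Complex (L - s) (k * (L - 2 * s))"

lemma triangle_path_eq: "triangle_path k L s = linepath (va s) (vb s) +++ linepath (vb s) (vc s) +++ linepath (vc s) (va s)"
  by (simp add: triangle_path_def va_def vb_def vc_def Let_def)

lemma path_triangle [simp]: "valid_path (triangle_path k L s)" "pathstart (triangle_path k L s) = of_real s"
   "pathfinish (triangle_path k L s) = of_real s"
  by (auto simp: triangle_path_eq va_def)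

definition edge :: "real \<Rightarrow> complex set" where
  "edge s = {z \<in> T' s. k * (Re z - s) = \<bar>Im z\<bar> \<or> Re z = L - s}"

lemma edges:
  assumes s: "1 \<le> s" "s \<le> 5"
  shows "closed_segment (va s) (vb s) \<subseteq> edge s" "closed_segment (vb s) (vc s) \<subseteq> edge s" "closed_segment (vc s) (va s) \<subseteq> edge s"
proof -
  have Ls: "0 \<le> L - 2 * s" using s L by linarith
  have conv: "(1 - u) * (L - 2 * s) \<ge> 0" "u * (L - 2 * s) \<ge> 0" "0 \<le> k * (u * (L - 2 * s))" "0 \<le> k * ((1 - u) * (L - 2 * s))"
    if "0 \<le> u" "u \<le> 1" for u :: real using that Ls k by auto
  show "closed_segment (va s) (vb s) \<subseteq> edge s"
  proof
    fix z assume "z \<in> closed_segment (va s) (vb s)"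
    then obtain u where u: "0 \<le> u" "u \<le> 1" "z = (1 - u) *\<^sub>R va s + u *\<^sub>R vb s" by (auto simp: closed_segment_def)
    have re: "Re z = s + u * (L - 2 * s)" and im: "Im z = - (k * (u * (L - 2 * s)))"
      by (simp_all add: u va_def vb_def algebra_simps)
    have "L - s - Re z = (1 - u) * (L - 2 * s)" unfolding re by (simp add: algebra_simps)
    then have le: "Re z \<le> L - s" using conv(1)[OF u(1,2)] by linarith
    have i: "\<bar>Im z\<bar> = k * (u * (L - 2 * s))" unfolding im abs_minus_cancel using conv(3)[OF u(1,2)] by (rule abs_of_nonneg)
    have r: "k * (Re z - s) = k * (u * (L - 2 * s))" unfolding re by simp
    show "z \<in> edge s" unfolding edge_def closed_triangle_def mem_Collect_eq i r using le by simp
  qed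
  show "closed_segment (vc s) (va s) \<subseteq> edge s"
  proof
    fix z assume "z \<in> closed_segment (vc s) (va s)"
    then obtain u where u: "0 \<le> u" "u \<le> 1" "z = (1 - u) *\<^sub>R vc s + u *\<^sub>R va s" by (auto simp: closed_segment_def)
    have re: "Re z = s + (1 - u) * (L - 2 * s)" and im: "Im z = k * ((1 - u) * (L - 2 * s))"
      by (simp_all add: u va_def vc_def algebra_simps)
    have "L - s - Re z = u * (L - 2 * s)" unfolding re by (simp add: algebra_simps)
    then have le: "Re z \<le> L - s" using conv(2)[OF u(1,2)] by linarith
    have i: "\<bar>Im z\<bar> = k * ((1 - u) * (L - 2 * s))" unfolding im using conv(4)[OF u(1,2)] by (rule abs_of_nonneg)
    have r: "k * (Re z - s) = k * ((1 - u) * (L - 2 * s))" unfolding re by simp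
    show "z \<in> edge s" unfolding edge_def closed_triangle_def mem_Collect_eq i r using le by simp
  qed
  show "closed_segment (vb s) (vc s) \<subseteq> edge s"
  proof
    fix z assume "z \<in> closed_segment (vb s) (vc s)"
    then obtain u where u: "0 \<le> u" "u \<le> 1" "z = (1 - u) *\<^sub>R vb s + u *\<^sub>R vc s" by (auto simp: closed_segment_def)
    have re: "Re z = L - s" and im: "Im z = (2 * u - 1) * (k * (L - 2 * s))"
      by (simp_all add: u vb_def vc_def algebra_simps)
    have "\<bar>2 * u - 1\<bar> * (k * (L - 2 * s)) \<le> 1 * (k * (L - 2 * s))"
      using u k Ls by (intro mult_right_mono) (auto simp: abs_le_iff)
    then have "\<bar>Im z\<bar> \<le> k * (L - 2 * s)" unfolding im abs_mult using k Ls by simp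
    then show "z \<in> edge s" by (simp add: edge_def closed_triangle_def re algebra_simps)
  qed
qed

lemma path_image_triangle: "1 \<le> s \<Longrightarrow> s \<le> 5 \<Longrightarrow> path_image (triangle_path k L s) \<subseteq> edge s"
  unfolding triangle_path_eq using edges[of s] by (auto simp: path_image_join)

lemma T_subset_hull:
  assumes s: "1 \<le> s" "s \<le> 5" and z: "z \<in> T s"
  shows "z \<in> interior (convex hull {va s, vb s, vc s})"
proof -
  have Ls: "0 < L - 2 * s" using s L by linarith
  have "T s \<subseteq> convex hull {va s, vb s, vc s}"
  proof
    fix z assume z: "z \<in> T s"
    define \<alpha> where "\<alpha> = (L - s - Re z) / (L - 2 * s)"
    define q where "q = (Re z - s) / (L - 2 * s)"
    define r where "r = Im z / (k * (L - 2 * s))"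
    have kL: "0 < k * (L - 2 * s)" using k Ls by simp
    have z': "\<bar>Im z\<bar> < k * (Re z - s)" "Re z < L - s" using z by (auto simp: open_triangle_def)
    have qr: "\<bar>r\<bar> \<le> q"
    proof -
      have q: "q = (k * (Re z - s)) / (k * (L - 2 * s))" using k by (simp add: q_def)
      show ?thesis unfolding q r_def abs_divide abs_of_pos[OF kL] using z' kL by (intro divide_right_mono) auto
    qed
    have sum: "\<alpha> + (q - r) / 2 + (q + r) / 2 = 1"
    proof -
      have "\<alpha> + q = (L - 2 * s) / (L - 2 * s)" unfolding \<alpha>_def q_def by (simp add: add_divide_distrib [symmetric])
      then show ?thesis using Ls by (simp add: field_simps)
    qed
    have eq: "z = \<alpha> *\<^sub>R va s + ((q - r) / 2) *\<^sub>R vb s + ((q + r) / 2) *\<^sub>R vc s"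
    proof (rule complex_eqI)
      have "Re (\<alpha> *\<^sub>R va s + ((q - r) / 2) *\<^sub>R vb s + ((q + r) / 2) *\<^sub>R vc s) = \<alpha> * s + q * (L - s)"
        by (simp add: va_def vb_def vc_def) (simp add: field_simps)
      also have "\<dots> = (1 - q) * s + q * (L - s)"
      proof -
        have "\<alpha> = 1 - q" using sum by (simp add: field_simps)
        then show ?thesis by simp
      qed
      also have "(1 - q) * s + q * (L - s) = s + q * (L - 2 * s)" by (simp add: algebra_simps)
      also have "\<dots> = Re z" using Ls by (simp add: q_def)
      finally show "Re z = Re (\<alpha> *\<^sub>R va s + ((q - r) / 2) *\<^sub>R vb s + ((q + r) / 2) *\<^sub>R vc s)" by simp
      have "Im (\<alpha> *\<^sub>R va s + ((q - r) / 2) *\<^sub>R vb s + ((q + r) / 2) *\<^sub>R vc s) = r * (k * (L - 2 * s))"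
        by (simp add: va_def vb_def vc_def) (simp add: field_simps)
      also have "\<dots> = Im z" unfolding r_def using kL by (metis less_irrefl nonzero_mult_div_cancel_right times_divide_eq_left)
      finally show "Im z = Im (\<alpha> *\<^sub>R va s + ((q - r) / 2) *\<^sub>R vb s + ((q + r) / 2) *\<^sub>R vc s)" by simp
    qed
    have nn: "0 \<le> \<alpha>" "0 \<le> (q - r) / 2" "0 \<le> (q + r) / 2" using z' Ls qr by (auto simp: \<alpha>_def)
    show "z \<in> convex hull {va s, vb s, vc s}"
      unfolding convex_hull_3 using sum eq nn by blast
  qed
  then show ?thesis using z open_open_triangle interior_maximal by blast
qed

lemma winding_inside:
  assumes s: "1 \<le> s" "s \<le> 5" and z: "z \<in> T s"
  shows "winding_number (triangle_path k L s) z = 1"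
proof -
  have Ls: "0 < L - 2 * s" using s L by linarith
  have "Im ((vb s - va s) * cnj (vb s - z)) = (L - 2 * s) * (Im z + k * (Re z - s))"
    by (simp add: vb_def va_def algebra_simps)
  moreover have "0 < Im z + k * (Re z - s)" using z by (auto simp: open_triangle_def)
  ultimately have "0 < Im ((vb s - va s) * cnj (vb s - z))" using Ls by simp
  then show ?thesis unfolding triangle_path_eq using winding_number_triangle[OF T_subset_hull[OF s z]] by simp
qed

lemma winding_outside:
  assumes s: "1 \<le> s" "s \<le> 5" and z: "z \<notin> T' s"
  shows "winding_number (triangle_path k L s) z = 0"
proof (rule winding_number_zero_outside[OF _ convex_closed_triangle _ z])
  show "path_image (triangle_path k L s) \<subseteq> T' s" using path_image_triangle[OF s] by (auto simp: edge_def)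
qed (auto intro: valid_path_imp_path)

lemma T_mono: "s \<le> t \<Longrightarrow> T t \<subseteq> T s" "s \<le> t \<Longrightarrow> T' t \<subseteq> T' s" "s < t \<Longrightarrow> T' t \<subseteq> T s" "T s \<subseteq> T' s"
proof -
  have m: "k * (x - t) \<le> k * (x - s)" if "s \<le> t" for x using that k by (intro mult_left_mono) auto
  have m2: "k * (x - t) < k * (x - s)" if "s < t" for x using that k by (intro mult_strict_left_mono) auto
  show "T t \<subseteq> T s" if "s \<le> t"
    using that by (auto simp: open_triangle_def intro: less_le_trans[OF _ m[OF that]])
  show "T' t \<subseteq> T' s" if "s \<le> t"
    using that by (auto simp: closed_triangle_def intro: order_trans[OF _ m[OF that]])
  show "T' t \<subseteq> T s" if "s < t"
    using that by (auto simp: closed_triangle_def open_triangle_def intro: le_less_trans[OF _ m2[OF that]])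
  show "T s \<subseteq> T' s" by (auto simp: closed_triangle_def open_triangle_def)
qed

lemma T_edge:
  assumes "z \<in> T s"
  shows "z \<notin> edge s"
proof
  assume "z \<in> edge s"
  then have "k * (Re z - s) = \<bar>Im z\<bar> \<or> Re z = L - s" unfolding edge_def by blast
  moreover have "\<bar>Im z\<bar> < k * (Re z - s)" "Re z < L - s" using assms unfolding open_triangle_def by blast+
  ultimately show False by linarith
qed

text \<open>
  The quantity \<open>k * Re z - |Im z|\<close> is constant along the slanted sides, so a difference of its values
  gives a lower bound for the distance of two points.
\<close>

lemma slope_lipschitz: "\<bar>(k * Re z - \<bar>Im z\<bar>) - (k * Re w - \<bar>Im w\<bar>)\<bar> \<le> (1 + k) * norm (z - w)"
proof -
  have "k * \<bar>Re (z - w)\<bar> \<le> k * norm (z - w)" using k by (intro mult_left_mono abs_Re_le_cmod) auto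
  moreover have "\<bar>Im (z - w)\<bar> \<le> norm (z - w)" by (rule abs_Im_le_cmod)
  moreover have "k * \<bar>Re (z - w)\<bar> = \<bar>k * Re z - k * Re w\<bar>"
  proof -
    have "\<bar>k * Re z - k * Re w\<bar> = \<bar>k\<bar> * \<bar>Re z - Re w\<bar>" by (simp only: right_diff_distrib [symmetric] abs_mult)
    then show ?thesis using k by simp
  qed
  moreover have "\<bar>Im (z - w)\<bar> = \<bar>Im z - Im w\<bar>" by simp
  moreover have "(1 + k) * norm (z - w) = norm (z - w) + k * norm (z - w)" by (simp add: distrib_right)
  ultimately show ?thesis by linarith
qed

lemma edge_distance:
  assumes w: "w \<in> edge s" and z: "(s = 2 \<and> z \<in> T 3) \<or> (s = 4 \<and> z \<notin> T 3)"
  shows "1 / 2 \<le> norm (w - z)"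
proof -
  have one: "1 / 2 \<le> norm (w - z)" if "k \<le> \<bar>(k * Re w - \<bar>Im w\<bar>) - (k * Re z - \<bar>Im z\<bar>)\<bar>"
  proof -
    have "k \<le> (1 + k) * norm (w - z)" using slope_lipschitz[of w z] that by linarith
    then have "k / (1 + k) \<le> norm (w - z)" using k by (simp add: pos_divide_le_eq mult.commute)
    moreover have "1 / 2 \<le> k / (1 + k)" using k by (simp add: field_simps)
    ultimately show ?thesis by linarith
  qed
  have two: "1 / 2 \<le> norm (w - z)" if "1 \<le> \<bar>Re w - Re z\<bar>"
    using abs_Re_le_cmod[of "w - z"] that by simp
  have w': "\<bar>Im w\<bar> \<le> k * (Re w - s)" "Re w \<le> L - s" "k * (Re w - s) = \<bar>Im w\<bar> \<or> Re w = L - s"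
    using w by (auto simp: edge_def closed_triangle_def)
  from z show ?thesis
  proof
    assume z: "s = 2 \<and> z \<in> T 3"
    then have z': "\<bar>Im z\<bar> < k * (Re z - 3)" "Re z < L - 3" by (auto simp: open_triangle_def)
    from w'(3) show ?thesis
    proof
      assume "k * (Re w - s) = \<bar>Im w\<bar>"
      then show ?thesis using z z' by (intro one) (simp add: algebra_simps)
    next
      assume "Re w = L - s"
      then show ?thesis using z z' by (intro two) simp
    qed
  next
    assume z: "s = 4 \<and> z \<notin> T 3"
    then have "k * (Re z - 3) \<le> \<bar>Im z\<bar> \<or> L - 3 \<le> Re z" by (auto simp: open_triangle_def not_less)
    then show ?thesis
    proof
      assume "k * (Re z - 3) \<le> \<bar>Im z\<bar>"
      then show ?thesis using z w' by (intro one) (simp add: algebra_simps)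
    next
      assume "L - 3 \<le> Re z"
      then show ?thesis using z w' by (intro two) simp
    qed
  qed
qed

definition cauchy_int :: "(complex \<Rightarrow> complex) \<Rightarrow> real \<Rightarrow> complex \<Rightarrow> complex" where
  "cauchy_int g s z = (contour_integral (linepath (va s) (vb s)) (\<lambda>\<zeta>. g \<zeta> / (\<zeta> - z)) +
     contour_integral (linepath (vb s) (vc s)) (\<lambda>\<zeta>. g \<zeta> / (\<zeta> - z)) +
     contour_integral (linepath (vc s) (va s)) (\<lambda>\<zeta>. g \<zeta> / (\<zeta> - z))) / (2 * of_real pi * \<i>)"

lemma cauchy_int_holomorphic:
  assumes s: "1 \<le> s" "s \<le> 5" and g: "continuous_on (edge s) g" and S: "open S" "S \<inter> edge s = {}"
  shows "cauchy_int g s holomorphic_on S"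
proof -
  have "(\<lambda>z. cauchy_int g s z) holomorphic_on S"
    unfolding cauchy_int_def
  proof (intro holomorphic_intros)
    show "(\<lambda>z. contour_integral (linepath (va s) (vb s)) (\<lambda>\<zeta>. g \<zeta> / (\<zeta> - z))) holomorphic_on S"
      by (rule holomorphic_linepath_cauchy) (use edges[OF s] g S in \<open>auto intro: continuous_on_subset\<close>)
    show "(\<lambda>z. contour_integral (linepath (vb s) (vc s)) (\<lambda>\<zeta>. g \<zeta> / (\<zeta> - z))) holomorphic_on S"
      by (rule holomorphic_linepath_cauchy) (use edges[OF s] g S in \<open>auto intro: continuous_on_subset\<close>)
    show "(\<lambda>z. contour_integral (linepath (vc s) (va s)) (\<lambda>\<zeta>. g \<zeta> / (\<zeta> - z))) holomorphic_on S"
      by (rule holomorphic_linepath_cauchy) (use edges[OF s] g S in \<open>auto intro: continuous_on_subset\<close>)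
  qed auto
  then show ?thesis by simp
qed

lemma cauchy_int_path:
  assumes s: "1 \<le> s" "s \<le> 5" and g: "continuous_on (edge s) g" and z: "z \<notin> edge s"
  shows "((\<lambda>\<zeta>. g \<zeta> / (\<zeta> - z)) has_contour_integral (2 * of_real pi * \<i> * cauchy_int g s z)) (triangle_path k L s)"
proof -
  have c: "continuous_on (edge s) (\<lambda>\<zeta>. g \<zeta> / (\<zeta> - z))" using z by (intro continuous_intros g) auto
  have h: "((\<lambda>\<zeta>. g \<zeta> / (\<zeta> - z)) has_contour_integral contour_integral (linepath a b) (\<lambda>\<zeta>. g \<zeta> / (\<zeta> - z))) (linepath a b)"
    if "closed_segment a b \<subseteq> edge s" for a b
    using contour_integrable_continuous_linepath[OF continuous_on_subset[OF c that]] has_contour_integral_integral by blast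
  have "((\<lambda>\<zeta>. g \<zeta> / (\<zeta> - z)) has_contour_integral
      (contour_integral (linepath (va s) (vb s)) (\<lambda>\<zeta>. g \<zeta> / (\<zeta> - z)) +
     (contour_integral (linepath (vb s) (vc s)) (\<lambda>\<zeta>. g \<zeta> / (\<zeta> - z)) +
     contour_integral (linepath (vc s) (va s)) (\<lambda>\<zeta>. g \<zeta> / (\<zeta> - z))))) (triangle_path k L s)"
    unfolding triangle_path_eq by (intro has_contour_integral_join h edges s) auto
  then show ?thesis by (simp add: cauchy_int_def add.assoc)
qed

text \<open>
  Along the slanted sides \<open>Re \<zeta>\<close> grows linearly with the arc length, and the vertical side has length
  \<open>O(L)\<close> and lies at \<open>Re \<zeta> = L - s\<close>. The decay of \<open>g\<close> hence gives a bound that does not depend on \<open>L\<close>.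
\<close>

lemma cauchy_int_bound:
  assumes s: "1 \<le> s" "s \<le> 5" and g: "continuous_on (edge s) g"
    and gle: "\<And>\<zeta>. \<zeta> \<in> edge s \<Longrightarrow> norm (g \<zeta>) \<le> 1 / (Re \<zeta>)\<^sup>2"
    and far: "\<And>\<zeta>. \<zeta> \<in> edge s \<Longrightarrow> 1 / 2 \<le> norm (\<zeta> - z)"
  shows "norm (cauchy_int g s z) \<le> 4 * (1 + k)"
proof -
  have Ls: "0 < L - 2 * s" using s L by linarith
  have c: "continuous_on (edge s) (\<lambda>\<zeta>. g \<zeta> / (\<zeta> - z))" using far by (intro continuous_intros g) force
  have pt: "norm (g \<zeta> / (\<zeta> - z)) \<le> 2 / (Re \<zeta>)\<^sup>2" if "\<zeta> \<in> edge s" for \<zeta>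
  proof -
    have "norm (g \<zeta>) / norm (\<zeta> - z) \<le> (1 / (Re \<zeta>)\<^sup>2) / (1 / 2)"
      using gle[OF that] far[OF that] by (intro frac_le) auto
    then show ?thesis by (simp add: norm_divide)
  qed
  have seg: "linepath a b t \<in> closed_segment a b" if "0 \<le> t" "t \<le> 1" for a b :: complex and t
    using that linepath_in_path by auto
  have len: "norm (vb s - va s) \<le> (1 + k) * (L - 2 * s)" "norm (va s - vc s) \<le> (1 + k) * (L - 2 * s)"
    using cmod_le[of "vb s - va s"] cmod_le[of "va s - vc s"] Ls k
    by (auto simp: va_def vb_def vc_def algebra_simps abs_mult)
  have len2: "norm (vc s - vb s) = 2 * k * (L - 2 * s)"
  proof -
    have "vc s - vb s = \<i> * of_real (2 * k * (L - 2 * s))" by (simp add: vb_def vc_def complex_eq_iff)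
    then have "norm (vc s - vb s) = \<bar>2 * k * (L - 2 * s)\<bar>" by (simp only: norm_mult norm_ii norm_of_real mult_1)
    then show ?thesis using Ls k by (metis abs_of_nonneg less_imp_le mult_nonneg_nonneg order_trans zero_le_numeral zero_le_one)
  qed
  have s1: "1 / s - 1 / (s + (L - 2 * s)) \<le> 1"
  proof -
    have "1 / s \<le> 1" using s by simp
    moreover have "0 \<le> 1 / (s + (L - 2 * s))" by (rule divide_nonneg_nonneg) (use s Ls in linarith)+
    ultimately show ?thesis by linarith
  qed
  have scale_eq: "2 / X * ((1 + k) * l) = 2 * (1 + k) * (l / X)" for X l :: real by (simp add: divide_inverse mult_ac)
  have b1: "norm (contour_integral (linepath (va s) (vb s)) (\<lambda>\<zeta>. g \<zeta> / (\<zeta> - z))) \<le> 2 * (1 + k) * (1 / s - 1 / (s + (L - 2 * s)))"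
  proof (rule segment_integral_bound[where H = "\<lambda>t. 2 * (1 + k) * ((L - 2 * s) / (s + t * (L - 2 * s))\<^sup>2)"])
    show "continuous_on (closed_segment (va s) (vb s)) (\<lambda>\<zeta>. g \<zeta> / (\<zeta> - z))" using continuous_on_subset[OF c edges(1)[OF s]] .
    fix t :: real assume t: "0 \<le> t" "t \<le> 1"
    have on_edge: "linepath (va s) (vb s) t \<in> edge s" using seg[OF t] edges(1)[OF s] by blast
    have re: "Re (linepath (va s) (vb s) t) = s + t * (L - 2 * s)" by (simp add: linepath_def va_def vb_def algebra_simps)
    have "norm (g (linepath (va s) (vb s) t) / (linepath (va s) (vb s) t - z)) \<le> 2 / (s + t * (L - 2 * s))\<^sup>2"
        using pt[OF on_edge] unfolding re .
    then have "norm (g (linepath (va s) (vb s) t) / (linepath (va s) (vb s) t - z)) * norm (vb s - va s) \<le> 2 / (s + t * (L - 2 * s))\<^sup>2 * ((1 + k) * (L - 2 * s))"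
      using len by (intro mult_mono) auto
    then show "norm (g (linepath (va s) (vb s) t) / (linepath (va s) (vb s) t - z)) * norm (vb s - va s) \<le> 2 * (1 + k) * ((L - 2 * s) / (s + t * (L - 2 * s))\<^sup>2)"
      unfolding scale_eq .
  qed (use s Ls in \<open>intro has_integral_mult_right inverse_square_integral; auto\<close>)
  have b3: "norm (contour_integral (linepath (vc s) (va s)) (\<lambda>\<zeta>. g \<zeta> / (\<zeta> - z))) \<le> 2 * (1 + k) * (1 / s - 1 / (s + (L - 2 * s)))"
  proof -
    have "norm (contour_integral (linepath (va s) (vc s)) (\<lambda>\<zeta>. g \<zeta> / (\<zeta> - z))) \<le> 2 * (1 + k) * (1 / s - 1 / (s + (L - 2 * s)))"
    proof (rule segment_integral_bound[where H = "\<lambda>t. 2 * (1 + k) * ((L - 2 * s) / (s + t * (L - 2 * s))\<^sup>2)"])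
      have e: "closed_segment (va s) (vc s) \<subseteq> edge s" using edges(3)[OF s] by (simp add: closed_segment_commute)
      show "continuous_on (closed_segment (va s) (vc s)) (\<lambda>\<zeta>. g \<zeta> / (\<zeta> - z))" using continuous_on_subset[OF c e] .
      fix t :: real assume t: "0 \<le> t" "t \<le> 1"
      have on_edge: "linepath (va s) (vc s) t \<in> edge s" using seg[OF t] e by blast
      have re: "Re (linepath (va s) (vc s) t) = s + t * (L - 2 * s)" by (simp add: linepath_def va_def vc_def algebra_simps)
      have "norm (g (linepath (va s) (vc s) t) / (linepath (va s) (vc s) t - z)) \<le> 2 / (s + t * (L - 2 * s))\<^sup>2"
        using pt[OF on_edge] unfolding re .
      then have "norm (g (linepath (va s) (vc s) t) / (linepath (va s) (vc s) t - z)) * norm (vc s - va s) \<le> 2 / (s + t * (L - 2 * s))\<^sup>2 * ((1 + k) * (L - 2 * s))"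
        using len(2) by (intro mult_mono) (auto simp: norm_minus_commute)
      then show "norm (g (linepath (va s) (vc s) t) / (linepath (va s) (vc s) t - z)) * norm (vc s - va s) \<le> 2 * (1 + k) * ((L - 2 * s) / (s + t * (L - 2 * s))\<^sup>2)"
        unfolding scale_eq .
    qed (use s Ls in \<open>intro has_integral_mult_right inverse_square_integral; auto\<close>)
    moreover have "contour_integral (linepath (vc s) (va s)) (\<lambda>\<zeta>. g \<zeta> / (\<zeta> - z)) = - contour_integral (linepath (va s) (vc s)) (\<lambda>\<zeta>. g \<zeta> / (\<zeta> - z))"
      using contour_integral_reversepath[of "linepath (va s) (vc s)" "\<lambda>\<zeta>. g \<zeta> / (\<zeta> - z)"] by simp
    ultimately show ?thesis by simp
  qed
  have b2: "norm (contour_integral (linepath (vb s) (vc s)) (\<lambda>\<zeta>. g \<zeta> / (\<zeta> - z))) \<le> 4 * k"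
  proof -
    have "norm (contour_integral (linepath (vb s) (vc s)) (\<lambda>\<zeta>. g \<zeta> / (\<zeta> - z))) \<le> 2 / (L - s)\<^sup>2 * norm (vc s - vb s)"
    proof (rule contour_integral_bound_linepath)
      show "(\<lambda>\<zeta>. g \<zeta> / (\<zeta> - z)) contour_integrable_on linepath (vb s) (vc s)"
        by (rule contour_integrable_continuous_linepath[OF continuous_on_subset[OF c edges(2)[OF s]]])
      fix x assume x: "x \<in> closed_segment (vb s) (vc s)"
      then obtain u where u: "x = (1 - u) *\<^sub>R vb s + u *\<^sub>R vc s" by (auto simp: closed_segment_def)
      have "Re x = L - s" unfolding u by (simp add: vb_def vc_def algebra_simps)
      then show "norm (g x / (x - z)) \<le> 2 / (L - s)\<^sup>2" using pt[of x] x edges(2)[OF s] by auto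
    qed auto
    also have "\<dots> = 4 * k * ((L - 2 * s) / (L - s)\<^sup>2)" unfolding len2 by simp
    also have "\<dots> \<le> 4 * k * 1"
    proof -
      have "L - 2 * s \<le> (L - s) * 1" using s by simp
      also have "\<dots> \<le> (L - s) * (L - s)" using s L by (intro mult_left_mono) auto
      finally have "L - 2 * s \<le> 1 * (L - s)\<^sup>2" by (simp only: power2_eq_square mult_1)
      moreover have "0 < (L - s)\<^sup>2" by (rule zero_less_power) (use s L in linarith)
      ultimately have "(L - 2 * s) / (L - s)\<^sup>2 \<le> 1" by (simp only: pos_divide_le_eq)
      then show ?thesis using k by (intro mult_left_mono) auto
    qed
    finally show ?thesis by simp
  qed
  define I1 where "I1 = contour_integral (linepath (va s) (vb s)) (\<lambda>\<zeta>. g \<zeta> / (\<zeta> - z))"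
  define I2 where "I2 = contour_integral (linepath (vb s) (vc s)) (\<lambda>\<zeta>. g \<zeta> / (\<zeta> - z))"
  define I3 where "I3 = contour_integral (linepath (vc s) (va s)) (\<lambda>\<zeta>. g \<zeta> / (\<zeta> - z))"
  have w: "2 * (1 + k) * (1 / s - 1 / (s + (L - 2 * s))) \<le> 2 * (1 + k) * 1" using s1 k by (intro mult_left_mono) auto
  have "norm (I1 + I2 + I3) \<le> norm I1 + norm I2 + norm I3"
    using norm_triangle_ineq[of "I1 + I2" I3] norm_triangle_ineq[of I1 I2] by linarith
  also have "\<dots> \<le> 8 * (1 + k)" using b1 b2 b3 w k unfolding I1_def I2_def I3_def by (simp add: algebra_simps)
  finally have "norm (I1 + I2 + I3) \<le> 8 * (1 + k)" .
  moreover have "norm (cauchy_int g s z) = norm (I1 + I2 + I3) / (2 * pi)"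
    by (simp add: cauchy_int_def I1_def I2_def I3_def norm_divide norm_mult)
  moreover have "norm (I1 + I2 + I3) / (2 * pi) \<le> norm (I1 + I2 + I3) / 2"
    using pi_gt3 by (intro divide_left_mono) auto
  ultimately show ?thesis by simp
qed

text \<open>
  This is the additive Cousin problem for the inside and the outside of a triangle, solved by Cauchy's
  integral formula: between two boundary curves, \<open>g\<close> is the difference of the Cauchy integrals over
  the outer and the inner one. Each integral extends across the ring, and since the curves \<open>s = 2\<close> and
  \<open>s = 4\<close> stay away from \<open>s = 3\<close>, both integrals are bounded up to that curve.
\<close>

lemma cousin_splitting:
  assumes hol: "g holomorphic_on (T 1 - T' 5)"
    and le: "\<And>\<zeta>. \<zeta> \<in> T 1 - T' 5 \<Longrightarrow> norm (g \<zeta>) \<le> 1 / (Re \<zeta>)\<^sup>2"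
  obtains \<Phi>i \<Phi>o where "\<Phi>i holomorphic_on T 2" "\<Phi>o holomorphic_on (- T' 4)"
    "\<And>z. z \<in> T 2 - T' 4 \<Longrightarrow> \<Phi>i z - \<Phi>o z = g z"
    "\<And>z. z \<in> T 3 \<Longrightarrow> norm (\<Phi>i z) \<le> 4 * (1 + k)"
    "\<And>z. z \<notin> T 3 \<Longrightarrow> norm (\<Phi>o z) \<le> 4 * (1 + k)"
proof -
  define U where "U = T 1 - T' 5"
  have opU: "open U" unfolding U_def by (intro open_Diff open_open_triangle closed_closed_triangle)
  have contU: "continuous_on U g" using hol unfolding U_def by (rule holomorphic_on_imp_continuous_on)
  have edgeU: "edge s \<subseteq> U" if "1 < s" "s < 5" for s
  proof
    fix z assume z: "z \<in> edge s"
    have "z \<in> T 1" using z T_mono(3)[OF that(1)] by (auto simp: edge_def)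
    moreover have "z \<notin> T' 5"
    proof
      assume "z \<in> T' 5"
      then have "z \<in> T s" using T_mono(3)[OF that(2)] by auto
      then show False using z T_edge by blast
    qed
    ultimately show "z \<in> U" by (simp add: U_def)
  qed
  have e2: "edge 2 \<subseteq> U" and e4: "edge 4 \<subseteq> U" by (rule edgeU; simp)+
  have c2: "continuous_on (edge 2) g" and c4: "continuous_on (edge 4) g"
    using contU e2 e4 by (auto intro: continuous_on_subset)
  show thesis
  proof (rule that[of "cauchy_int g 2" "cauchy_int g 4"])
    show "cauchy_int g 2 holomorphic_on T 2"
      by (rule cauchy_int_holomorphic[OF _ _ c2 open_open_triangle]) (use T_edge in auto)
    show "cauchy_int g 4 holomorphic_on - T' 4"
    proof (rule cauchy_int_holomorphic[OF _ _ c4])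
      show "open (- T' 4)" by (intro open_Compl closed_closed_triangle)
      show "- T' 4 \<inter> edge 4 = {}" unfolding edge_def by blast
    qed auto
    show "norm (cauchy_int g 2 z) \<le> 4 * (1 + k)" if "z \<in> T 3" for z
    proof (rule cauchy_int_bound[OF _ _ c2])
      fix \<zeta> assume \<zeta>: "\<zeta> \<in> edge 2"
      then show "norm (g \<zeta>) \<le> 1 / (Re \<zeta>)\<^sup>2" using le[of \<zeta>] e2 unfolding U_def by blast
      show "1 / 2 \<le> norm (\<zeta> - z)" by (rule edge_distance[OF \<zeta>]) (use that in simp)
    qed auto
    show "norm (cauchy_int g 4 z) \<le> 4 * (1 + k)" if "z \<notin> T 3" for z
    proof (rule cauchy_int_bound[OF _ _ c4])
      fix \<zeta> assume \<zeta>: "\<zeta> \<in> edge 4"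
      then show "norm (g \<zeta>) \<le> 1 / (Re \<zeta>)\<^sup>2" using le[of \<zeta>] e4 unfolding U_def by blast
      show "1 / 2 \<le> norm (\<zeta> - z)" by (rule edge_distance[OF \<zeta>]) (use that in simp)
    qed auto
    fix z assume z: "z \<in> T 2 - T' 4"
    have zU: "z \<in> U" using z T_mono(1)[of 1 2] T_mono(2)[of 4 5] by (auto simp: U_def)
    have ne: "z \<notin> edge 2" "z \<notin> edge 4" using z T_edge[of z 2] unfolding edge_def by blast+
    define G where "G = (\<lambda>\<zeta>. if \<zeta> = z then deriv g z else (g \<zeta> - g z) / (\<zeta> - z))"
    have holG: "G holomorphic_on U" unfolding G_def by (rule pole_lemma_open) (use hol opU in \<open>auto simp: U_def\<close>)
    have contour: "(G has_contour_integral (2 * of_real pi * \<i> * cauchy_int g s z - g z * (2 * of_real pi * \<i> * winding_number (triangle_path k L s) z))) (triangle_path k L s)"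
      if s: "1 < s" "s < 5" and nz: "z \<notin> edge s" and c: "continuous_on (edge s) g" for s
    proof -
      have img: "path_image (triangle_path k L s) \<subseteq> edge s" using path_image_triangle s by simp
      have i1: "((\<lambda>\<zeta>. g \<zeta> / (\<zeta> - z)) has_contour_integral (2 * of_real pi * \<i> * cauchy_int g s z)) (triangle_path k L s)"
        by (rule cauchy_int_path) (use s c nz in auto)
      have i2: "((\<lambda>\<zeta>. 1 / (\<zeta> - z)) has_contour_integral (2 * of_real pi * \<i> * winding_number (triangle_path k L s) z)) (triangle_path k L s)"
        using has_contour_integral_winding_number[of "triangle_path k L s" z] img nz by auto
      have "((\<lambda>\<zeta>. g \<zeta> / (\<zeta> - z) - g z * (1 / (\<zeta> - z))) has_contour_integral
        (2 * of_real pi * \<i> * cauchy_int g s z - g z * (2 * of_real pi * \<i> * winding_number (triangle_path k L s) z))) (triangle_path k L s)"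
        by (intro has_contour_integral_diff has_contour_integral_lmul i1 i2)
      then show ?thesis
        by (rule has_contour_integral_eq) (use img nz in \<open>auto simp: G_def diff_divide_distrib\<close>)
    qed
    (* The segment l joins the apexes and is traversed in both directions; this turns the two boundary
       curves of the ring into a single closed path. *)
    define l where "l = linepath (complex_of_real 2) (of_real 4)"
    define \<gamma> where "\<gamma> = triangle_path k L 2 +++ (l +++ (reversepath (triangle_path k L 4) +++ reversepath l))"
    have limg: "path_image l \<subseteq> U"
    proof
      fix w assume "w \<in> path_image l"
      then obtain u where u: "0 \<le> u" "u \<le> 1" "w = (1 - u) *\<^sub>R complex_of_real 2 + u *\<^sub>R of_real 4" by (auto simp: l_def closed_segment_def)
      have "w = of_real (2 + 2 * u)" unfolding u(3) by (simp add: complex_eq_iff)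
      then have "Re w = 2 + 2 * u" "Im w = 0" by simp_all
      moreover have "0 < k * (1 + 2 * u)" "k * (2 * u - 3) < 0" using u(1,2) k by (auto intro: mult_pos_neg)
      ultimately show "w \<in> U" using u(1,2) L by (auto simp: U_def open_triangle_def closed_triangle_def)
    qed
    have img: "path_image (triangle_path k L 2) \<subseteq> U" "path_image (triangle_path k L 4) \<subseteq> U"
      using path_image_triangle[of 2] path_image_triangle[of 4] e2 e4 by auto
    have valid: "valid_path \<gamma>" "pathfinish \<gamma> = pathstart \<gamma>" by (auto simp: \<gamma>_def l_def valid_path_imp_reverse intro!: valid_path_join)
    have imgs: "path_image \<gamma> \<subseteq> U"
    proof -
      have "path_image (reversepath (triangle_path k L 4) +++ reversepath l) \<subseteq> U"
        by (rule subset_trans[OF path_image_join_subset]) (use img limg in auto)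
      then have "path_image (l +++ (reversepath (triangle_path k L 4) +++ reversepath l)) \<subseteq> U"
        by (intro subset_trans[OF path_image_join_subset]) (use limg in auto)
      then show ?thesis unfolding \<gamma>_def
        by (intro subset_trans[OF path_image_join_subset]) (use img in auto)
    qed
    have wind: "winding_number \<gamma> w = winding_number (triangle_path k L 2) w - winding_number (triangle_path k L 4) w" if "w \<notin> U" for w
    proof -
      have nw: "w \<notin> path_image (triangle_path k L 2)" "w \<notin> path_image (triangle_path k L 4)" "w \<notin> path_image l" using img limg that by auto
      have p: "path (triangle_path k L 2)" "path (triangle_path k L 4)" "path l" by (auto simp: valid_path_imp_path l_def)
      have pl: "pathstart l = 2" "pathfinish l = 4" by (simp_all add: l_def)
      have w1: "winding_number (reversepath (triangle_path k L 4) +++ reversepath l) w = winding_number (reversepath (triangle_path k L 4)) w + winding_number (reversepath l) w"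
        by (rule winding_number_join) (simp_all add: p nw pl)
      have n1: "w \<notin> path_image (reversepath (triangle_path k L 4) +++ reversepath l)"
        by (simp add: path_image_join nw pl)
      have w2: "winding_number (l +++ (reversepath (triangle_path k L 4) +++ reversepath l)) w = winding_number l w + winding_number (reversepath (triangle_path k L 4) +++ reversepath l) w"
        by (rule winding_number_join) (simp_all add: p nw n1 pl)
      have n2: "w \<notin> path_image (l +++ (reversepath (triangle_path k L 4) +++ reversepath l))"
        using n1 by (simp add: path_image_join nw pl)
      have w3: "winding_number \<gamma> w = winding_number (triangle_path k L 2) w + winding_number (l +++ (reversepath (triangle_path k L 4) +++ reversepath l)) w"
        unfolding \<gamma>_def by (rule winding_number_join) (simp_all add: p nw n2 pl)
      show ?thesis unfolding w3 w2 w1 winding_number_reversepath[OF p(2) nw(2)] winding_number_reversepath[OF p(3) nw(3)] by simp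
    qed
    have "(G has_contour_integral 0) \<gamma>"
    proof (rule Cauchy_theorem_global[OF opU holG valid imgs])
      fix w assume w: "w \<notin> U"
      show "winding_number \<gamma> w = 0"
      proof (cases "w \<in> T' 5")
        case True
        then have "w \<in> T 2" "w \<in> T 4" using T_mono(3)[of 2 5] T_mono(3)[of 4 5] by auto
        then show ?thesis using wind[OF w] winding_inside[of 2 w] winding_inside[of 4 w] by simp
      next
        case False
        then have "w \<notin> T' 2" "w \<notin> T' 4" using w T_mono(3)[of 1 2] T_mono(3)[of 1 4] by (auto simp: U_def)
        then show ?thesis using wind[OF w] winding_outside[of 2 w] winding_outside[of 4 w] by simp
      qed
    qed
    moreover have "(G has_contour_integral (contour_integral (triangle_path k L 2) G + (contour_integral l G + (- contour_integral (triangle_path k L 4) G + - contour_integral l G)))) \<gamma>"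
    proof -
      have i2: "(G has_contour_integral contour_integral (triangle_path k L 2) G) (triangle_path k L 2)"
        by (rule has_contour_integral_integral[OF has_contour_integral_integrable[OF contour]]) (use ne c2 in auto)
      have i4: "(G has_contour_integral contour_integral (triangle_path k L 4) G) (triangle_path k L 4)"
        by (rule has_contour_integral_integral[OF has_contour_integral_integrable[OF contour]]) (use ne c4 in auto)
      have il: "(G has_contour_integral contour_integral l G) l"
        unfolding l_def by (intro has_contour_integral_integral contour_integrable_continuous_linepath
           continuous_on_subset[OF holomorphic_on_imp_continuous_on[OF holG]]) (use limg in \<open>auto simp: l_def\<close>)
      show ?thesis unfolding \<gamma>_def
        by (intro has_contour_integral_join has_contour_integral_reversepath i2 i4 il)
          (auto simp: l_def valid_path_imp_reverse intro!: valid_path_join)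
    qed
    ultimately have "contour_integral (triangle_path k L 2) G + (contour_integral l G + (- contour_integral (triangle_path k L 4) G + - contour_integral l G)) = 0"
      using has_contour_integral_unique by blast
    then have eq: "contour_integral (triangle_path k L 2) G = contour_integral (triangle_path k L 4) G"
      by (simp add: algebra_simps)
    have "contour_integral (triangle_path k L 2) G = 2 * of_real pi * \<i> * cauchy_int g 2 z - g z * (2 * of_real pi * \<i> * 1)"
      using contour_integral_unique[OF contour[of 2]] ne c2 winding_inside[of 2 z] z by simp
    moreover have "contour_integral (triangle_path k L 4) G = 2 * of_real pi * \<i> * cauchy_int g 4 z - g z * (2 * of_real pi * \<i> * 0)"
      using contour_integral_unique[OF contour[of 4]] ne c4 winding_outside[of 4 z] z by simp
    ultimately have "2 * of_real pi * \<i> * (cauchy_int g 2 z - cauchy_int g 4 z) = 2 * of_real pi * \<i> * g z"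
      using eq by (simp add: algebra_simps)
    then show "cauchy_int g 2 z - cauchy_int g 4 z = g z" by simp
  qed
qed

end

section \<open>Gluing the products of the two half planes\<close>

text \<open>
  The points \<open>p\<close> satisfy \<open>|Im p| \<le> Re p / \<kappa>\<close>, so they lie in a cone of half the slope of the triangle,
  and moreover far from its apex and from its vertical side. Their distance to the complement of the
  triangle is thus proportional to their modulus.
\<close>

lemma triangle_separation:
  assumes \<kappa>: "0 < \<kappa>" "\<kappa> \<le> 1" and p: "\<kappa> * norm p \<le> Re p" "20 \<le> Re p" "norm p \<le> n"
    and z: "z \<notin> closed_triangle (2 / \<kappa>) (3 * n + 30) 5"
  shows "\<kappa> / (\<kappa> + 16) * (norm z + norm p) \<le> norm (z - p)"
proof -
  define k where "k = 2 / \<kappa>"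
  have k: "2 \<le> k" using \<kappa> by (simp add: k_def field_simps)
  have tri: "norm p \<le> norm z + norm (z - p)" "norm z \<le> norm (z - p) + norm p"
    using norm_triangle_ineq4[of z "z - p"] norm_triangle_ineq[of "z - p" p] by auto
  have n: "0 \<le> n" using p(3) norm_ge_zero[of p] by linarith
  interpret triangle k "3 * n + 30"
    by unfold_locales (use k n in auto)
  have "k * (Re z - 5) < \<bar>Im z\<bar> \<or> 3 * n + 25 < Re z"
    using z by (auto simp: closed_triangle_def k_def not_le)
  then show ?thesis
  proof
    assume a: "k * (Re z - 5) < \<bar>Im z\<bar>"
    have "\<bar>Im p\<bar> \<le> norm p" by (rule abs_Im_le_cmod)
    also have "\<dots> \<le> k * Re p / 2" using p \<kappa> by (simp add: k_def field_simps)
    finally have "\<bar>Im p\<bar> \<le> k * Re p / 2" .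
    moreover have "k * 20 \<le> k * Re p" using p k by (intro mult_left_mono) auto
    moreover have "k * (Re z - 5) = k * Re z - k * 5" by (simp add: right_diff_distrib)
    ultimately have "k * Re p / 4 \<le> (k * Re p - \<bar>Im p\<bar>) - (k * Re z - \<bar>Im z\<bar>)" using a by linarith
    also have "\<dots> \<le> (1 + k) * norm (p - z)" using slope_lipschitz[of p z] by linarith
    finally have 1: "k * Re p / 4 \<le> (1 + k) * norm (z - p)" by (simp add: norm_minus_commute)
    have "(1 + k) * norm (z - p) \<le> (2 * k) * norm (z - p)" using k by (intro mult_right_mono) auto
    then have "k * (Re p / 4) \<le> k * (2 * norm (z - p))" using 1 by simp
    then have "Re p / 4 \<le> 2 * norm (z - p)" using k by (subst (asm) mult_le_cancel_left_pos) auto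
    then have "\<kappa> * norm p \<le> 8 * norm (z - p)" using p by linarith
    moreover have "\<kappa> * norm z \<le> \<kappa> * norm (z - p) + \<kappa> * norm p"
      using mult_left_mono[OF tri(2), of \<kappa>] \<kappa> by (simp add: distrib_left)
    ultimately have "\<kappa> * (norm z + norm p) \<le> (\<kappa> + 16) * norm (z - p)" by (simp add: distrib_left distrib_right)
    then show ?thesis using \<kappa> by (simp add: pos_divide_le_eq mult.commute)
  next
    assume a: "3 * n + 25 < Re z"
    then have "3 * norm p \<le> norm z" using p complex_Re_le_cmod[of z] by linarith
    then have "norm z + norm p \<le> norm (z - p) * 2" using tri(2) by linarith
    then have "(norm z + norm p) / 2 \<le> norm (z - p)" by simp
    moreover have "\<kappa> / (\<kappa> + 16) * (norm z + norm p) \<le> 1 / 2 * (norm z + norm p)"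
      using \<kappa> by (intro mult_right_mono) (auto simp: field_simps)
    ultimately show ?thesis by linarith
  qed
qed

lemma two_mult_exp_le_inverse_square:
  fixes t x :: real
  assumes "0 < x" "x \<le> t"
  shows "2 * exp (- (2 * (1 + t))) \<le> 1 / x\<^sup>2" "exp (- (2 * (1 + t))) < 1 / 2"
proof -
  have "1 + t + 1 \<le> exp (1 + t)" using exp_ge_add_one_self[of "1 + t"] by simp
  then have "(2 + t)\<^sup>2 \<le> (exp (1 + t))\<^sup>2" using assms by (intro power_mono) auto
  then have sq: "(2 + t)\<^sup>2 \<le> exp (2 * (1 + t))" by (simp only: exp_double)
  have e: "exp (2 * (1 + t)) = exp 1 * exp (1 + 2 * t)" by (simp flip: exp_add)
  have "(1 + t)\<^sup>2 \<le> exp (2 * t)"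
  proof -
    have "(1 + t)\<^sup>2 \<le> (exp t)\<^sup>2" using assms exp_ge_add_one_self[of t] by (intro power_mono) auto
    then show ?thesis by (simp only: exp_double)
  qed
  moreover have "2 \<le> exp (1::real)" using exp_ge_add_one_self[of 1] by simp
  moreover have "(1::real) \<le> exp 1" by simp
  ultimately have "2 * (1 * (1 + t)\<^sup>2) \<le> exp 1 * (exp 1 * exp (2 * t))" using assms
    by (intro mult_mono) auto
  then have "2 * x\<^sup>2 \<le> exp (2 * (1 + t))"
  proof -
    have "x\<^sup>2 \<le> (1 + t)\<^sup>2" using assms by (intro power_mono) auto
    moreover have "exp 1 * (exp 1 * exp (2 * t)) = exp (2 * (1 + t))" by (simp flip: exp_add)
    ultimately show ?thesis using \<open>2 * (1 * (1 + t)\<^sup>2) \<le> exp 1 * (exp 1 * exp (2 * t))\<close> by linarith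
  qed
  moreover have "2 * exp (- X) \<le> 1 / x\<^sup>2" if "2 * x\<^sup>2 \<le> exp X" for X
    using that assms by (simp add: exp_minus field_simps)
  ultimately show "2 * exp (- (2 * (1 + t))) \<le> 1 / x\<^sup>2" by blast
  have "2 < (2 + t)\<^sup>2"
  proof -
    have "2\<^sup>2 < (2 + t)\<^sup>2" using assms by (intro power_strict_mono) auto
    then show ?thesis by simp
  qed
  then have "2 < exp (2 * (1 + t))" using sq by linarith
  moreover have "exp (- X) < 1 / 2" if "2 < exp X" for X :: real
    using that by (simp add: exp_minus field_simps)
  ultimately show "exp (- (2 * (1 + t))) < 1 / 2" by blast
qed

lemma open_reflect: "open S \<Longrightarrow> open {z. - z \<in> S}" for S :: "complex set"
  using continuous_open_vimage[of S uminus] by (simp add: vimage_def)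

text \<open>
  The family \<open>P'\<close> consists of the negatives of the zeros in the left half plane. That both families are
  balanced against the same \<open>m\<close> makes their products agree in modulus on the imaginary axis, where
  neither of the two dominates.
\<close>

locale balanced_pair =
  R: balanced_family P F m n \<kappa> Q B + L: balanced_family P' F' m n \<kappa> Q B
  for P P' :: "'i \<Rightarrow> complex" and F F' :: "'i set" and m n \<kappa> Q B +
  assumes \<kappa>1: "\<kappa> \<le> 1"
    and bounds: "\<And>i. i \<in> F \<Longrightarrow> 20 \<le> Re (P i)" "\<And>i. i \<in> F \<Longrightarrow> norm (P i) \<le> real n"
    and bounds': "\<And>i. i \<in> F' \<Longrightarrow> 20 \<le> Re (P' i)" "\<And>i. i \<in> F' \<Longrightarrow> norm (P' i) \<le> real n"
begin

text \<open>
  The values of \<open>slope\<close> and \<open>\<eta>\<close> come from \<open>triangle_separation\<close>. In the triangle of apex \<open>1\<close> one has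
  \<open>1 + norm z \<le> (2 + slope) * Re z\<close>, so \<open>D\<close> is large enough for \<open>exp (- 2 * D * Re z)\<close> to outweigh the
  two bounds \<open>exp (E * (1 + norm z))\<close> of the products.
\<close>

definition slope :: real where "slope = 2 / \<kappa>"
definition \<eta> :: real where "\<eta> = \<kappa> / (\<kappa> + 16)"
definition E :: real where "E = \<bar>R.growth_const \<eta>\<bar>"
definition D :: real where "D = (E + 1) * (2 + slope)"

abbreviation "Tr \<equiv> open_triangle slope (3 * real n + 30)"
abbreviation "Tc \<equiv> closed_triangle slope (3 * real n + 30)"

text \<open>
  The functions \<open>ar\<close> and \<open>al\<close> carry the zeros on the right and on the left. The exponential factors
  have modulus \<open>1\<close> on the imaginary axis and let \<open>ar\<close> dominate on the right and \<open>al\<close> on the left.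
\<close>

definition ar :: "complex \<Rightarrow> complex" where
  "ar z = exp (of_real D * z) * half_plane_product P F m n z"
definition al :: "complex \<Rightarrow> complex" where
  "al z = exp (- of_real D * z) * half_plane_product P' F' m n (- z)"

lemma params: "2 \<le> slope" "0 < \<eta>" "\<eta> \<le> 1" "0 \<le> E" "0 \<le> D" "0 < \<kappa>"
proof -
  show k: "0 < \<kappa>" by (rule R.\<kappa>)
  show s: "2 \<le> slope" using k \<kappa>1 by (simp add: slope_def field_simps)
  show "0 < \<eta>" "\<eta> \<le> 1" using k by (auto simp: \<eta>_def)
  show e: "0 \<le> E" by (simp add: E_def)
  show "0 \<le> D" unfolding D_def using e s by simp
qed

sublocale triangle slope "3 * real n + 30"
  by unfold_locales (use params in auto)

lemma Tc_pos: "z \<in> Tc s \<Longrightarrow> s \<le> Re z" "z \<in> Tr s \<Longrightarrow> s < Re z"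
proof -
  assume "z \<in> Tc s"
  then have "0 \<le> slope * (Re z - s)" unfolding closed_triangle_def using abs_ge_zero order_trans by blast
  then show "s \<le> Re z" using params by (simp add: zero_le_mult_iff)
next
  assume "z \<in> Tr s"
  then have "0 < slope * (Re z - s)" unfolding open_triangle_def using abs_ge_zero le_less_trans by blast
  then show "s < Re z" using params by (simp add: zero_less_mult_iff)
qed

lemma not_Tc_neg: "z \<in> Tr s \<Longrightarrow> 0 \<le> s \<Longrightarrow> 0 < t \<Longrightarrow> - z \<notin> Tc t"
  using Tc_pos[of z s] Tc_pos(1)[of "-z" t] by auto

lemma sep:
  assumes "z \<notin> Tc 5"
  shows "i \<in> F \<Longrightarrow> \<eta> * (norm z + norm (P i)) \<le> norm (z - P i)"
    and "i \<in> F' \<Longrightarrow> \<eta> * (norm z + norm (P' i)) \<le> norm (z - P' i)"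
  using triangle_separation[OF R.\<kappa> \<kappa>1 R.cone bounds] triangle_separation[OF R.\<kappa> \<kappa>1 L.cone bounds'] assms
  unfolding \<eta>_def slope_def by blast+

lemma sep_reflected:
  assumes "- z \<notin> Tc 5"
  shows "i \<in> F \<Longrightarrow> \<eta> * (norm z + norm (P i)) \<le> norm (z + cnj (P i))"
    and "i \<in> F' \<Longrightarrow> \<eta> * (norm z + norm (P' i)) \<le> norm (z + cnj (P' i))"
proof -
  have c: "cnj (- z) \<notin> Tc 5" using assms by (simp add: closed_triangle_def)
  have e: "norm (cnj (- z) - w) = norm (z + cnj w)" for w
  proof -
    have "cnj (- z) - w = - cnj (z + cnj w)" by simp
    then show ?thesis by (metis complex_mod_cnj norm_minus_cancel)
  qed
  show "i \<in> F \<Longrightarrow> \<eta> * (norm z + norm (P i)) \<le> norm (z + cnj (P i))"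
    using sep(1)[OF c] unfolding e by simp
  show "i \<in> F' \<Longrightarrow> \<eta> * (norm z + norm (P' i)) \<le> norm (z + cnj (P' i))"
    using sep(2)[OF c] unfolding e by simp
qed

lemma exp_bound: "exp (R.growth_const \<eta> * (1 + norm z)) \<le> exp (E * (1 + norm z))"
  "exp (- (E * (1 + norm z))) \<le> exp (- R.growth_const \<eta> * (1 + norm z))"
proof -
  have "R.growth_const \<eta> * (1 + norm z) \<le> E * (1 + norm z)" unfolding E_def by (intro mult_right_mono) auto
  then show "exp (R.growth_const \<eta> * (1 + norm z)) \<le> exp (E * (1 + norm z))"
    "exp (- (E * (1 + norm z))) \<le> exp (- R.growth_const \<eta> * (1 + norm z))" by auto
qed

lemma ar_le:
  assumes "- z \<notin> Tc 5"
  shows "norm (ar z) \<le> exp (D * Re z + E * (1 + norm z))"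
proof -
  have "norm (half_plane_product P F m n z) \<le> exp (R.growth_const \<eta> * (1 + norm z))"
    by (rule R.half_plane_product_le[OF params(2,3)]) (rule sep_reflected(1)[OF assms])
  also note exp_bound(1)
  finally show ?thesis unfolding ar_def norm_mult exp_add by (intro mult_mono) auto
qed

lemma ar_ge:
  assumes "z \<notin> Tc 5" "0 \<le> Re z"
  shows "exp (D * Re z - E * (1 + norm z)) \<le> norm (ar z)"
proof -
  note exp_bound(2)
  also have "exp (- R.growth_const \<eta> * (1 + norm z)) \<le> norm (half_plane_product P F m n z)"
    by (rule R.half_plane_product_ge[OF params(2,3) _ assms(2)]) (rule sep(1)[OF assms(1)])
  finally show ?thesis unfolding ar_def norm_mult diff_conv_add_uminus exp_add by (intro mult_mono) auto
qed

lemma al_le: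
  assumes "z \<notin> Tc 5"
  shows "norm (al z) \<le> exp (- D * Re z + E * (1 + norm z))"
proof -
  have "norm (half_plane_product P' F' m n (- z)) \<le> exp (R.growth_const \<eta> * (1 + norm (- z)))"
    by (rule L.half_plane_product_le[OF params(2,3)]) (rule sep_reflected(2), use assms in simp_all)
  also have "\<dots> \<le> exp (E * (1 + norm z))" using exp_bound(1)[of z] by simp
  finally show ?thesis unfolding al_def norm_mult exp_add by (intro mult_mono) auto
qed

lemma al_ge:
  assumes "- z \<notin> Tc 5" "Re z \<le> 0"
  shows "exp (- D * Re z - E * (1 + norm z)) \<le> norm (al z)"
proof -
  note exp_bound(2)
  also have "exp (- R.growth_const \<eta> * (1 + norm z)) \<le> norm (half_plane_product P' F' m n (- z))"
  proof -
    have "exp (- R.growth_const \<eta> * (1 + norm (- z))) \<le> norm (half_plane_product P' F' m n (- z))"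
      by (rule L.half_plane_product_ge[OF params(2,3)]) (rule sep(2), use assms in simp_all)
    then show ?thesis by (simp only: norm_minus_cancel)
  qed
  finally show ?thesis unfolding al_def norm_mult diff_conv_add_uminus exp_add by (intro mult_mono) auto
qed

lemma holomorphic_product:
  "half_plane_product P F m n holomorphic_on {z. - z \<notin> Tc 5}"
  "half_plane_product P' F' m n holomorphic_on {z. - z \<notin> Tc 5}"
proof -
  have ne: "1 + z / cnj (P i) \<noteq> 0" if "- z \<notin> Tc 5" "i \<in> F" for z i
  proof
    have pos: "0 < norm (P i)" using R.large[OF that(2)] by linarith
    assume "1 + z / cnj (P i) = 0"
    then have "z + cnj (P i) = 0" using pos by (simp add: field_simps)
    then have "\<eta> * (norm z + norm (P i)) \<le> 0" using sep_reflected(1)[OF that] by simp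
    moreover have "0 < \<eta> * (norm z + norm (P i))" using params pos norm_ge_zero[of z] by (intro mult_pos_pos) linarith+
    ultimately show False by linarith
  qed
  have ne': "1 + z / cnj (P' i) \<noteq> 0" if "- z \<notin> Tc 5" "i \<in> F'" for z i
  proof
    have pos: "0 < norm (P' i)" using L.large[OF that(2)] by linarith
    assume "1 + z / cnj (P' i) = 0"
    then have "z + cnj (P' i) = 0" using pos by (simp add: field_simps)
    then have "\<eta> * (norm z + norm (P' i)) \<le> 0" using sep_reflected(2)[OF that] by simp
    moreover have "0 < \<eta> * (norm z + norm (P' i))" using params pos norm_ge_zero[of z] by (intro mult_pos_pos) linarith+
    ultimately show False by linarith
  qed
  have nz: "P i \<noteq> 0" if "i \<in> F" for i using R.large[OF that] by auto
  have nz': "P' i \<noteq> 0" if "i \<in> F'" for i using L.large[OF that] by auto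
  have "(\<lambda>z. half_plane_product P F m n z) holomorphic_on {z. - z \<notin> Tc 5}"
    unfolding half_plane_product_def by (intro holomorphic_intros) (use ne nz in auto)
  then show "half_plane_product P F m n holomorphic_on {z. - z \<notin> Tc 5}" by simp
  have "(\<lambda>z. half_plane_product P' F' m n z) holomorphic_on {z. - z \<notin> Tc 5}"
    unfolding half_plane_product_def by (intro holomorphic_intros) (use ne' nz' in auto)
  then show "half_plane_product P' F' m n holomorphic_on {z. - z \<notin> Tc 5}" by simp
qed

lemma ar_holomorphic: "ar holomorphic_on {z. - z \<notin> Tc 5}"
proof -
  have "(\<lambda>z. ar z) holomorphic_on {z. - z \<notin> Tc 5}"
    unfolding ar_def by (intro holomorphic_intros holomorphic_product)
  then show ?thesis by simp
qed

lemma al_holomorphic: "al holomorphic_on {z. z \<notin> Tc 5}"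
proof -
  have "(\<lambda>z. half_plane_product P' F' m n (- z)) holomorphic_on {z. z \<notin> Tc 5}"
    using holomorphic_reflect[OF holomorphic_product(2)] by simp
  then have "(\<lambda>z. al z) holomorphic_on {z. z \<notin> Tc 5}"
    unfolding al_def by (intro holomorphic_intros)
  then show ?thesis by simp
qed

lemma strip:
  assumes "z \<in> Tr 1 - Tc 5"
  shows "norm (al z / ar z) \<le> exp (- (2 * (1 + norm z)))" "ar z \<noteq> 0"
    "norm (ar (- z) / al (- z)) \<le> exp (- (2 * (1 + norm z)))" "al (- z) \<noteq> 0"
proof -
  have z: "z \<notin> Tc 5" "- z \<notin> Tc 5" "1 < Re z" using assms not_Tc_neg[of z 1 5] Tc_pos(2)[of z 1] by auto
  have key: "- D * Re z + E * (1 + norm z) - (D * Re z - E * (1 + norm z)) \<le> - (2 * (1 + norm z))"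
  proof -
    have "norm z \<le> Re z + slope * (Re z - 1)"
      using cmod_le[of z] assms z by (auto simp: open_triangle_def)
    also have "\<dots> \<le> Re z + slope * Re z" using params by (simp add: algebra_simps)
    finally have "1 + norm z \<le> (2 + slope) * Re z" using z by (simp add: algebra_simps)
    then have "(E + 1) * (1 + norm z) \<le> (E + 1) * ((2 + slope) * Re z)" using params by (intro mult_left_mono) auto
    then show ?thesis by (simp add: D_def algebra_simps)
  qed
  have lo: "exp (D * Re z - E * (1 + norm z)) \<le> norm (ar z)" using ar_ge z by simp
  have lo': "exp (D * Re z - E * (1 + norm z)) \<le> norm (al (- z))" using al_ge[of "- z"] z by simp
  have pos: "0 < exp (D * Re z - E * (1 + norm z))" by simp
  show "ar z \<noteq> 0" using lo pos by (metis norm_zero not_le)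
  show "al (- z) \<noteq> 0" using lo' pos by (metis norm_zero not_le)
  have "norm (al z / ar z) \<le> exp (- D * Re z + E * (1 + norm z)) / exp (D * Re z - E * (1 + norm z))"
    unfolding norm_divide using al_le[OF z(1)] lo pos by (intro frac_le) auto
  also have "\<dots> \<le> exp (- (2 * (1 + norm z)))" unfolding exp_diff [symmetric] using key by simp
  finally show "norm (al z / ar z) \<le> exp (- (2 * (1 + norm z)))" .
  have "norm (ar (- z) / al (- z)) \<le> exp (- D * Re z + E * (1 + norm z)) / exp (D * Re z - E * (1 + norm z))"
    unfolding norm_divide using ar_le[of "- z"] z(1) lo' pos by (intro frac_le) auto
  also have "\<dots> \<le> exp (- (2 * (1 + norm z)))" unfolding exp_diff [symmetric] using key by simp
  finally show "norm (ar (- z) / al (- z)) \<le> exp (- (2 * (1 + norm z)))" .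
qed

lemma log_quotient:
  fixes q :: "complex \<Rightarrow> complex"
  assumes hol: "q holomorphic_on (Tr 1 - Tc 5)"
    and le: "\<And>z. z \<in> Tr 1 - Tc 5 \<Longrightarrow> norm (q z) \<le> exp (- (2 * (1 + norm z)))"
  shows "(\<lambda>z. Ln (1 + q z)) holomorphic_on (Tr 1 - Tc 5)"
    and "\<And>z. z \<in> Tr 1 - Tc 5 \<Longrightarrow> norm (Ln (1 + q z)) \<le> 1 / (Re z)\<^sup>2"
    and "\<And>z. z \<in> Tr 1 - Tc 5 \<Longrightarrow> exp (Ln (1 + q z)) = 1 + q z"
proof -
  have pos: "0 < Re z" "Re z \<le> norm z" if "z \<in> Tr 1 - Tc 5" for z
    using Tc_pos(2)[of z 1] that complex_Re_le_cmod[of z] by auto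
  have small: "norm (q z) < 1 / 2" if "z \<in> Tr 1 - Tc 5" for z
    using two_mult_exp_le_inverse_square(2)[OF pos[OF that]] le[OF that] by linarith
  have re: "0 < Re (1 + q z)" if "z \<in> Tr 1 - Tc 5" for z
    using small[OF that] abs_Re_le_cmod[of "q z"] by simp
  show "(\<lambda>z. Ln (1 + q z)) holomorphic_on (Tr 1 - Tc 5)"
    by (intro holomorphic_intros hol) (use re in \<open>force simp: complex_nonpos_Reals_iff\<close>)
  show "norm (Ln (1 + q z)) \<le> 1 / (Re z)\<^sup>2" if z: "z \<in> Tr 1 - Tc 5" for z
    using norm_Ln_le[OF small[OF z]] le[OF z] two_mult_exp_le_inverse_square(1)[OF pos[OF z]] by linarith
  show "exp (Ln (1 + q z)) = 1 + q z" if z: "z \<in> Tr 1 - Tc 5" for z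
    using re[OF z] by (intro exp_Ln) (metis less_irrefl zero_complex.sel(1))
qed

definition glue_const :: real where "glue_const = 4 * (1 + slope)"

lemma zeros_in_triangle:
  assumes "\<kappa> * norm p \<le> Re p" "20 \<le> Re p" "norm p \<le> real n"
  shows "p \<in> Tr 5"
proof -
  have "\<bar>Im p\<bar> \<le> norm p" by (rule abs_Im_le_cmod)
  also have "\<dots> \<le> slope * Re p / 2" using assms params by (simp add: slope_def field_simps)
  also have "\<dots> < slope * (Re p - 5)"
  proof -
    have "slope * 10 < slope * Re p" using assms params by (intro mult_strict_left_mono) auto
    then show ?thesis unfolding right_diff_distrib by linarith
  qed
  finally have "\<bar>Im p\<bar> < slope * (Re p - 5)" .
  moreover have "Re p < 3 * real n + 30 - 5" using assms complex_Re_le_cmod[of p] by linarith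
  ultimately show ?thesis by (simp add: open_triangle_def)
qed

lemma product_vanishes:
  fixes G :: "complex \<Rightarrow> complex"
  assumes fin: "finite I" and U: "open U" "w \<in> U" and G: "G holomorphic_on U"
    and p: "\<And>i. i \<in> I \<Longrightarrow> p i \<noteq> 0" and f: "\<And>z. z \<in> U \<Longrightarrow> f z = (\<Prod>i\<in>I. 1 - z / p i) * G z"
  shows "\<exists>K \<rho>. 0 < \<rho> \<and> (\<forall>z\<in>ball w \<rho>. norm (f z) \<le> K * norm (z - w) ^ card {i\<in>I. p i = w})"
proof -
  define J where "J = {i\<in>I. p i = w}"
  define H where "H = (\<lambda>z. (\<Prod>i\<in>J. - 1 / p i) * (\<Prod>i\<in>I - J. 1 - z / p i) * G z)"
  have fH: "f z = (z - w) ^ card J * H z" if "z \<in> U" for z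
  proof -
    have "(\<Prod>i\<in>I. 1 - z / p i) = (\<Prod>i\<in>J. 1 - z / p i) * (\<Prod>i\<in>I - J. 1 - z / p i)"
      using fin by (subst prod.subset_diff[of J]) (auto simp: J_def)
    moreover have "(\<Prod>i\<in>J. 1 - z / p i) = (\<Prod>i\<in>J. (z - w) * (- 1 / p i))"
      by (rule prod.cong) (use p in \<open>auto simp: J_def field_simps\<close>)
    ultimately show ?thesis using f[OF that] by (simp only: prod.distrib prod_constant H_def mult_ac)
  qed
  obtain \<rho> where \<rho>: "0 < \<rho>" "cball w \<rho> \<subseteq> U" using U open_contains_cball by blast
  have "continuous_on (cball w \<rho>) H"
    unfolding H_def by (intro continuous_intros continuous_on_subset[OF holomorphic_on_imp_continuous_on[OF G]]) (use \<rho> p in auto)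
  then have "bounded (H ` cball w \<rho>)" by (intro compact_imp_bounded compact_continuous_image) auto
  then obtain K where K: "\<And>z. z \<in> cball w \<rho> \<Longrightarrow> norm (H z) \<le> K" by (force simp: bounded_iff)
  have "norm (f z) \<le> K * norm (z - w) ^ card J" if "z \<in> ball w \<rho>" for z
  proof -
    have "z \<in> cball w \<rho>" using that ball_subset_cball by blast
    then have "norm (f z) = norm (H z) * norm (z - w) ^ card J" using fH[of z] \<rho> by (auto simp: norm_mult norm_power)
    also have "\<dots> \<le> K * norm (z - w) ^ card J" using K[OF \<open>z \<in> cball w \<rho>\<close>] by (intro mult_right_mono) auto
    finally show ?thesis .
  qed
  then show ?thesis using \<rho>(1) unfolding J_def by blast
qed

text \<open>
  Inside the right triangle \<open>ar\<close> is the right function, inside the left one \<open>al\<close> is, and elsewhere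
  \<open>ar + al\<close> is. The transition factors \<open>1 + al / ar\<close> and \<open>1 + ar / al\<close> are split by
  \<open>cousin_splitting\<close>. The exponentials of the parts have no zeros and are bounded from above and from
  below, so they change neither the zeros nor the growth. At the origin \<open>ar\<close> and \<open>al\<close> are \<open>1\<close>, and the
  lower bound there prevents a limit of such functions from being \<open>0\<close>.
\<close>

lemma glued_function:
  "\<exists>f. f holomorphic_on UNIV \<and>
     (\<forall>z. norm (f z) \<le> 2 * exp (2 * glue_const) * exp (D * norm z + E * (1 + norm z))) \<and>
     (\<forall>y. norm (f (\<i> * of_real y)) \<le> 2 * exp (2 * glue_const) * (\<Prod>j=1..n. (1 + y\<^sup>2 / (real j)\<^sup>2) ^ m j)) \<and>
     2 * exp (- (2 * glue_const)) \<le> norm (f 0) \<and>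
     (\<forall>w. 0 < Re w \<longrightarrow> (\<exists>K \<rho>. 0 < \<rho> \<and> (\<forall>z\<in>ball w \<rho>. norm (f z) \<le> K * norm (z - w) ^ card {i\<in>F. P i = w}))) \<and>
     (\<forall>w. Re w < 0 \<longrightarrow> (\<exists>K \<rho>. 0 < \<rho> \<and> (\<forall>z\<in>ball w \<rho>. norm (f z) \<le> K * norm (z - w) ^ card {i\<in>F'. P' i = - w})))"
proof -
  have hr: "(\<lambda>z. al z / ar z) holomorphic_on (Tr 1 - Tc 5)"
    by (intro holomorphic_intros holomorphic_on_subset[OF al_holomorphic] holomorphic_on_subset[OF ar_holomorphic])
      (use not_Tc_neg[of _ 1 5] strip(2) in auto)
  have refl: "(\<lambda>z. ar (- z)) holomorphic_on (Tr 1 - Tc 5)" "(\<lambda>z. al (- z)) holomorphic_on (Tr 1 - Tc 5)"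
  proof -
    show "(\<lambda>z. ar (- z)) holomorphic_on (Tr 1 - Tc 5)"
      by (rule holomorphic_on_subset[OF holomorphic_reflect[OF ar_holomorphic]]) auto
    show "(\<lambda>z. al (- z)) holomorphic_on (Tr 1 - Tc 5)"
      by (rule holomorphic_on_subset[OF holomorphic_reflect[OF al_holomorphic]]) (use not_Tc_neg[of _ 1 5] in auto)
  qed
  have hl: "(\<lambda>z. ar (- z) / al (- z)) holomorphic_on (Tr 1 - Tc 5)"
    by (intro holomorphic_intros refl) (use strip(4) in auto)
  note lr = log_quotient[OF hr strip(1)] and ll = log_quotient[OF hl strip(3)]
  obtain \<Phi>i \<Phi>o where \<Phi>: "\<Phi>i holomorphic_on Tr 2" "\<Phi>o holomorphic_on (- Tc 4)"
    "\<And>z. z \<in> Tr 2 - Tc 4 \<Longrightarrow> \<Phi>i z - \<Phi>o z = Ln (1 + al z / ar z)"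
    "\<And>z. z \<in> Tr 3 \<Longrightarrow> norm (\<Phi>i z) \<le> 4 * (1 + slope)"
    "\<And>z. z \<notin> Tr 3 \<Longrightarrow> norm (\<Phi>o z) \<le> 4 * (1 + slope)"
    using cousin_splitting[OF lr(1,2)] by blast
  obtain \<Psi>i \<Psi>o where \<Psi>: "\<Psi>i holomorphic_on Tr 2" "\<Psi>o holomorphic_on (- Tc 4)"
    "\<And>z. z \<in> Tr 2 - Tc 4 \<Longrightarrow> \<Psi>i z - \<Psi>o z = Ln (1 + ar (- z) / al (- z))"
    "\<And>z. z \<in> Tr 3 \<Longrightarrow> norm (\<Psi>i z) \<le> 4 * (1 + slope)"
    "\<And>z. z \<notin> Tr 3 \<Longrightarrow> norm (\<Psi>o z) \<le> 4 * (1 + slope)"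
    using cousin_splitting[OF ll(1,2)] by blast
  (* On the overlaps these agree because exp (\<Phi>i - \<Phi>o) = 1 + al / ar, and correspondingly for \<Psi> at - z.
     The poles of ar lie in the left triangle and those of al in the right one, where f2 and f1 are used. *)
  define f1 where "f1 = (\<lambda>z. ar z * exp (\<Phi>i z + \<Psi>o (- z)))"
  define f2 where "f2 = (\<lambda>z. al z * exp (\<Phi>o z + \<Psi>i (- z)))"
  define f3 where "f3 = (\<lambda>z. (ar z + al z) * exp (\<Phi>o z + \<Psi>o (- z)))"
  define f where "f = (\<lambda>z. if z \<in> Tr 2 then f1 z else if - z \<in> Tr 2 then f2 z else f3 z)"
  define W where "W = {z. z \<notin> Tc 4 \<and> - z \<notin> Tc 4}"
  have sub: "Tr 2 - Tc 4 \<subseteq> Tr 1 - Tc 5" using T_mono(1)[of 1 2] T_mono(2)[of 4 5] by auto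
  have f13: "f1 z = f3 z" if "z \<in> Tr 2 - Tc 4" for z
  proof -
    have z: "z \<in> Tr 1 - Tc 5" using that sub by blast
    have "exp (\<Phi>i z + \<Psi>o (- z)) = exp (Ln (1 + al z / ar z)) * exp (\<Phi>o z + \<Psi>o (- z))"
      unfolding \<Phi>(3)[OF that, symmetric] exp_add [symmetric] by simp
    also have "exp (Ln (1 + al z / ar z)) = 1 + al z / ar z" using lr(3)[of z] z by blast
    finally show ?thesis unfolding f1_def f3_def using strip(2)[OF z] by (simp add: field_simps)
  qed
  have f23: "f2 z = f3 z" if "- z \<in> Tr 2 - Tc 4" for z
  proof -
    have z: "- z \<in> Tr 1 - Tc 5" using that sub by blast
    have "exp (\<Phi>o z + \<Psi>i (- z)) = exp (Ln (1 + ar z / al z)) * exp (\<Phi>o z + \<Psi>o (- z))"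
      using \<Psi>(3)[OF that, symmetric] unfolding exp_add [symmetric] by (simp add: add.commute)
    also have "exp (Ln (1 + ar z / al z)) = 1 + ar z / al z" using ll(3)[of "- z"] z by simp
    finally show ?thesis unfolding f2_def f3_def using strip(4)[OF z] by (simp add: field_simps)
  qed
  have disj: "- z \<notin> Tr 2" if "z \<in> Tr 2" for z using Tc_pos(2)[OF that] Tc_pos(2)[of "- z" 2] by auto
  have eq1: "f z = f1 z" if "z \<in> Tr 2" for z using that by (simp add: f_def)
  have eq2: "f z = f2 z" if "- z \<in> Tr 2" for z using that disj[of z] by (auto simp: f_def)
  have eq3: "f z = f3 z" if "z \<in> W" for z
    using that f13[of z] f23[of z] unfolding f_def W_def by auto
  have op: "open (Tr 2)" by (rule open_open_triangle)
  have op': "open {z. - z \<in> Tr 2}"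
    by (rule open_reflect[OF op])
  have opW: "open W"
  proof -
    have "W = - Tc 4 \<inter> {z. - z \<in> - Tc 4}" by (auto simp: W_def)
    moreover have "open (- Tc 4)" by (intro open_Compl closed_closed_triangle)
    ultimately show ?thesis using open_reflect[of "- Tc 4"] by (simp only: open_Int)
  qed
  have neg_Psi_o: "(\<lambda>z. \<Psi>o (- z)) holomorphic_on {z. - z \<notin> Tc 4}"
    by (rule holomorphic_on_subset[OF holomorphic_reflect[OF \<Psi>(2)]]) auto
  have neg_Psi_i: "(\<lambda>z. \<Psi>i (- z)) holomorphic_on {z. - z \<in> Tr 2}"
    by (rule holomorphic_on_subset[OF holomorphic_reflect[OF \<Psi>(1)]]) auto
  have G1: "(\<lambda>z. exp (\<Phi>i z + \<Psi>o (- z))) holomorphic_on Tr 2"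
    by (intro holomorphic_intros \<Phi>(1) holomorphic_on_subset[OF neg_Psi_o]) (use not_Tc_neg[of _ 2 4] in auto)
  have G2: "(\<lambda>z. exp (\<Phi>o z + \<Psi>i (- z))) holomorphic_on {z. - z \<in> Tr 2}"
    by (intro holomorphic_intros holomorphic_on_subset[OF \<Phi>(2)] neg_Psi_i) (use not_Tc_neg[of _ 2 4] in force)
  have h1: "f1 holomorphic_on Tr 2"
  proof -
    have "(\<lambda>z. f1 z) holomorphic_on Tr 2" unfolding f1_def
      by (intro holomorphic_on_mult G1 holomorphic_on_subset[OF ar_holomorphic]) (use not_Tc_neg[of _ 2 5] in auto)
    then show ?thesis by simp
  qed
  have h2: "f2 holomorphic_on {z. - z \<in> Tr 2}"
  proof -
    have "(\<lambda>z. f2 z) holomorphic_on {z. - z \<in> Tr 2}" unfolding f2_def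
      by (intro holomorphic_on_mult G2 holomorphic_on_subset[OF al_holomorphic]) (use not_Tc_neg[of _ 2 5] in force)
    then show ?thesis by simp
  qed
  have W5: "W \<subseteq> {z. - z \<notin> Tc 5}" "W \<subseteq> {z. z \<notin> Tc 5}" "W \<subseteq> - Tc 4" "W \<subseteq> {z. - z \<notin> Tc 4}"
    using T_mono(2)[of 4 5] by (auto simp: W_def)
  have h3: "f3 holomorphic_on W"
  proof -
    have "(\<lambda>z. f3 z) holomorphic_on W" unfolding f3_def
      by (intro holomorphic_intros holomorphic_on_subset[OF ar_holomorphic W5(1)] holomorphic_on_subset[OF al_holomorphic W5(2)]
          holomorphic_on_subset[OF \<Phi>(2) W5(3)] holomorphic_on_subset[OF neg_Psi_o W5(4)])
    then show ?thesis by simp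
  qed
  have cover: "z \<in> Tr 2 \<or> - z \<in> Tr 2 \<or> z \<in> W" for z using T_mono(3)[of 2 4] by (auto simp: W_def)
  have hol: "f holomorphic_on UNIV"
  proof -
    have "f holomorphic_on (Tr 2 \<union> {z. - z \<in> Tr 2} \<union> W)"
      by (intro holomorphic_on_Un open_Un op op' opW)
        (use h1 h2 h3 eq1 eq2 eq3 in \<open>auto intro: holomorphic_transform\<close>)
    moreover have "Tr 2 \<union> {z. - z \<in> Tr 2} \<union> W = UNIV" using cover by auto
    ultimately show ?thesis by simp
  qed
  have e2: "norm (exp (u + v)) \<le> exp (2 * glue_const)" if "norm u \<le> 4 * (1 + slope)" "norm v \<le> 4 * (1 + slope)" for u v :: complex
  proof -
    have "Re (u + v) \<le> 2 * glue_const" using that complex_Re_le_cmod[of u] complex_Re_le_cmod[of v] by (simp add: glue_const_def)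
    then show ?thesis by simp
  qed
  have f3_form: "f z = f3 z \<and> norm (\<Phi>o z) \<le> 4 * (1 + slope) \<and> norm (\<Psi>o (- z)) \<le> 4 * (1 + slope) \<and> z \<notin> Tc 5 \<and> - z \<notin> Tc 5"
    if "z \<notin> Tr 3" "- z \<notin> Tr 3" for z
  proof -
    have "z \<notin> Tc 4" "- z \<notin> Tc 4" using that T_mono(3)[of 3 4] by auto
    then have "z \<in> W" by (simp add: W_def)
    then show ?thesis using eq3 \<Phi>(5)[OF that(1)] \<Psi>(5)[OF that(2)] W5 by auto
  qed
  have ReD: "D * Re z \<le> D * norm z" "- D * Re z \<le> D * norm z" for z
    using params abs_Re_le_cmod[of z] mult_left_mono[of "- Re z" "norm z" D] by (auto intro!: mult_left_mono complex_Re_le_cmod)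
  have bound: "norm (f z) \<le> 2 * exp (2 * glue_const) * exp (D * norm z + E * (1 + norm z))" for z
  proof -
    let ?X = "exp (D * norm z + E * (1 + norm z))"
    have arX: "norm (ar z) \<le> ?X" if "- z \<notin> Tc 5"
      using ar_le[OF that] ReD(1)[of z] by (meson add_right_mono exp_le_cancel_iff order_trans)
    have alX: "norm (al z) \<le> ?X" if "z \<notin> Tc 5"
      using al_le[OF that] ReD(2)[of z] by (meson add_right_mono exp_le_cancel_iff order_trans)
    have pos: "0 \<le> ?X * exp (2 * glue_const)" by simp
    have dbl: "v \<le> 2 * e * X" if "v \<le> X * e" "0 \<le> X * e" for v e X :: real
    proof -
      have "2 * e * X = X * e + X * e" by (simp add: mult.commute)
      then show ?thesis using that by linarith
    qed
    consider "z \<in> Tr 3" | "- z \<in> Tr 3" | "z \<notin> Tr 3" "- z \<notin> Tr 3" by blast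
    then show ?thesis
    proof cases
      case 1
      then have z2: "z \<in> Tr 2" "- z \<notin> Tc 5" "- z \<notin> Tr 3"
        using T_mono(1)[of 2 3] not_Tc_neg[of z 3 5] Tc_pos(2)[of z 3] Tc_pos(2)[of "-z" 3] by auto
      have "norm (f z) = norm (ar z) * norm (exp (\<Phi>i z + \<Psi>o (- z)))" unfolding eq1[OF z2(1)] f1_def norm_mult ..
      also have "\<dots> \<le> ?X * exp (2 * glue_const)"
        by (intro mult_mono arX[OF z2(2)] e2 \<Phi>(4)[OF 1] \<Psi>(5)[OF z2(3)]) auto
      finally show ?thesis using pos by (rule dbl)
    next
      case 2
      then have z2: "- z \<in> Tr 2" "z \<notin> Tc 5" "z \<notin> Tr 3"
        using T_mono(1)[of 2 3] not_Tc_neg[of "-z" 3 5] Tc_pos(2)[of z 3] Tc_pos(2)[of "-z" 3] by auto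
      have "norm (f z) = norm (al z) * norm (exp (\<Phi>o z + \<Psi>i (- z)))" unfolding eq2[OF z2(1)] f2_def norm_mult ..
      also have "\<dots> \<le> ?X * exp (2 * glue_const)"
        by (intro mult_mono alX[OF z2(2)] e2 \<Psi>(4)[OF 2] \<Phi>(5)[OF z2(3)]) auto
      finally show ?thesis using pos by (rule dbl)
    next
      case 3
      note F3 = f3_form[OF 3]
      have "norm (f z) = norm (ar z + al z) * norm (exp (\<Phi>o z + \<Psi>o (- z)))" using F3 by (simp add: f3_def norm_mult)
      also have "\<dots> \<le> (?X + ?X) * exp (2 * glue_const)"
        using F3 by (intro mult_mono e2 norm_triangle_mono arX alX) auto
      finally show ?thesis by (simp add: mult_ac)
    qed
  qed
  have axis: "\<i> * of_real y \<notin> Tr 3" "- (\<i> * of_real y) \<notin> Tr 3" for y :: real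
    using Tc_pos(2)[of "\<i> * of_real y" 3] Tc_pos(2)[of "- (\<i> * of_real y)" 3] by auto
  have im: "norm (f (\<i> * of_real y)) \<le> 2 * exp (2 * glue_const) * (\<Prod>j=1..n. (1 + y\<^sup>2 / (real j)\<^sup>2) ^ m j)" for y
  proof -
    let ?z = "\<i> * complex_of_real y" let ?X = "\<Prod>j=1..n. (1 + y\<^sup>2 / (real j)\<^sup>2) ^ m j"
    note F3 = f3_form[OF axis[of y]]
    have "norm (ar ?z) = ?X" using R.half_plane_product_imaginary[of y] by (simp add: ar_def norm_mult)
    moreover have "norm (al ?z) = ?X"
      using L.half_plane_product_imaginary[of "- y"] by (simp add: al_def norm_mult)
    ultimately have "norm (ar ?z + al ?z) \<le> ?X + ?X" by (intro norm_triangle_mono) auto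
    moreover have "norm (f ?z) = norm (ar ?z + al ?z) * norm (exp (\<Phi>o ?z + \<Psi>o (- ?z)))"
      using F3 by (simp add: f3_def norm_mult)
    moreover have "norm (exp (\<Phi>o ?z + \<Psi>o (- ?z))) \<le> exp (2 * glue_const)" using F3 by (intro e2) auto
    moreover have X0: "0 \<le> ?X" by (intro prod_nonneg ballI zero_le_power add_nonneg_nonneg) auto
    ultimately have "norm (f ?z) \<le> (?X + ?X) * exp (2 * glue_const)"
      by (simp only:) (intro mult_mono add_nonneg_nonneg norm_ge_zero)
    then show ?thesis by (simp add: mult_ac)
  qed
  have zero: "2 * exp (- (2 * glue_const)) \<le> norm (f 0)"
  proof -
    have 0: "0 \<notin> Tr 3" "- 0 \<notin> Tr 3" using Tc_pos(2)[of 0 3] by auto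
    note F3 = f3_form[OF 0]
    have "ar 0 = 1" "al 0 = 1" by (simp_all add: ar_def al_def half_plane_product_def)
    then have "norm (f 0) = 2 * exp (Re (\<Phi>o 0 + \<Psi>o 0))" using F3 by (simp add: f3_def norm_mult)
    moreover have "- (2 * glue_const) \<le> Re (\<Phi>o 0 + \<Psi>o 0)"
    proof -
      have "norm (\<Phi>o 0) \<le> glue_const" "norm (\<Psi>o 0) \<le> glue_const" using F3 by (simp_all add: glue_const_def)
      then show ?thesis using abs_Re_le_cmod[of "\<Phi>o 0"] abs_Re_le_cmod[of "\<Psi>o 0"]
        unfolding plus_complex.sel by linarith
    qed
    ultimately show ?thesis by simp
  qed
  have vr: "\<exists>K \<rho>. 0 < \<rho> \<and> (\<forall>z\<in>ball w \<rho>. norm (f z) \<le> K * norm (z - w) ^ card {i\<in>F. P i = w})" for w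
  proof (cases "w \<in> Tr 2")
    case True
    define G where "G = (\<lambda>z. exp (of_real D * z) * (\<Prod>i\<in>F. 1 / (1 + z / cnj (P i))) * (\<Prod>j=1..n. (1 + z / of_nat j) ^ (2 * m j)) * exp (\<Phi>i z + \<Psi>o (- z)))"
    show ?thesis
    proof (rule product_vanishes[OF R.fin op True])
      show "P i \<noteq> 0" if "i \<in> F" for i using R.large[OF that] by auto
      show "f z = (\<Prod>i\<in>F. 1 - z / P i) * G z" if "z \<in> Tr 2" for z
        unfolding eq1[OF that] f1_def ar_def half_plane_product_def G_def by (simp add: prod_dividef field_simps)
      have ne: "1 + z / cnj (P i) \<noteq> 0" if "z \<in> Tr 2" "i \<in> F" for z i
      proof
        have "0 < norm (P i)" using R.large[OF that(2)] by linarith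
        then have c: "cnj (P i) \<noteq> 0" by simp
        assume "1 + z / cnj (P i) = 0"
        then have "z + cnj (P i) = 0" using c by (simp add: field_simps)
        then have "Re z = - Re (P i)" by (metis add_eq_0_iff2 cnj.sel(1) plus_complex.sel(1) zero_complex.sel(1))
        then show False using bounds(1)[OF that(2)] Tc_pos(2)[OF that(1)] by linarith
      qed
      show "G holomorphic_on Tr 2" unfolding G_def
        by (intro holomorphic_on_mult G1 holomorphic_intros) (use ne R.large in auto)
    qed
  next
    case False
    have "{i\<in>F. P i = w} = {}"
    proof -
      have "P i \<in> Tr 2" if "i \<in> F" for i
        using zeros_in_triangle[OF R.cone[OF that] bounds[OF that]] T_mono(1)[of 2 5] by auto
      then have "P i \<noteq> w" if "i \<in> F" for i using False that by metis
      then show ?thesis by blast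
    qed
    have "\<exists>K. \<forall>z\<in>cball w 1. norm (f z) \<le> K"
    proof -
      have "bounded (f ` cball w 1)"
        by (intro compact_imp_bounded compact_continuous_image holomorphic_on_imp_continuous_on holomorphic_on_subset[OF hol]) auto
      then show ?thesis by (auto simp: bounded_iff)
    qed
    then show ?thesis unfolding \<open>{i\<in>F. P i = w} = {}\<close> by (force intro: exI[of _ 1])
  qed
  have vl: "\<exists>K \<rho>. 0 < \<rho> \<and> (\<forall>z\<in>ball w \<rho>. norm (f z) \<le> K * norm (z - w) ^ card {i\<in>F'. P' i = - w})" for w
  proof (cases "- w \<in> Tr 2")
    case True
    define G where "G = (\<lambda>z. exp (- of_real D * z) * (\<Prod>i\<in>F'. 1 / (1 + - z / cnj (P' i))) * (\<Prod>j=1..n. (1 + - z / of_nat j) ^ (2 * m j)) * exp (\<Phi>o z + \<Psi>i (- z)))"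
    have w: "w \<in> {z. - z \<in> Tr 2}" using True by simp
    have eqs: "{i\<in>F'. P' i = - w} = {i\<in>F'. - P' i = w}" by force
    show ?thesis unfolding eqs
    proof (rule product_vanishes[OF L.fin op' w])
      show "- P' i \<noteq> 0" if "i \<in> F'" for i using L.large[OF that] by auto
      show "f z = (\<Prod>i\<in>F'. 1 - z / - P' i) * G z" if "z \<in> {z. - z \<in> Tr 2}" for z
      proof -
        have "f z = f2 z" using eq2 that by blast
        then show ?thesis
          unfolding f2_def al_def half_plane_product_def G_def by (simp add: prod_dividef field_simps)
      qed
      have ne: "1 + - z / cnj (P' i) \<noteq> 0" if "- z \<in> Tr 2" "i \<in> F'" for z i
      proof
        have "0 < norm (P' i)" using L.large[OF that(2)] by linarith
        then have c: "cnj (P' i) \<noteq> 0" by simp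
        assume "1 + - z / cnj (P' i) = 0"
        then have "z = cnj (P' i)" using c by (simp add: field_simps)
        then have "Re z = Re (P' i)" by simp
        then show False using bounds'(1)[OF that(2)] Tc_pos(2)[OF that(1)] by simp
      qed
      show "G holomorphic_on {z. - z \<in> Tr 2}" unfolding G_def
        by (intro holomorphic_on_mult G2 holomorphic_intros) (use ne L.large in auto)
    qed
  next
    case False
    have "{i\<in>F'. P' i = - w} = {}"
    proof -
      have "P' i \<in> Tr 2" if "i \<in> F'" for i
        using zeros_in_triangle[OF L.cone[OF that] bounds'[OF that]] T_mono(1)[of 2 5] by auto
      then have "P' i \<noteq> - w" if "i \<in> F'" for i using False that by metis
      then show ?thesis by blast
    qed
    have "\<exists>K. \<forall>z\<in>cball w 1. norm (f z) \<le> K"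
    proof -
      have "bounded (f ` cball w 1)"
        by (intro compact_imp_bounded compact_continuous_image holomorphic_on_imp_continuous_on holomorphic_on_subset[OF hol]) auto
      then show ?thesis by (auto simp: bounded_iff)
    qed
    then show ?thesis unfolding \<open>{i\<in>F'. P' i = - w} = {}\<close> by (force intro: exI[of _ 1])
  qed
  show ?thesis using hol bound im zero vr vl by (intro exI[of _ f]) blast
qed

end

section \<open>Balanced families of zeros\<close>

text \<open>
  The target of the fillers is the deficit \<open>M - lam\<close> between the reference sum and the sum over the
  zeros; by the hypothesis on \<open>X\<close> it is increasing up to the constant \<open>C\<close>, as
  \<open>filler_multiplicities\<close> requires. An index \<open>Inl k\<close> stands for the term \<open>X k\<close>, and \<open>Inr (j, u)\<close> for
  one of the \<open>a j\<close> copies of the integer \<open>j\<close>.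
\<close>

lemma family_with_fillers:
  fixes X :: "nat \<Rightarrow> complex" and m :: "nat \<Rightarrow> nat"
  assumes fin: "\<And>t. finite {k. norm (X k) \<le> t}"
    and \<kappa>: "0 < \<kappa>" "\<kappa> \<le> 1" and \<rho>: "20 \<le> \<kappa> * \<rho>" "20 \<le> \<rho>"
    and cone: "\<And>k. \<rho> < norm (X k) \<Longrightarrow> 0 < Re (X k) \<Longrightarrow> \<kappa> * norm (X k) \<le> Re (X k)"
    and mB: "\<And>j. real (m j) \<le> B" and C: "0 \<le> C"
    and l: "\<And>i J. 1 \<le> i \<Longrightarrow> i < J \<Longrightarrow>
       (\<Sum>k\<in>{k. real i < norm (X k) \<and> norm (X k) \<le> real J \<and> 0 < Re (X k)}. Re (1 / X k)) \<le> (\<Sum>j\<in>{i<..J}. real (m j) / real j) + C"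
  shows "\<exists>Q0\<ge>0. \<exists>(P :: nat + nat \<times> nat \<Rightarrow> complex) F. \<forall>n Q. Q0 \<le> Q \<longrightarrow>
     balanced_family P (F n) m n \<kappa> Q B \<and> (\<forall>i\<in>F n. 20 \<le> Re (P i) \<and> norm (P i) \<le> real n) \<and>
     (\<forall>w. 0 < Re w \<and> \<rho> < norm w \<and> norm w \<le> real n \<longrightarrow> card {k. X k = w} \<le> card {i\<in>F n. P i = w})"
proof -
  have B0: "0 \<le> B" using mB[of 0] by linarith
  define S where "S = (\<lambda>t. {k. \<rho> < norm (X k) \<and> norm (X k) \<le> t \<and> 0 < Re (X k)})"
  have finS: "finite (S t)" for t by (rule finite_subset[OF _ fin[of t]]) (auto simp: S_def)
  define lam where "lam = (\<lambda>J::nat. \<Sum>k\<in>S (real J). Re (1 / X k))"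
  define M where "M = (\<lambda>J. \<Sum>j=1..J. real (m j) / real j)"
  have Mdiff: "M J - M i = (\<Sum>j\<in>{i<..J}. real (m j) / real j)" if "i \<le> J" for i J
  proof -
    have "{1..J} = {1..i} \<union> {i<..J}" using that by auto
    moreover have "(\<Sum>j\<in>{1..i} \<union> {i<..J}. real (m j) / real j) = (\<Sum>j=1..i. real (m j) / real j) + (\<Sum>j\<in>{i<..J}. real (m j) / real j)"
      by (rule sum.union_disjoint) auto
    ultimately show ?thesis by (simp add: M_def)
  qed
  have M_mono: "M i \<le> M J" if "i \<le> J" for i J
    using Mdiff[OF that] sum_nonneg[of "{i<..J}" "\<lambda>j. real (m j) / real j"] by simp
  have rpos: "0 \<le> Re (1 / X k)" if "0 < Re (X k)" for k using that by (simp add: Re_divide)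
  have lamdiff: "lam J - lam i = (\<Sum>k\<in>{k\<in>S (real J). real i < norm (X k)}. Re (1 / X k))" if "i \<le> J" for i J
  proof -
    have "S (real J) = S (real i) \<union> {k\<in>S (real J). real i < norm (X k)}" using that by (auto simp: S_def)
    moreover have "(\<Sum>k\<in>S (real i) \<union> {k\<in>S (real J). real i < norm (X k)}. Re (1 / X k))
       = lam i + (\<Sum>k\<in>{k\<in>S (real J). real i < norm (X k)}. Re (1 / X k))"
      unfolding lam_def
    proof (rule sum.union_disjoint)
      show "finite {k\<in>S (real J). real i < norm (X k)}" by (rule finite_subset[OF _ finS[of "real J"]]) auto
      show "S (real i) \<inter> {k\<in>S (real J). real i < norm (X k)} = {}" by (auto simp: S_def)
    qed (rule finS)
    ultimately show ?thesis by (simp add: lam_def)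
  qed
  have step: "lam J - lam i \<le> M J - M i + C" if "1 \<le> i" "i \<le> J" for i J
  proof (cases "i = J")
    case False
    then have ij: "i < J" using that by simp
    have "lam J - lam i = (\<Sum>k\<in>{k\<in>S (real J). real i < norm (X k)}. Re (1 / X k))" using lamdiff that by simp
    also have "\<dots> \<le> (\<Sum>k\<in>{k. real i < norm (X k) \<and> norm (X k) \<le> real J \<and> 0 < Re (X k)}. Re (1 / X k))"
    proof (rule sum_mono2)
      show "finite {k. real i < norm (X k) \<and> norm (X k) \<le> real J \<and> 0 < Re (X k)}"
        by (rule finite_subset[OF _ fin[of "real J"]]) auto
    qed (use rpos in \<open>auto simp: S_def\<close>)
    also have "\<dots> \<le> M J - M i + C" using l[OF that(1) ij] Mdiff that by simp
    finally show ?thesis .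
  qed (use C in auto)
  have lam0: "lam 0 = 0" "lam 1 = 0"
  proof -
    have "S (real 0) = {}" "S (real 1) = {}" using \<rho> by (auto simp: S_def)
    then show "lam 0 = 0" "lam 1 = 0" by (simp_all add: lam_def)
  qed
  have M0: "M 0 = 0" by (simp add: M_def)
  have q: "M i - lam i \<le> M J - lam J + C" if "i \<le> J" for i J
  proof (cases "i = 0")
    case True
    show ?thesis
    proof (cases "J = 0")
      case False
      then have "lam J - lam 1 \<le> M J - M 1 + C" by (intro step) auto
      moreover have "0 \<le> M 1" using M_mono[of 0 1] M0 by simp
      ultimately show ?thesis using True lam0 M0 by simp
    qed (use True C in simp)
  qed (use step[of i J] that in simp)
  have q0: "M 0 - lam 0 = 0" using M0 lam0 by simp
  obtain a :: "nat \<Rightarrow> nat" where a: "\<And>J. \<bar>(\<Sum>j=1..J. real (a j) / real j) - (M J - lam J)\<bar> \<le> C + 1"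
    using filler_multiplicities[of "\<lambda>j. M j - lam j", OF q0 q C] by blast
  define A where "A = (\<lambda>J. \<Sum>j=1..J. real (a j) / real j)"
  have aA: "\<bar>A J - (M J - lam J)\<bar> \<le> C + 1" for J using a[of J] by (simp only: A_def)
  (* The summand A 20 accounts for the fillers up to 20, which are left out to keep all real parts above 20. *)
  define Q0 where "Q0 = 2 * (C + 1) + A 20"
  have A0: "0 \<le> A J" for J by (simp add: A_def sum_nonneg)
  define P :: "nat + nat \<times> nat \<Rightarrow> complex" where "P = case_sum X (\<lambda>(j, i). of_nat j)"
  define F where "F = (\<lambda>n::nat. Inl ` S (real n) \<union> Inr ` (SIGMA j:{21..n}. {..<a j}))"
  have PF: "\<kappa> * norm (P i) \<le> Re (P i) \<and> 20 \<le> Re (P i) \<and> norm (P i) \<le> real n" if "i \<in> F n" for i n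
  proof -
    from that consider k where "i = Inl k" "k \<in> S (real n)" | j u where "i = Inr (j, u)" "j \<in> {21..n}"
      by (auto simp: F_def)
    then show ?thesis
    proof cases
      case 1
      then have k: "\<rho> < norm (X k)" "0 < Re (X k)" "norm (X k) \<le> real n" by (auto simp: S_def)
      have "\<kappa> * \<rho> \<le> \<kappa> * norm (X k)" using k \<kappa> by (intro mult_left_mono) auto
      then have "\<kappa> * norm (X k) \<le> Re (X k)" "20 \<le> Re (X k)" using cone[OF k(1,2)] \<rho> by linarith+
      then show ?thesis using 1 k by (simp add: P_def)
    next
      case 2
      then show ?thesis using \<kappa> by (auto simp: P_def mult_left_le_one_le)
    qed
  qed
  have finF: "finite (F n)" for n using finS by (auto simp: F_def)
  have sumF: "(\<Sum>i\<in>{i\<in>F n. real T < norm (P i)}. Re (1 / P i)) = (lam n - lam T) + (\<Sum>j\<in>{j\<in>{21..n}. T < j}. real (a j) / real j)"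
    if "T \<le> n" for n T
  proof -
    have "{i\<in>F n. real T < norm (P i)} = Inl ` {k\<in>S (real n). real T < norm (X k)} \<union> Inr ` (SIGMA j:{j\<in>{21..n}. T < j}. {..<a j})"
      by (auto simp: F_def P_def)
    then have "(\<Sum>i\<in>{i\<in>F n. real T < norm (P i)}. Re (1 / P i)) =
       (\<Sum>i\<in>Inl ` {k\<in>S (real n). real T < norm (X k)}. Re (1 / P i)) + (\<Sum>i\<in>Inr ` (SIGMA j:{j\<in>{21..n}. T < j}. {..<a j}). Re (1 / P i))"
      by (simp only:) (rule sum.union_disjoint; use finS in auto)
    moreover have "(\<Sum>i\<in>Inl ` {k\<in>S (real n). real T < norm (X k)}. Re (1 / P i)) = lam n - lam T"
      unfolding lamdiff[OF that] by (subst sum.reindex) (auto simp: P_def)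
    moreover have "(\<Sum>i\<in>Inr ` (SIGMA j:{j\<in>{21..n}. T < j}. {..<a j}). Re (1 / P i)) = (\<Sum>j\<in>{j\<in>{21..n}. T < j}. real (a j) / real j)"
    proof -
      have "(\<Sum>i\<in>Inr ` (SIGMA j:{j\<in>{21..n}. T < j}. {..<a j}). Re (1 / P i)) = (\<Sum>(j, u)\<in>(SIGMA j:{j\<in>{21..n}. T < j}. {..<a j}). 1 / real j)"
        by (subst sum.reindex) (auto simp: P_def Re_divide power2_eq_square intro!: sum.cong)
      also have "\<dots> = (\<Sum>j\<in>{j\<in>{21..n}. T < j}. \<Sum>u<a j. 1 / real j)" by (rule sum.Sigma [symmetric]) auto
      finally show ?thesis by simp
    qed
    ultimately show ?thesis by simp
  qed
  have bal: "\<bar>(\<Sum>i\<in>{i\<in>F n. real T < norm (P i)}. Re (1 / P i)) - (\<Sum>j\<in>{T<..n}. real (m j) / real j)\<bar> \<le> Q0" for n T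
  proof (cases "T \<le> n")
    case False
    then have "{i\<in>F n. real T < norm (P i)} = {}" using PF by force
    moreover have "{T<..n} = {}" using False by auto
    moreover have "0 \<le> Q0" using C A0[of 20] by (simp add: Q0_def)
    ultimately show ?thesis by (metis (no_types, lifting) abs_zero diff_0_right sum.empty)
  next
    case True
    have up: "(\<Sum>j\<in>{j\<in>{21..n}. T < j}. real (a j) / real j) \<le> A n - A T"
    proof -
      have "{1..n} = {1..T} \<union> {T<..n}" using True by auto
      moreover have "(\<Sum>j\<in>{1..T} \<union> {T<..n}. real (a j) / real j) = A T + (\<Sum>j\<in>{T<..n}. real (a j) / real j)"
        unfolding A_def by (rule sum.union_disjoint) auto
      ultimately have "A n - A T = (\<Sum>j\<in>{T<..n}. real (a j) / real j)" by (simp add: A_def)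
      moreover have "(\<Sum>j\<in>{j\<in>{21..n}. T < j}. real (a j) / real j) \<le> (\<Sum>j\<in>{T<..n}. real (a j) / real j)"
        by (intro sum_mono2) auto
      ultimately show ?thesis by simp
    qed
    have lo: "A n - A T - A 20 \<le> (\<Sum>j\<in>{j\<in>{21..n}. T < j}. real (a j) / real j)"
    proof -
      have "A n \<le> (\<Sum>j\<in>{1..T} \<union> {1..20} \<union> {j\<in>{21..n}. T < j}. real (a j) / real j)"
        unfolding A_def by (rule sum_mono2) auto
      also have "\<dots> \<le> (\<Sum>j\<in>{1..T} \<union> {1..20}. real (a j) / real j) + (\<Sum>j\<in>{j\<in>{21..n}. T < j}. real (a j) / real j)"
        by (intro eq_refl sum.union_disjoint) auto
      also have "(\<Sum>j\<in>{1..T} \<union> {1..20}. real (a j) / real j) \<le> A T + A 20"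
        unfolding A_def using sum.union_inter[of "{1..T}" "{1..20::nat}" "\<lambda>j. real (a j) / real j"]
          sum_nonneg[of "{1..T} \<inter> {1..20}" "\<lambda>j. real (a j) / real j"] by simp
      finally show ?thesis by simp
    qed
    have lin: "\<bar>ln' - lT + s - (Mn - MT)\<bar> \<le> 2 * (C + 1) + x"
      if "s \<le> An - AT" "An - AT - x \<le> s" "\<bar>An - (Mn - ln')\<bar> \<le> C + 1" "\<bar>AT - (MT - lT)\<bar> \<le> C + 1" "0 \<le> x"
      for ln' lT s Mn MT An AT x :: real
    proof (rule abs_leI)
      have "An - (Mn - ln') \<le> C + 1" "- (An - (Mn - ln')) \<le> C + 1" "AT - (MT - lT) \<le> C + 1" "- (AT - (MT - lT)) \<le> C + 1"
        using that(3,4) by (simp_all only: abs_le_iff)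
      then show "ln' - lT + s - (Mn - MT) \<le> 2 * (C + 1) + x" "- (ln' - lT + s - (Mn - MT)) \<le> 2 * (C + 1) + x"
        using that(1,2,5) by argo+
    qed
    show ?thesis unfolding sumF[OF True] Mdiff[OF True, symmetric] Q0_def
      by (rule lin[OF up lo aA aA A0])
  qed
  have Q00: "0 \<le> Q0" using C A0[of 20] by (simp add: Q0_def)
  have count: "card {k. X k = w} \<le> card {i\<in>F n. P i = w}" if w: "0 < Re w" "\<rho> < norm w" "norm w \<le> real n" for w n
  proof -
    have "Inl ` {k. X k = w} \<subseteq> {i\<in>F n. P i = w}" using w by (auto simp: F_def S_def P_def)
    then have "card (Inl ` {k. X k = w} :: (nat + nat \<times> nat) set) \<le> card {i\<in>F n. P i = w}"
      by (rule card_mono[rotated]) (use finF in auto)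
    then show ?thesis by (simp add: card_image)
  qed
  have "balanced_family P (F n) m n \<kappa> Q B" if "Q0 \<le> Q" for n Q
  proof
    show "\<And>i. i \<in> F n \<Longrightarrow> 1 < norm (P i)" using PF complex_Re_le_cmod by (smt (verit))
    show "\<And>T. \<bar>(\<Sum>i\<in>{i\<in>F n. real T < norm (P i)}. Re (1 / P i)) - (\<Sum>j\<in>{T<..n}. real (m j) / real j)\<bar> \<le> Q"
      using bal that order_trans by blast
  qed (use finF \<kappa> Q00 that B0 PF mB in auto)
  then show ?thesis using Q00 PF count by (intro exI[of _ Q0] conjI exI[of _ P] exI[of _ F]) auto
qed

text \<open>
  The infinite product is \<open>sinh (\<pi> * y) / (\<pi> * y)\<close>, by Euler's product for the sine at \<open>\<i> * y\<close>, and
  the partial products increase.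
\<close>

lemma prod_one_plus_inverse_squares_le: "(\<Prod>j=1..n. 1 + y\<^sup>2 / (real j)\<^sup>2) \<le> exp (pi * \<bar>y\<bar>)"
proof (cases "y = 0")
  case False
  define x where "x = pi * \<bar>y\<bar>"
  have x: "0 < x" using False by (simp add: x_def)
  define p where "p = (\<lambda>n. \<Prod>j=1..n. 1 + y\<^sup>2 / (real j)\<^sup>2)"
  have inc: "incseq p"
  proof (rule incseq_SucI)
    fix n
    have "0 \<le> p n" unfolding p_def by (intro prod_nonneg) auto
    then have "p n * 1 \<le> p n * (1 + y\<^sup>2 / (real (Suc n))\<^sup>2)" by (intro mult_left_mono) auto
    then show "p n \<le> p (Suc n)" by (simp add: p_def)
  qed
  have "(\<lambda>n. norm (of_real pi * (\<i> * of_real y) * (\<Prod>k=1..n. 1 - (\<i> * of_real y)\<^sup>2 / of_nat k ^ 2))) \<longlonglongrightarrow> norm (sin (of_real pi * (\<i> * of_real y)))"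
    by (intro tendsto_norm sin_product_formula_complex)
  moreover have "norm (of_real pi * (\<i> * of_real y) * (\<Prod>k=1..n. 1 - (\<i> * of_real y)\<^sup>2 / of_nat k ^ 2)) = x * p n" for n
  proof -
    have "(\<Prod>k=1..n. 1 - (\<i> * of_real y)\<^sup>2 / of_nat k ^ 2) = complex_of_real (p n)"
      by (simp add: p_def power_mult_distrib)
    moreover have "0 \<le> p n" unfolding p_def by (intro prod_nonneg) auto
    ultimately show ?thesis by (simp add: norm_mult x_def)
  qed
  ultimately have lim: "(\<lambda>n. x * p n) \<longlonglongrightarrow> norm (sin (of_real pi * (\<i> * of_real y)))" by simp
  have "incseq (\<lambda>n. x * p n)" using inc x by (auto simp: incseq_def intro: mult_left_mono)
  then have le: "x * p n \<le> norm (sin (of_real pi * (\<i> * of_real y)))" using incseq_le[OF _ lim] by blast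
  have "norm (sin (of_real pi * (\<i> * of_real y))) \<le> x * exp x"
  proof -
    have "norm (sin (of_real pi * (\<i> * of_real y))) = \<bar>exp (- (pi * y)) - exp (pi * y)\<bar> / 2"
    proof -
      have "sin (of_real pi * (\<i> * of_real y)) = (of_real (exp (- (pi * y))) - of_real (exp (pi * y))) / (2 * \<i>)"
        unfolding sin_exp_eq by (simp add: exp_of_real [symmetric] mult_ac)
      also have "norm \<dots> = norm (complex_of_real (exp (- (pi * y)) - exp (pi * y))) / 2" by (simp add: norm_divide norm_mult)
      finally show ?thesis by (simp only: norm_of_real)
    qed
    also have "\<dots> = (exp x - exp (- x)) / 2"
    proof -
      have e: "exp (- x) \<le> exp x" using x by simp
      consider "pi * y = x" | "pi * y = - x" by (cases "0 \<le> y") (auto simp: x_def)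
      then show ?thesis using e by cases auto
    qed
    also have "\<dots> \<le> x * exp x"
    proof -
      have "1 - 2 * x \<le> exp (- (2 * x))" using exp_ge_add_one_self[of "- (2 * x)"] by simp
      then have "(1 - 2 * x) * exp x \<le> exp (- (2 * x)) * exp x" by (intro mult_right_mono) auto
      also have "\<dots> = exp (- x)" by (simp flip: exp_add)
      finally show ?thesis by (simp add: left_diff_distrib)
    qed
    finally show ?thesis .
  qed
  then have "x * p n \<le> x * exp x" using le by linarith
  then have "p n \<le> exp x" using x by simp
  then show ?thesis by (simp add: p_def x_def)
qed (simp add: prod_le_1)

section \<open>From the logarithmic bound to entire functions\<close>

lemma separated_cone:
  assumes Z: "no_limit_points Z" and sep: "separated_from_imaginary_axis Z"
  obtains \<kappa> \<rho> where "0 < \<kappa>" "\<kappa> \<le> 1" "\<And>k. \<rho> < norm (Z k) \<Longrightarrow> \<kappa> * norm (Z k) \<le> \<bar>Re (Z k)\<bar>"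
proof -
  obtain c :: real where c0: "0 < ereal c" and c2: "ereal c < liminf (\<lambda>k. ereal (\<bar>Re (Z k)\<bar> / norm (Z k)))"
    using ereal_dense2[OF sep[unfolded separated_from_imaginary_axis_def]] by blast
  have c: "0 < c" using c0 by simp
  from less_LiminfD[OF c2] obtain k0 where k0: "\<And>k. k0 \<le> k \<Longrightarrow> c < \<bar>Re (Z k)\<bar> / norm (Z k)"
    by (auto simp: eventually_sequentially)
  define \<rho> where "\<rho> = (\<Sum>k<k0. norm (Z k))"
  show thesis
  proof (rule that[of "min c 1" \<rho>])
    fix k assume k: "\<rho> < norm (Z k)"
    have "k0 \<le> k"
    proof (rule ccontr)
      assume "\<not> k0 \<le> k"
      then have "norm (Z k) \<le> \<rho>" unfolding \<rho>_def by (intro member_le_sum) auto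
      then show False using k by simp
    qed
    then have "c < \<bar>Re (Z k)\<bar> / norm (Z k)" by (rule k0)
    moreover have pos: "0 < norm (Z k)" using k sum_nonneg[of "{..<k0}" "\<lambda>k. norm (Z k)"] unfolding \<rho>_def by auto
    ultimately have "c * norm (Z k) \<le> \<bar>Re (Z k)\<bar>" by (simp add: pos_less_divide_eq)
    moreover have "min c 1 * norm (Z k) \<le> c * norm (Z k)" by (intro mult_right_mono) auto
    ultimately show "min c 1 * norm (Z k) \<le> \<bar>Re (Z k)\<bar>" by linarith
  qed (use c in auto)
qed

text \<open>
  Schwarz's lemma: after division by \<open>(z - w) ^ p\<close>, the maximum principle on the unit disc about \<open>w\<close>
  replaces the unspecified \<open>K\<close> and \<open>\<rho>\<close> by a bound that only involves the size of \<open>f\<close>. Such a bound is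
  uniform along a locally bounded sequence.
\<close>

lemma vanishing_bound_uniform:
  fixes f :: "complex \<Rightarrow> complex"
  assumes hol: "f holomorphic_on UNIV" and nz: "f \<noteq> (\<lambda>_. 0)"
    and \<rho>: "0 < \<rho>" "\<And>z. z \<in> ball w \<rho> \<Longrightarrow> norm (f z) \<le> K * norm (z - w) ^ e" and p: "p \<le> e"
    and B: "\<And>z. z \<in> cball w 1 \<Longrightarrow> norm (f z) \<le> B"
    and z: "z \<in> ball w 1"
  shows "norm (f z) \<le> B * norm (z - w) ^ p"
proof -
  have ord: "int e \<le> zorder f w" by (rule zorder_ge_of_bound[OF hol nz \<rho>])
  have "int (card {k\<in>{..<p}. w = v}) \<le> zorder f v" for v
  proof (cases "w = v")
    case True
    then show ?thesis using ord p by simp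
  next
    case False
    then show ?thesis using zorder_ge_0[OF entire_nonzero(3,2)[OF hol nz]] by simp
  qed
  then obtain h where h: "h holomorphic_on UNIV" "\<And>z. f z = (\<Prod>k\<in>{..<p}. z - w) * h z"
    using entire_divide_by_zeros[OF finite_lessThan hol nz, of p "\<lambda>_. w"] by blast
  have fh: "f z = (z - w) ^ p * h z" for z using h(2)[of z] by simp
  have "norm (h z) \<le> B"
  proof (rule max_modulus_closed[of "ball w 1" "cball w 1" h B z])
    show "h holomorphic_on ball w 1" using h(1) by (rule holomorphic_on_subset) auto
    show "continuous_on (cball w 1) h"
      by (intro holomorphic_on_imp_continuous_on holomorphic_on_subset[OF h(1)]) auto
    show "z \<in> cball w 1" using z by simp
    fix v assume "v \<in> cball w 1 - ball w 1"
    then have "norm (v - w) = 1" "v \<in> cball w 1" by (auto simp: dist_norm norm_minus_commute)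
    then show "norm (h v) \<le> B" using B[of v] fh[of v] by (simp add: norm_mult norm_power)
  qed auto
  then have "norm (h z) * norm (z - w) ^ p \<le> B * norm (z - w) ^ p" by (intro mult_right_mono) auto
  then show ?thesis unfolding fh norm_mult norm_power by (simp only: mult.commute)
qed

text \<open>
  A subsequence converges by Montel's theorem, and every bound that holds eventually at a point is
  inherited by the limit at that point.
\<close>

lemma entire_limit:
  fixes f :: "nat \<Rightarrow> complex \<Rightarrow> complex"
  assumes hol: "\<And>n. f n holomorphic_on UNIV"
    and bd: "\<And>n z. norm (f n z) \<le> H (norm z)" and mono: "\<And>s t. s \<le> t \<Longrightarrow> H s \<le> H t"
    and c: "\<And>n. c \<le> norm (f n 0)"
  obtains g where "g holomorphic_on UNIV" "c \<le> norm (g 0)"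
    "\<And>z B. (\<forall>\<^sub>F n in sequentially. norm (f n z) \<le> B) \<Longrightarrow> norm (g z) \<le> B"
proof -
  have bdK: "\<exists>B. \<forall>h\<in>range f. \<forall>z\<in>K. norm (h z) \<le> B" if K: "compact K" for K
  proof -
    obtain R where R: "\<And>z. z \<in> K \<Longrightarrow> norm z \<le> R"
      using compact_imp_bounded[OF K] by (auto simp: bounded_iff)
    have "norm (f n z) \<le> H R" if "z \<in> K" for n z using bd[of n z] mono[OF R[OF that]] by linarith
    then show ?thesis by blast
  qed
  obtain g r where g: "g holomorphic_on UNIV" "strict_mono (r :: nat \<Rightarrow> nat)"
     "\<And>x. x \<in> UNIV \<Longrightarrow> (\<lambda>n. f (r n) x) \<longlonglongrightarrow> g x"

    by (rule Montel[OF open_UNIV, of "range f" f]) (use hol bdK in auto)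
  have lim: "(\<lambda>n. norm (f (r n) x)) \<longlonglongrightarrow> norm (g x)" for x using g(3) by (intro tendsto_norm) auto
  show thesis
  proof (rule that[OF g(1)])
    show "c \<le> norm (g 0)" by (rule tendsto_lowerbound[OF lim]) (use c in auto)
    fix z B assume "\<forall>\<^sub>F n in sequentially. norm (f n z) \<le> B"
    then have "\<forall>\<^sub>F n in sequentially. norm (f (r n) z) \<le> B" by (rule eventually_subseq[OF g(2)])
    then show "norm (g z) \<le> B" by (intro tendsto_upperbound[OF lim]) auto
  qed
qed

text \<open>
  After division by \<open>r\<close>, the constant and the logarithmic term in the exponent tend to \<open>0\<close>.
\<close>

lemma growth_indicator_le:
  assumes bd: "\<And>\<epsilon>. 0 < \<epsilon> \<Longrightarrow> \<exists>C K. \<forall>r\<ge>1. norm (f (of_real r * cis \<theta>)) \<le> exp (C + (a + \<epsilon>) * r + K * ln (1 + r\<^sup>2))"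
  shows "growth_indicator f \<theta> \<le> ereal a"
proof (rule ereal_le_epsilon2)
  fix e :: real assume e: "0 < e"
  obtain C K where CK: "\<And>r. 1 \<le> r \<Longrightarrow> norm (f (of_real r * cis \<theta>)) \<le> exp (C + (a + e / 2) * r + K * ln (1 + r\<^sup>2))"
    using bd[of "e / 2"] e by auto
  have "((\<lambda>r::real. C * (1 / r) + K * (ln (1 + r\<^sup>2) / r)) \<longlongrightarrow> C * 0 + K * 0) at_top"
    by (intro tendsto_intros) real_asymp+
  then have "\<forall>\<^sub>F r in at_top. C * (1 / r) + K * (ln (1 + r\<^sup>2) / r) < e / 2"
    using e by (intro order_tendstoD(2)) auto
  then have "\<forall>\<^sub>F r in at_top. ln_norm (f (of_real r * cis \<theta>)) / ereal r \<le> ereal (a + e)"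
    using eventually_ge_at_top[of 1]
  proof eventually_elim
    case (elim r)
    show ?case
    proof (cases "f (of_real r * cis \<theta>) = 0")
      case True
      then show ?thesis using elim by (simp add: ln_norm_def)
    next
      case False
      have "ln (norm (f (of_real r * cis \<theta>))) \<le> C + (a + e / 2) * r + K * ln (1 + r\<^sup>2)"

        using ln_mono[OF CK[OF elim(2)]] False by simp
      then have "ln (norm (f (of_real r * cis \<theta>))) / r \<le> (C + (a + e / 2) * r + K * ln (1 + r\<^sup>2)) / r"
        using elim by (intro divide_right_mono) auto
      also have "\<dots> = (a + e / 2) + (C * (1 / r) + K * (ln (1 + r\<^sup>2) / r))" using elim by (simp add: field_simps)
      also have "\<dots> \<le> a + e" using elim(1) by linarith
      finally show ?thesis using False elim by (simp add: ln_norm_def)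
    qed
  qed
  then have "growth_indicator f \<theta> \<le> ereal (a + e)" unfolding growth_indicator_def by (rule Limsup_bounded)
  then show "growth_indicator f \<theta> \<le> ereal a + ereal e" by simp
qed

lemma exponential_typeI:
  assumes hol: "f holomorphic_on UNIV" and bd: "\<And>z. norm (f z) \<le> exp (C + \<sigma> * norm z)"
  shows "entire_of_exponential_type f"
proof -
  have "\<forall>\<^sub>F z in at_infinity. ln_norm (f z) / ereal (norm z) \<le> ereal (\<bar>C\<bar> + \<sigma>)"
    unfolding eventually_at_infinity
  proof (intro exI allI impI)
    fix z :: complex assume z: "1 \<le> norm z"
    show "ln_norm (f z) / ereal (norm z) \<le> ereal (\<bar>C\<bar> + \<sigma>)"
    proof (cases "f z = 0")
      case True
      then show ?thesis using z by (simp add: ln_norm_def)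
    next
      case False
      have "ln (norm (f z)) \<le> C + \<sigma> * norm z"
        using ln_mono[OF bd[of z]] False by simp
      also have "\<dots> \<le> (\<bar>C\<bar> + \<sigma>) * norm z"
      proof -
        have "\<bar>C\<bar> * 1 \<le> \<bar>C\<bar> * norm z" using z by (intro mult_left_mono) auto
        then show ?thesis by (simp add: distrib_right)
      qed
      finally have "ln (norm (f z)) / norm z \<le> \<bar>C\<bar> + \<sigma>"
        using z by (subst pos_divide_le_eq) auto
      moreover have "z \<noteq> 0" using z by auto
      ultimately show ?thesis using False by (simp add: ln_norm_def)
    qed
  qed
  then have "Limsup at_infinity (\<lambda>z. ln_norm (f z) / ereal (norm z)) \<le> ereal (\<bar>C\<bar> + \<sigma>)" by (rule Limsup_bounded)
  then show ?thesis using hol unfolding entire_of_exponential_type_def by (auto intro: le_less_trans)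
qed

text \<open>
  The construction uses only terms of modulus above \<open>\<rho>\<close>: those lie in the cone \<open>\<kappa> * |z| \<le> |Re z|\<close> and
  have \<open>|Re z| \<ge> 20\<close>. The polynomial \<open>q\<close> contributes the finitely many remaining ones; it affects the
  growth by a power of \<open>1 + |z|\<close>.
\<close>

lemma entire_function_of_log_submeasure_bound:
  fixes Z :: "nat \<Rightarrow> complex" and b C :: real and d :: "real \<Rightarrow> real"
  assumes Z: "no_limit_points Z" and sep: "separated_from_imaginary_axis Z" and b: "0 \<le> b"
    and C: "0 \<le> C" and d: "\<And>x. 0 \<le> x \<Longrightarrow> 0 \<le> d x" "bounded (d ` {0..})" "(d \<longlongrightarrow> 0) at_top"
    and l: "\<And>r R. 0 < r \<Longrightarrow> r < R \<Longrightarrow> log_submeasure Z r R \<le> (b + d R) * ln (R / r) + C"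
  shows "\<exists>f. entire_of_exponential_type f \<and> f \<noteq> (\<lambda>_. 0) \<and> vanishes_on f Z \<and>
              growth_indicator f (pi / 2) \<le> ereal (pi * b) \<and>
              growth_indicator f (- pi / 2) \<le> ereal (pi * b)"
proof -
  have fin: "finite {k. norm (Z k) \<le> t}" for t by (rule finite_norm_le[OF Z])
  obtain \<kappa> \<rho>0 where \<kappa>: "0 < \<kappa>" "\<kappa> \<le> 1" and cone0: "\<And>k. \<rho>0 < norm (Z k) \<Longrightarrow> \<kappa> * norm (Z k) \<le> \<bar>Re (Z k)\<bar>"
    proof (rule separated_cone[OF Z sep], goal_cases)
    case (1 \<kappa> \<rho>)
    from 1(2-) show ?case by (rule 1(1))
  qed
  define \<rho> where "\<rho> = max \<rho>0 (20 / \<kappa>)"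
  have \<rho>: "20 \<le> \<kappa> * \<rho>" "20 \<le> \<rho>"
  proof -
    have "20 / \<kappa> \<le> \<rho>" by (simp add: \<rho>_def)
    then show "20 \<le> \<kappa> * \<rho>" using \<kappa> by (simp add: pos_divide_le_eq mult.commute)
    have "20 \<le> 20 / \<kappa>" using \<kappa> by (simp add: field_simps)
    then show "20 \<le> \<rho>" by (simp add: \<rho>_def)
  qed
  have cone: "\<kappa> * norm (Z k) \<le> \<bar>Re (Z k)\<bar>" if "\<rho> < norm (Z k)" for k using cone0[of k] that by (simp add: \<rho>_def)
  obtain m :: "nat \<Rightarrow> nat" and C2 B where m: "0 \<le> C2" "\<And>j. real (m j) \<le> B"
    "\<And>i J. 1 \<le> i \<Longrightarrow> i \<le> J \<Longrightarrow> (b + d (real J)) * ln (real J / real i) \<le> (\<Sum>j\<in>{i<..J}. real (m j) / real j) + C2"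
    "\<And>\<epsilon>. 0 < \<epsilon> \<Longrightarrow> \<exists>K\<ge>0. \<forall>n h. (\<forall>j\<ge>1. 0 \<le> h j \<and> h (Suc j) \<le> h j) \<longrightarrow>
        (\<Sum>j=1..n. real (m j) * h j) \<le> (b + \<epsilon>) * (\<Sum>j=1..n. h j) + K * h (1::nat)"
    proof (rule reference_multiplicities[of b d], goal_cases)
    case (5 m C B)
    from 5(2-) show ?case by (rule 5(1))
  qed (use b d in simp_all)
  have lZ: "log_submeasure Z (real i) (real J) \<le> (\<Sum>j\<in>{i<..J}. real (m j) / real j) + (C2 + C)" if "1 \<le> i" "i < J" for i J
    using l[of "real i" "real J"] m(3)[of i J] that by simp
  obtain Q1 P1 F1 where f1: "0 \<le> Q1" "\<And>n Q. Q1 \<le> Q \<Longrightarrow> balanced_family (P1 :: nat + nat \<times> nat \<Rightarrow> complex) (F1 n) m n \<kappa> Q B \<and>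
     (\<forall>i\<in>F1 n. 20 \<le> Re (P1 i) \<and> norm (P1 i) \<le> real n) \<and>
     (\<forall>w. 0 < Re w \<and> \<rho> < norm w \<and> norm w \<le> real n \<longrightarrow> card {k. Z k = w} \<le> card {i\<in>F1 n. P1 i = w})"
  proof -
    have "\<exists>Q0\<ge>0. \<exists>(P :: nat + nat \<times> nat \<Rightarrow> complex) F. \<forall>n Q. Q0 \<le> Q \<longrightarrow>
     balanced_family P (F n) m n \<kappa> Q B \<and> (\<forall>i\<in>F n. 20 \<le> Re (P i) \<and> norm (P i) \<le> real n) \<and>
     (\<forall>w. 0 < Re w \<and> \<rho> < norm w \<and> norm w \<le> real n \<longrightarrow> card {k. Z k = w} \<le> card {i\<in>F n. P i = w})"
    proof (rule family_with_fillers[OF fin \<kappa> \<rho> _ m(2)])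
      show "\<kappa> * norm (Z k) \<le> Re (Z k)" if "\<rho> < norm (Z k)" "0 < Re (Z k)" for k using cone[OF that(1)] that(2) by simp
      show "0 \<le> C2 + C" using m(1) C by simp
      show "(\<Sum>k\<in>{k. real i < norm (Z k) \<and> norm (Z k) \<le> real J \<and> 0 < Re (Z k)}. Re (1 / Z k)) \<le> (\<Sum>j\<in>{i<..J}. real (m j) / real j) + (C2 + C)"
        if "1 \<le> i" "i < J" for i J
        using lZ[OF that] unfolding log_submeasure_def by linarith
    qed
    then show thesis using that by blast
  qed
  obtain Q2 P2 F2 where f2: "0 \<le> Q2" "\<And>n Q. Q2 \<le> Q \<Longrightarrow> balanced_family (P2 :: nat + nat \<times> nat \<Rightarrow> complex) (F2 n) m n \<kappa> Q B \<and>
     (\<forall>i\<in>F2 n. 20 \<le> Re (P2 i) \<and> norm (P2 i) \<le> real n) \<and>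
     (\<forall>w. 0 < Re w \<and> \<rho> < norm w \<and> norm w \<le> real n \<longrightarrow> card {k. - Z k = w} \<le> card {i\<in>F2 n. P2 i = w})"
  proof -
    have "\<exists>Q0\<ge>0. \<exists>(P :: nat + nat \<times> nat \<Rightarrow> complex) F. \<forall>n Q. Q0 \<le> Q \<longrightarrow>
     balanced_family P (F n) m n \<kappa> Q B \<and> (\<forall>i\<in>F n. 20 \<le> Re (P i) \<and> norm (P i) \<le> real n) \<and>
     (\<forall>w. 0 < Re w \<and> \<rho> < norm w \<and> norm w \<le> real n \<longrightarrow> card {k. - Z k = w} \<le> card {i\<in>F n. P i = w})"
    proof (rule family_with_fillers[OF _ \<kappa> \<rho> _ m(2)])
      show "finite {k. norm (- Z k) \<le> t}" for t using fin by simp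
      show "\<kappa> * norm (- Z k) \<le> Re (- Z k)" if "\<rho> < norm (- Z k)" "0 < Re (- Z k)" for k using cone[of k] that by simp
      show "0 \<le> C2 + C" using m(1) C by simp
      show "(\<Sum>k\<in>{k. real i < norm (- Z k) \<and> norm (- Z k) \<le> real J \<and> 0 < Re (- Z k)}. Re (1 / - Z k)) \<le> (\<Sum>j\<in>{i<..J}. real (m j) / real j) + (C2 + C)"
        if "1 \<le> i" "i < J" for i J
        using lZ[OF that] unfolding log_submeasure_def by simp
    qed
    then show thesis using that by blast
  qed
  define Q where "Q = max Q1 Q2"
  have pair: "balanced_pair P1 P2 (F1 n) (F2 n) m n \<kappa> Q B" for n
    using f1(2)[of Q n] f2(2)[of Q n] \<kappa>(2)
    by (auto simp: Q_def balanced_pair_def balanced_pair_axioms_def)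
  define G where "G = balanced_pair.glue_const \<kappa>"
  define D where "D = balanced_pair.D \<kappa> Q B"
  define E where "E = balanced_pair.E \<kappa> Q B"
  define R where "R n f \<longleftrightarrow> f holomorphic_on UNIV \<and>
     (\<forall>z. norm (f z) \<le> 2 * exp (2 * G) * exp (D * norm z + E * (1 + norm z))) \<and>
     (\<forall>y. norm (f (\<i> * of_real y)) \<le> 2 * exp (2 * G) * (\<Prod>j=1..n. (1 + y\<^sup>2 / (real j)\<^sup>2) ^ m j)) \<and>
     2 * exp (- (2 * G)) \<le> norm (f 0) \<and>
     (\<forall>w. 0 < Re w \<longrightarrow> (\<exists>K \<rho>. 0 < \<rho> \<and> (\<forall>z\<in>ball w \<rho>. norm (f z) \<le> K * norm (z - w) ^ card {i\<in>F1 n. P1 i = w}))) \<and>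
     (\<forall>w. Re w < 0 \<longrightarrow> (\<exists>K \<rho>. 0 < \<rho> \<and> (\<forall>z\<in>ball w \<rho>. norm (f z) \<le> K * norm (z - w) ^ card {i\<in>F2 n. P2 i = - w})))" for n and f :: "complex \<Rightarrow> complex"
  have "\<exists>f. R n f" for n
    using balanced_pair.glued_function[OF pair[of n]] unfolding R_def G_def D_def E_def .
  then obtain f where R: "\<And>n. R n (f n)" by metis
  have f: "\<And>n. f n holomorphic_on UNIV"
     "\<And>n z. norm (f n z) \<le> 2 * exp (2 * G) * exp (D * norm z + E * (1 + norm z))"
     "\<And>n y. norm (f n (\<i> * of_real y)) \<le> 2 * exp (2 * G) * (\<Prod>j=1..n. (1 + y\<^sup>2 / (real j)\<^sup>2) ^ m j)"
     "\<And>n. 2 * exp (- (2 * G)) \<le> norm (f n 0)"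
     "\<And>n w. 0 < Re w \<Longrightarrow> (\<exists>K \<rho>. 0 < \<rho> \<and> (\<forall>z\<in>ball w \<rho>. norm (f n z) \<le> K * norm (z - w) ^ card {i\<in>F1 n. P1 i = w}))"
     "\<And>n w. Re w < 0 \<Longrightarrow> (\<exists>K \<rho>. 0 < \<rho> \<and> (\<forall>z\<in>ball w \<rho>. norm (f n z) \<le> K * norm (z - w) ^ card {i\<in>F2 n. P2 i = - w}))"
    using R unfolding R_def by blast+
  have DE: "0 \<le> D" "0 \<le> E" using balanced_pair.params(4,5)[OF pair[of 0]] by (auto simp: D_def E_def)
  define H where "H = (\<lambda>t. 2 * exp (2 * G) * exp (D * t + E * (1 + t)))"
  have Hmono: "H s \<le> H t" if "s \<le> t" for s t
    unfolding H_def using that DE by (intro mult_left_mono) (auto intro!: add_mono mult_left_mono)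
  have fH: "norm (f n z) \<le> H (norm z)" for n z using f(2) by (simp add: H_def)
  obtain g where g: "g holomorphic_on UNIV" "2 * exp (- (2 * G)) \<le> norm (g 0)"
    "\<And>z B. (\<forall>\<^sub>F n in sequentially. norm (f n z) \<le> B) \<Longrightarrow> norm (g z) \<le> B"
    proof (rule entire_limit[of f H "2 * exp (- (2 * G))"], goal_cases)
    case (5 g)
    from 5(2-) show ?case by (rule 5(1))
  qed (use f fH Hmono in simp_all)
  have gH: "norm (g z) \<le> H (norm z)" for z by (rule g(3)) (use fH in auto)
  have g0: "g 0 \<noteq> 0"
  proof
    assume "g 0 = 0"
    then show False using g(2) by (simp add: not_le)
  qed
  have gim: "\<exists>K\<ge>0. \<forall>y. norm (g (\<i> * of_real y)) \<le> 2 * exp (2 * G) * exp ((pi * b + \<epsilon>) * \<bar>y\<bar> + K * ln (1 + y\<^sup>2))"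
    if \<epsilon>: "0 < \<epsilon>" for \<epsilon>
  proof -
    obtain K where K: "0 \<le> K" "\<And>n h. (\<forall>j\<ge>1. 0 \<le> h j \<and> h (Suc j) \<le> h j) \<Longrightarrow>
        (\<Sum>j=1..n. real (m j) * h j) \<le> (b + \<epsilon> / pi) * (\<Sum>j=1..n. h j) + K * h (1::nat)"
      using m(4)[of "\<epsilon> / pi"] \<epsilon> by auto
    have "(\<Prod>j=1..n. (1 + y\<^sup>2 / (real j)\<^sup>2) ^ m j) \<le> exp ((pi * b + \<epsilon>) * \<bar>y\<bar> + K * ln (1 + y\<^sup>2))" for n y
    proof -
      (* These weights are decreasing in j, so the sum with the multiplicities m j compares with b + \<epsilon> / pi
         times the sum without them. *)
      define h where "h = (\<lambda>j::nat. ln (1 + y\<^sup>2 / (real j)\<^sup>2))"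
      have pos: "0 < 1 + y\<^sup>2 / (real j)\<^sup>2" for j by (simp add: add_pos_nonneg)
      have "(\<Prod>j=1..n. (1 + y\<^sup>2 / (real j)\<^sup>2) ^ m j) = (\<Prod>j=1..n. exp (real (m j) * h j))"
        by (rule prod.cong) (use pos in \<open>auto simp: h_def exp_of_nat_mult\<close>)
      also have "\<dots> = exp (\<Sum>j=1..n. real (m j) * h j)" by (rule exp_sum [symmetric]) auto
      also have "\<dots> \<le> exp ((b + \<epsilon> / pi) * (\<Sum>j=1..n. h j) + K * h 1)"
      proof -
        have "0 \<le> h j \<and> h (Suc j) \<le> h j" if "1 \<le> j" for j
        proof -
          have "y\<^sup>2 / (real (Suc j))\<^sup>2 \<le> y\<^sup>2 / (real j)\<^sup>2"
            using that by (intro divide_left_mono power_mono mult_pos_pos) auto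
          then show ?thesis using pos[of j] pos[of "Suc j"] by (auto simp: h_def)
        qed
        then show ?thesis using K(2)[of h n] by simp
      qed
      also have "\<dots> \<le> exp ((pi * b + \<epsilon>) * \<bar>y\<bar> + K * ln (1 + y\<^sup>2))"
      proof -
        have "exp (\<Sum>j=1..n. h j) = (\<Prod>j=1..n. 1 + y\<^sup>2 / (real j)\<^sup>2)"
          by (subst exp_sum) (use pos in \<open>auto simp: h_def\<close>)
        also have "\<dots> \<le> exp (pi * \<bar>y\<bar>)" by (rule prod_one_plus_inverse_squares_le)
        finally have "(\<Sum>j=1..n. h j) \<le> pi * \<bar>y\<bar>" by simp
        then have "(b + \<epsilon> / pi) * (\<Sum>j=1..n. h j) \<le> (b + \<epsilon> / pi) * (pi * \<bar>y\<bar>)" using b \<epsilon> by (intro mult_left_mono) auto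
        also have "\<dots> = (pi * b + \<epsilon>) * \<bar>y\<bar>" by (simp add: field_simps)
        finally show ?thesis by (simp add: h_def)
      qed
      finally show ?thesis .
    qed
    then have "norm (f n (\<i> * of_real y)) \<le> 2 * exp (2 * G) * exp ((pi * b + \<epsilon>) * \<bar>y\<bar> + K * ln (1 + y\<^sup>2))" for n y
      by (intro order_trans[OF f(3)] mult_left_mono) auto
    then show ?thesis using K(1) by (intro exI[of _ K]) (auto intro!: g(3))
  qed
  have gvan: "\<exists>B. \<forall>z\<in>ball w 1. norm (g z) \<le> B * norm (z - w) ^ card {k. Z k = w}" if w: "\<rho> < norm w" for w
  proof (cases "Re w = 0")
    case True
    have "{k. Z k = w} = {}"
    proof -
      have "Z k \<noteq> w" for k
      proof
        assume "Z k = w"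
        then have "\<kappa> * norm w \<le> 0" using cone[of k] w True by auto
        moreover have "0 < \<kappa> * norm w" using \<kappa> w \<rho> by (intro mult_pos_pos) linarith+
        ultimately show False by linarith
      qed
      then show ?thesis by blast
    qed
    moreover have "norm (g z) \<le> H (norm w + 1)" if "z \<in> ball w 1" for z
    proof -
      have "norm z \<le> norm w + 1" using that norm_triangle_ineq2[of z w] by (simp add: dist_norm norm_minus_commute)
      then show ?thesis using gH[of z] Hmono by (meson order_trans)
    qed
    ultimately show ?thesis by (intro exI[of _ "H (norm w + 1)"]) simp
  next
    case False
    define p where "p = card {k. Z k = w}"
    have ev: "norm (f n z) \<le> H (norm w + 1) * norm (z - w) ^ p" if n: "norm w \<le> real n" and z: "z \<in> ball w 1" for n z
    proof -
      have "f n 0 \<noteq> 0"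
      proof
        assume "f n 0 = 0"
        then show False using f(4)[of n] by (simp add: not_le)
      qed
      then have nz: "f n \<noteq> (\<lambda>_. 0)" by metis
      have "\<exists>e K \<rho>. p \<le> e \<and> 0 < \<rho> \<and> (\<forall>z\<in>ball w \<rho>. norm (f n z) \<le> K * norm (z - w) ^ e)"
      proof (cases "0 < Re w")
        case True
        have "p \<le> card {i\<in>F1 n. P1 i = w}" using f1(2)[of Q n] True w n unfolding p_def Q_def by auto
        then show ?thesis using f(5)[OF True, of n] by blast
      next
        case False
        then have neg: "Re w < 0" using \<open>Re w \<noteq> 0\<close> by simp
        have "{k. Z k = w} = {k. - Z k = - w}" by auto
        moreover have "card {k. - Z k = - w} \<le> card {i\<in>F2 n. P2 i = - w}"
        proof -
          have "Q2 \<le> Q" by (simp add: Q_def)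
          from f2(2)[OF this, of n] show ?thesis using neg w n by (elim conjE allE[of _ "- w"]) simp
        qed
        ultimately have "p \<le> card {i\<in>F2 n. P2 i = - w}" unfolding p_def by metis
        then show ?thesis using f(6)[OF neg, of n] by blast
      qed
      then obtain e K r where e: "p \<le> e" "0 < r" "\<And>z. z \<in> ball w r \<Longrightarrow> norm (f n z) \<le> K * norm (z - w) ^ e" by blast
      show ?thesis
      proof (rule vanishing_bound_uniform[OF f(1) nz e(2,3,1) _ z])
        fix v assume "v \<in> cball w 1"
        then have "norm v \<le> norm w + 1" using norm_triangle_ineq2[of v w] by (simp add: dist_norm norm_minus_commute)
        then show "norm (f n v) \<le> H (norm w + 1)" using fH[of n v] Hmono by (meson order_trans)
      qed
    qed
    have "norm (g z) \<le> H (norm w + 1) * norm (z - w) ^ p" if z: "z \<in> ball w 1" for z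
    proof (rule g(3))
      obtain n0 :: nat where "norm w \<le> real n0" using real_arch_simple by blast
      then show "\<forall>\<^sub>F n in sequentially. norm (f n z) \<le> H (norm w + 1) * norm (z - w) ^ p"
        unfolding eventually_sequentially using ev[OF _ z] by (intro exI[of _ n0]) (auto intro: order_trans)
    qed
    then show ?thesis unfolding p_def by blast
  qed
  define K0 where "K0 = {k. norm (Z k) \<le> \<rho>}"
  have finK0: "finite K0" unfolding K0_def by (rule fin)
  define q where "q = (\<lambda>z. \<Prod>k\<in>K0. z - Z k)"
  define F where "F = (\<lambda>z. q z * g z)"
  have holq: "q holomorphic_on UNIV" unfolding q_def by (intro holomorphic_intros)
  have holF: "F holomorphic_on UNIV" unfolding F_def by (intro holomorphic_intros holq g(1))
  have qle: "norm (q z) \<le> (norm z + \<rho>) ^ card K0" for z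
  proof -
    have "norm (q z) = (\<Prod>k\<in>K0. norm (z - Z k))" by (simp add: q_def prod_norm)
    also have "\<dots> \<le> (\<Prod>k\<in>K0. norm z + \<rho>)"
    proof (intro prod_mono conjI)
      fix k assume "k \<in> K0"
      then show "norm (z - Z k) \<le> norm z + \<rho>" using norm_triangle_ineq4[of z "Z k"] by (simp add: K0_def)
    qed auto
    finally show ?thesis by simp
  qed
  have nzF: "F \<noteq> (\<lambda>_. 0)"
  proof -
    have "\<forall>\<^sub>F z in at 0. g z \<noteq> 0" by (rule entire_nonzero(1)[OF g(1)]) (use g0 in metis)
    moreover have "\<forall>\<^sub>F z in at 0. z \<notin> Z ` K0 - {0}"
    proof -
      have "finite (Z ` K0 - {0})" using finK0 by simp
      then have "open (- (Z ` K0 - {0}))" by (intro open_Compl finite_imp_closed)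
      then have "\<forall>\<^sub>F z in at 0. z \<in> - (Z ` K0 - {0}) - {0}" by (intro eventually_at_in_open) auto
      then show ?thesis by (auto elim: eventually_mono)
    qed
    moreover have "\<forall>\<^sub>F z in at 0. z \<noteq> (0::complex)" by (rule eventually_neq_at_within)
    ultimately have "\<forall>\<^sub>F z in at 0. F z \<noteq> 0"
    proof eventually_elim
      case (elim z)
      then have "z - Z k \<noteq> 0" if "k \<in> K0" for k using that by force
      then show ?case using elim finK0 by (simp add: F_def q_def)
    qed
    then have "\<exists>z. F z \<noteq> 0" using eventually_happens[of "\<lambda>z. F z \<noteq> 0" "at (0::complex)"] by auto
    then show ?thesis by auto
  qed
  have van: "finite {k. Z k = w} \<and> int (card {k. Z k = w}) \<le> zorder F w" for w
  proof -
    have finw: "finite {k. Z k = w}" by (rule finite_subset[OF _ fin[of "norm w"]]) auto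
    have "\<exists>B. \<forall>z\<in>ball w 1. norm (F z) \<le> B * norm (z - w) ^ card {k. Z k = w}"
    proof (cases "norm w \<le> \<rho>")
      case True
      define J where "J = {k. Z k = w}"
      have JK: "J \<subseteq> K0" using True by (auto simp: J_def K0_def)
      define h where "h = (\<lambda>z. (\<Prod>k\<in>K0 - J. z - Z k) * g z)"
      have Fh: "F z = (z - w) ^ card J * h z" for z
      proof -
        have "q z = (\<Prod>k\<in>K0 - J. z - Z k) * (\<Prod>k\<in>J. z - Z k)" unfolding q_def by (rule prod.subset_diff[OF JK finK0])
        also have "(\<Prod>k\<in>J. z - Z k) = (\<Prod>k\<in>J. z - w)" by (rule prod.cong) (auto simp: J_def)
        finally show ?thesis by (simp add: F_def h_def mult_ac)
      qed
      have "continuous_on (cball w 1) h" unfolding h_def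
        by (intro continuous_intros holomorphic_on_imp_continuous_on holomorphic_on_subset[OF g(1)]) auto
      then have "bounded (h ` cball w 1)" by (intro compact_imp_bounded compact_continuous_image) auto
      then obtain B where B: "\<And>z. z \<in> cball w 1 \<Longrightarrow> norm (h z) \<le> B" by (force simp: bounded_iff)
      have "norm (F z) \<le> B * norm (z - w) ^ card J" if "z \<in> ball w 1" for z
      proof -
        have "norm (h z) \<le> B" using B[of z] that by simp
        then have "norm (h z) * norm (z - w) ^ card J \<le> B * norm (z - w) ^ card J" by (intro mult_right_mono) auto
        then show ?thesis unfolding Fh norm_mult norm_power by (simp only: mult.commute)
      qed
      then show ?thesis unfolding J_def by blast
    next
      case False
      then obtain B where B: "\<forall>z\<in>ball w 1. norm (g z) \<le> B * norm (z - w) ^ card {k. Z k = w}" using gvan[of w] by force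
      have "norm (F z) \<le> ((norm w + 1 + \<rho>) ^ card K0 * B) * norm (z - w) ^ card {k. Z k = w}" if z: "z \<in> ball w 1" for z
      proof -
        have "norm z \<le> norm w + 1" using z norm_triangle_ineq2[of z w] by (simp add: dist_norm norm_minus_commute)
        then have "(norm z + \<rho>) ^ card K0 \<le> (norm w + 1 + \<rho>) ^ card K0" using \<rho> by (intro power_mono) auto
        then have q1: "norm (q z) \<le> (norm w + 1 + \<rho>) ^ card K0" using qle[of z] by (rule order_trans[rotated])
        have "0 \<le> (norm w + 1 + \<rho>) ^ card K0" using \<rho> by simp
        then show ?thesis unfolding F_def norm_mult mult.assoc by (intro mult_mono[OF q1 bspec[OF B z]]) auto
      qed
      then show ?thesis by blast
    qed
    then obtain B where B: "\<forall>z\<in>ball w 1. norm (F z) \<le> B * norm (z - w) ^ card {k. Z k = w}" by blast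
    then have "int (card {k. Z k = w}) \<le> zorder F w"
      by (intro zorder_ge_of_bound[OF holF nzF zero_less_one, of w B]) auto
    then show ?thesis using finw by simp
  qed
  have typeF: "entire_of_exponential_type F"
  proof (rule exponential_typeI[OF holF])
    fix z
    have "norm (q z) \<le> exp (real (card K0) * (\<rho> + norm z))"
    proof -
      have "norm z + \<rho> \<le> exp (\<rho> + norm z)" using exp_ge_add_one_self[of "\<rho> + norm z"] by linarith
      then have "(norm z + \<rho>) ^ card K0 \<le> exp (\<rho> + norm z) ^ card K0"
        by (rule power_mono) (use \<rho> in simp)
      then show ?thesis using qle[of z] unfolding exp_of_nat_mult by linarith
    qed
    then have "norm (F z) \<le> exp (real (card K0) * (\<rho> + norm z)) * H (norm z)"
      unfolding F_def norm_mult by (intro mult_mono gH) auto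
    also have "H (norm z) = exp (ln 2) * exp (2 * G) * exp (D * norm z + E * (1 + norm z))" by (simp add: H_def)
    also have "exp (real (card K0) * (\<rho> + norm z)) * \<dots> = exp ((real (card K0) * \<rho> + ln 2 + 2 * G + E) + (real (card K0) + D + E) * norm z)"
      unfolding exp_add [symmetric] by (simp add: algebra_simps)
    finally show "norm (F z) \<le> exp ((real (card K0) * \<rho> + ln 2 + 2 * G + E) + (real (card K0) + D + E) * norm z)" .
  qed
  have Fim: "\<exists>C K. \<forall>r\<ge>1. norm (F (of_real r * u)) \<le> exp (C + (pi * b + \<epsilon>) * r + K * ln (1 + r\<^sup>2))"
    if \<epsilon>: "0 < \<epsilon>" and u: "u = \<i> \<or> u = - \<i>" for \<epsilon> u
  proof -
    obtain K where K: "0 \<le> K" "\<And>y. norm (g (\<i> * of_real y)) \<le> 2 * exp (2 * G) * exp ((pi * b + \<epsilon>) * \<bar>y\<bar> + K * ln (1 + y\<^sup>2))"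
      using gim[OF \<epsilon>] by blast
    have "norm (F (of_real r * u)) \<le> exp ((real (card K0) * ln (1 + \<rho>) + ln 2 + 2 * G) + (pi * b + \<epsilon>) * r + (real (card K0) + K) * ln (1 + r\<^sup>2))"
      if r: "1 \<le> r" for r
    proof -
      have gg: "norm (g (of_real r * u)) \<le> 2 * exp (2 * G) * exp ((pi * b + \<epsilon>) * r + K * ln (1 + r\<^sup>2))"
        using u K(2)[of r] K(2)[of "- r"] r by (auto simp: mult.commute)
      have "r * 1 \<le> r * r" using r by (intro mult_left_mono) auto
      then have "r + \<rho> \<le> (1 + \<rho>) * (1 + r\<^sup>2)"
      proof -
        have "0 \<le> \<rho> * r\<^sup>2" using \<rho> by simp
        then show ?thesis using \<open>r * 1 \<le> r * r\<close> by (simp add: algebra_simps power2_eq_square)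
      qed
      moreover have p1: "0 < 1 + r\<^sup>2" "0 < 1 + \<rho>" using \<rho> by (auto simp: add_pos_nonneg)
      moreover have "exp (ln (1 + \<rho>) + ln (1 + r\<^sup>2)) = (1 + \<rho>) * (1 + r\<^sup>2)" using p1 by (simp add: exp_add)
      ultimately have base: "r + \<rho> \<le> exp (ln (1 + \<rho>) + ln (1 + r\<^sup>2))" by simp
      have nu: "norm (of_real r * u) = r" using u r by (auto simp: norm_mult)
      have "norm (q (of_real r * u)) \<le> (r + \<rho>) ^ card K0" using qle[of "of_real r * u"] nu by simp
      also have "\<dots> \<le> exp (ln (1 + \<rho>) + ln (1 + r\<^sup>2)) ^ card K0" by (rule power_mono[OF base]) (use r \<rho> in simp)
      also have "\<dots> = exp (real (card K0) * (ln (1 + \<rho>) + ln (1 + r\<^sup>2)))" by (rule exp_of_nat_mult [symmetric])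
      finally have "norm (F (of_real r * u)) \<le> exp (real (card K0) * (ln (1 + \<rho>) + ln (1 + r\<^sup>2))) * (2 * exp (2 * G) * exp ((pi * b + \<epsilon>) * r + K * ln (1 + r\<^sup>2)))"
        unfolding F_def norm_mult using gg by (intro mult_mono) auto
      also have "2 * exp (2 * G) * exp ((pi * b + \<epsilon>) * r + K * ln (1 + r\<^sup>2)) = exp (ln 2) * exp (2 * G) * exp ((pi * b + \<epsilon>) * r + K * ln (1 + r\<^sup>2))" by simp
      also have "exp (real (card K0) * (ln (1 + \<rho>) + ln (1 + r\<^sup>2))) * \<dots> =
         exp ((real (card K0) * ln (1 + \<rho>) + ln 2 + 2 * G) + (pi * b + \<epsilon>) * r + (real (card K0) + K) * ln (1 + r\<^sup>2))"
        unfolding exp_add [symmetric] by (simp only: distrib_left distrib_right add_ac)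
      finally show ?thesis .
    qed
    then show ?thesis by blast
  qed
  have cm: "cis (- pi / 2) = - \<i>" by (simp add: complex_eq_iff)
  have "growth_indicator F (pi / 2) \<le> ereal (pi * b)" by (rule growth_indicator_le) (use Fim[of _ \<i>] in simp)
  moreover have "growth_indicator F (- pi / 2) \<le> ereal (pi * b)"
    by (rule growth_indicator_le) (unfold cm, use Fim[of _ "- \<i>"] in blast)
  moreover have "vanishes_on F Z" using van by (simp add: vanishes_on_def)
  ultimately show ?thesis using typeF nzF by blast
qed

theorem mainTheorem2:
  fixes Z :: "nat \<Rightarrow> complex" and b :: real
  assumes "no_limit_points Z"
    and "separated_from_imaginary_axis Z"
    and "0 \<le> b"
  shows "(\<exists>f. entire_of_exponential_type f \<and> f \<noteq> (\<lambda>_. 0) \<and> vanishes_on f Z \<and>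
              growth_indicator f (pi / 2) \<le> ereal (pi * b) \<and>
              growth_indicator f (- pi / 2) \<le> ereal (pi * b))
     \<longleftrightarrow>
         (\<exists>C::real. \<exists>d::real \<Rightarrow> real.
              0 \<le> C \<and> (\<forall>x\<ge>0. 0 \<le> d x) \<and> bounded (d ` {0..}) \<and> (d \<longlongrightarrow> 0) at_top \<and>
              (\<forall>r R. 0 < r \<and> r < R \<longrightarrow>
                 log_submeasure Z r R \<le> (b + d R) * ln (R / r) + C))"
proof
  assume "\<exists>f. entire_of_exponential_type f \<and> f \<noteq> (\<lambda>_. 0) \<and> vanishes_on f Z \<and>
              growth_indicator f (pi / 2) \<le> ereal (pi * b) \<and>
              growth_indicator f (- pi / 2) \<le> ereal (pi * b)"
  then show "\<exists>C::real. \<exists>d::real \<Rightarrow> real.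
              0 \<le> C \<and> (\<forall>x\<ge>0. 0 \<le> d x) \<and> bounded (d ` {0..}) \<and> (d \<longlongrightarrow> 0) at_top \<and>
              (\<forall>r R. 0 < r \<and> r < R \<longrightarrow>
                 log_submeasure Z r R \<le> (b + d R) * ln (R / r) + C)"
    using log_submeasure_bound_of_entire_function[OF assms(1,3)] by blast
next
  assume "\<exists>C::real. \<exists>d::real \<Rightarrow> real. 0 \<le> C \<and> (\<forall>x\<ge>0. 0 \<le> d x) \<and> bounded (d ` {0..}) \<and> (d \<longlongrightarrow> 0) at_top \<and>
              (\<forall>r R. 0 < r \<and> r < R \<longrightarrow> log_submeasure Z r R \<le> (b + d R) * ln (R / r) + C)"
  then obtain C :: real and d :: "real \<Rightarrow> real" where
    "0 \<le> C" "\<forall>x\<ge>0. 0 \<le> d x" "bounded (d ` {0..})" "(d \<longlongrightarrow> 0) at_top"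
    "\<forall>r R. 0 < r \<and> r < R \<longrightarrow> log_submeasure Z r R \<le> (b + d R) * ln (R / r) + C"
    by blast
  then show "\<exists>f. entire_of_exponential_type f \<and> f \<noteq> (\<lambda>_. 0) \<and> vanishes_on f Z \<and>
              growth_indicator f (pi / 2) \<le> ereal (pi * b) \<and>
              growth_indicator f (- pi / 2) \<le> ereal (pi * b)"
    by (intro entire_function_of_log_submeasure_bound[OF assms, of C d]) auto
qed

end
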